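(* Let $N\ge2$ and $v\in\mathbb{R}^N$ with $|v|<1$. The quantity $d_p(a)=\inf_{\varphi\in\mathcal{S}_a}E_p(\varphi)$ satisfies: (i) if $2<p<2+\frac2N$, $a>0$ and $m>m_p^*(a)$, then $d_p(a)<-\frac12\left(1-\sqrt{1-|v|^2}\right)ma$; (ii) if $p=2+\frac2N$, $0<a<a_v^*$ and $m>m_p^*(a)$, then $d_p(a)<-\frac12\left(1-\sqrt{1-|v|^2}\right)ma$; (iii) if $p=2+\frac2N$, $a\ge a_v^*$ and $m>0$, then $d_p(a)=-\infty$; (iv) if $2+\frac2N<p\le\frac{2N}{N-1}$ and $a,m>0$, then $d_p(a)=-\infty$.
   Context: Functions are complex-valued on $\mathbb{R}^N$ unless stated otherwise; $\|\cdot\|_q$ is the $L^q(\mathbb{R}^N)$ norm; $\hat u$ is the (unitary) Fourier transform. $H^{1/2}(\mathbb{R}^N)$ is the usual fractional Sobolev space and $W^{1/2}(\mathbb{R}^N):=\{\varphi\in H^{1/2}(\mathbb{R}^N): |\varphi|^2\log|\varphi|^2\in L^1(\mathbb{R}^N)\}$ (with $0\log 0=0$). For $m>0$ the operator $\sqrt{-\Delta+m^2}-m$ is the Fourier multiplier with symbol $\sqrt{|k|^2+m^2}-m$, and $\int\bar\varphi(\sqrt{-\Delta+m^2}-m+iv\cdot\nabla)\varphi\,dx$ is understood as the quadratic form $\int_{\mathbb{R}^N}(\sqrt{|k|^2+m^2}-m-v\cdot k)|\hat\varphi(k)|^2\,dk$ on $H^{1/2}(\mathbb{R}^N)$. For $a>0$: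 $\mathcal{S}_a:=\{\varphi\in W^{1/2}(\mathbb{R}^N):\|\varphi\|_2^2=a\}$, and $$E_p(\varphi):=\frac12\int_{\mathbb{R}^N}\bar\varphi(\sqrt{-\Delta+m^2}-m+iv\cdot\nabla)\varphi\,dx-\frac1p\|\varphi\|_p^p-\frac12\int_{\mathbb{R}^N}|\varphi|^2(\log|\varphi|^2-1)\,dx,\qquad d_p(a):=\inf_{\varphi\in\mathcal{S}_a}E_p(\varphi).$$ Let $\mathcal{X}_a:=\{u\in\mathcal{S}_a\cap C_c^\infty(\mathbb{R}^N,\mathbb{R}):\int_{\mathbb{R}^N}|u|^2(\log|u|^2-1)\,dx\ge0\}$ (a non-empty set), and for $2<p\le 2+\frac2N$ let $$m_p^*(a):=\frac{p\sqrt{1-|v|^2}}{4}\inf_{u\in\mathcal{X}_a}\frac{\|\nabla u\|_2^2}{\|u\|_p^p}.$$ Let $T_v(u):=\int_{\mathbb{R}^N}\bar u(\sqrt{-\Delta}+iv\cdot\nabla)u\,dx=\int_{\mathbb{R}^N}(|k|-v\cdot k)|\hat u|^2\,dk$. Set $a_v^*:=\|Q_v\|_2^2$, where $Q_v\in H^{1/2}(\mathbb{R}^N)\setminus\{0\}$ solves $(\sqrt{-\Delta}+iv\cdot\nabla)u+u=|u|^{2/N}u$ and attains equality in the sharp Gagliardo–Nirenberg type inequality, valid for all $u\in H^{1/2}(\mathbb{R}^N)$, $$\|u\|_{2+\frac2N}^{2+\frac2N}\le\frac{N+1}{N\|Q_v\|_2^{2/N}}\,T_v(u)\,\|u\|_2^{2/N}.$$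 Such $Q_v$ is known to exist, and the number $a_v^*$ is well defined (independent of the choice of $Q_v$). *)

theory Defs
  imports "HOL-Analysis.Analysis"
begin

text \<open>
  Elements of \<open>L\<^sup>q\<close> are represented by Borel measurable functions on \<open>\<real>\<^sup>N = real ^ 'n\<close>, where
  \<open>N = CARD('n)\<close>.  Every quantity below depends only on the almost-everywhere class, so infima
  over functions and over classes agree.

  Real-valued integrals are Bochner integrals, which are 0 on non-integrable functions.  On the
  sets where they are used (\<open>H\<^sup>1\<^sup>/\<^sup>2\<close>, and \<open>W\<^sup>1\<^sup>/\<^sup>2\<close> for the logarithmic term), the integrands below are
  integrable for all exponents \<open>2 \<le> q \<le> 2N/(N - 1)\<close>, by the Sobolev embedding.
\<close>

definition Lnorm :: "real \<Rightarrow> (real ^ 'n \<Rightarrow> complex) \<Rightarrow> real" where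
  "Lnorm q u = (LINT x|lborel. norm (u x) powr q) powr (1 / q)"

definition L1_set :: "(real ^ 'n \<Rightarrow> complex) set" where
  "L1_set = {u \<in> borel_measurable lborel. integrable lborel (\<lambda>x. norm (u x))}"

definition L2_set :: "(real ^ 'n \<Rightarrow> complex) set" where
  "L2_set = {u \<in> borel_measurable lborel. integrable lborel (\<lambda>x. (norm (u x))\<^sup>2)}"

definition fourier_integral :: "(real ^ 'n \<Rightarrow> complex) \<Rightarrow> real ^ 'n \<Rightarrow> complex" where
  "fourier_integral u k =
     complex_of_real ((2 * pi) powr (- real CARD('n) / 2)) * (LINT x|lborel. cis (- (k \<bullet> x)) * u x)"

definition L2_tendsto ::
  "(nat \<Rightarrow> real ^ 'n \<Rightarrow> complex) \<Rightarrow> (real ^ 'n \<Rightarrow> complex) \<Rightarrow> bool" where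
  "L2_tendsto f g \<longleftrightarrow>
     (\<lambda>j. \<integral>\<^sup>+ x. ennreal ((norm (f j x - g x))\<^sup>2) \<partial>lborel) \<longlonglongrightarrow> 0"

text \<open>
  The Fourier transform on \<open>L\<^sup>2\<close> is the continuous extension of the Fourier integral from
  \<open>L\<^sup>1 \<inter> L\<^sup>2\<close>; it exists and is unique up to null sets by Plancherel's theorem.
\<close>

definition is_fourier :: "(real ^ 'n \<Rightarrow> complex) \<Rightarrow> (real ^ 'n \<Rightarrow> complex) \<Rightarrow> bool" where
  "is_fourier u g \<longleftrightarrow> u \<in> L2_set \<and> g \<in> L2_set \<and>
     (\<exists>f. (\<forall>j. f j \<in> L1_set \<inter> L2_set) \<and> L2_tendsto f u \<and>
          L2_tendsto (\<lambda>j. fourier_integral (f j)) g)"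

definition fourier :: "(real ^ 'n \<Rightarrow> complex) \<Rightarrow> real ^ 'n \<Rightarrow> complex" where
  "fourier u = (SOME g. is_fourier u g)"

definition H_half :: "(real ^ 'n \<Rightarrow> complex) set" where
  "H_half = {u \<in> L2_set.
     integrable lborel (\<lambda>k. sqrt (1 + (norm k)\<^sup>2) * (norm (fourier u k))\<^sup>2)}"

text \<open>The convention \<open>0 log 0 = 0\<close> holds because of the factor \<open>0\<close>.\<close>

definition W_half :: "(real ^ 'n \<Rightarrow> complex) set" where
  "W_half = {u \<in> H_half. integrable lborel (\<lambda>x. (norm (u x))\<^sup>2 * ln ((norm (u x))\<^sup>2))}"

definition mass_sphere :: "real \<Rightarrow> (real ^ 'n \<Rightarrow> complex) set" where
  "mass_sphere a = {u \<in> W_half. (Lnorm 2 u)\<^sup>2 = a}"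

definition kinetic :: "real ^ 'n \<Rightarrow> real \<Rightarrow> (real ^ 'n \<Rightarrow> complex) \<Rightarrow> real" where
  "kinetic v m u =
     (LINT k|lborel. (sqrt ((norm k)\<^sup>2 + m\<^sup>2) - m - v \<bullet> k) * (norm (fourier u k))\<^sup>2)"

definition log_term :: "(real ^ 'n \<Rightarrow> complex) \<Rightarrow> real" where
  "log_term u = (LINT x|lborel. (norm (u x))\<^sup>2 * (ln ((norm (u x))\<^sup>2) - 1))"

definition energy ::
  "real ^ 'n \<Rightarrow> real \<Rightarrow> real \<Rightarrow> (real ^ 'n \<Rightarrow> complex) \<Rightarrow> real" where
  "energy v m p u =
     1 / 2 * kinetic v m u - 1 / p * Lnorm p u powr p - 1 / 2 * log_term u"

definition min_energy :: "real ^ 'n \<Rightarrow> real \<Rightarrow> real \<Rightarrow> real \<Rightarrow> ereal" where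
  "min_energy v m p a = (INF u \<in> mass_sphere a. ereal (energy v m p u))"

definition partial_deriv :: "'n \<Rightarrow> (real ^ 'n \<Rightarrow> real) \<Rightarrow> real ^ 'n \<Rightarrow> real" where
  "partial_deriv i f x = frechet_derivative f (at x) (axis i 1)"

text \<open>\<open>C_k j f\<close>: the function \<open>f\<close> is of class \<open>C\<^sup>j\<close> on the whole space.\<close>

primrec C_k :: "nat \<Rightarrow> (real ^ 'n \<Rightarrow> real) \<Rightarrow> bool" where
  "C_k 0 f \<longleftrightarrow> continuous_on UNIV f"
| "C_k (Suc j) f \<longleftrightarrow> f differentiable_on UNIV \<and> (\<forall>i. C_k j (partial_deriv i f))"

definition Cc_infinity :: "(real ^ 'n \<Rightarrow> real) set" where
  "Cc_infinity = {f. (\<forall>j. C_k j f) \<and> compact (closure {x. f x \<noteq> 0})}"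

definition grad_norm_sq :: "(real ^ 'n \<Rightarrow> real) \<Rightarrow> real" where
  "grad_norm_sq f = (LINT x|lborel. (\<Sum>i\<in>UNIV. (partial_deriv i f x)\<^sup>2))"

definition X_set :: "real \<Rightarrow> (real ^ 'n \<Rightarrow> real) set" where
  "X_set a = {u \<in> Cc_infinity. (\<lambda>x. complex_of_real (u x)) \<in> mass_sphere a \<and>
     log_term (\<lambda>x. complex_of_real (u x)) \<ge> 0}"

definition m_star :: "real ^ 'n \<Rightarrow> real \<Rightarrow> real \<Rightarrow> ereal" where
  "m_star v p a = ereal (p * sqrt (1 - (norm v)\<^sup>2) / 4) *
     (INF u \<in> (X_set a :: (real ^ 'n \<Rightarrow> real) set).
        ereal (grad_norm_sq u / Lnorm p (\<lambda>x. complex_of_real (u x)) powr p))"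

definition T_form :: "real ^ 'n \<Rightarrow> (real ^ 'n \<Rightarrow> complex) \<Rightarrow> real" where
  "T_form v u = (LINT k|lborel. (norm k - v \<bullet> k) * (norm (fourier u k))\<^sup>2)"

text \<open>
  Weak solutions in \<open>H\<^sup>1\<^sup>/\<^sup>2\<close> of \<open>(\<surd>(-\<Delta>) + i v \<cdot> \<nabla>) u + u = |u|\<^bsup>2/N\<^esup> u\<close>: the linear part is
  tested through its Fourier multiplier \<open>|k| - v \<cdot> k + 1\<close>.
\<close>

definition half_laplace_solution :: "real ^ 'n \<Rightarrow> (real ^ 'n \<Rightarrow> complex) \<Rightarrow> bool" where
  "half_laplace_solution v u \<longleftrightarrow> u \<in> H_half \<and>
     (\<forall>w \<in> H_half.
        (LINT k|lborel. complex_of_real (norm k - v \<bullet> k + 1) * fourier u k * cnj (fourier w k)) =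
        (LINT x|lborel. complex_of_real (norm (u x) powr (2 / real CARD('n))) * u x * cnj (w x)))"

definition GN_optimizer :: "real ^ 'n \<Rightarrow> (real ^ 'n \<Rightarrow> complex) \<Rightarrow> bool" where
  "GN_optimizer v Q \<longleftrightarrow>
     (let N = real CARD('n); q = 2 + 2 / N;
          rhs = (\<lambda>u. (N + 1) / (N * Lnorm 2 Q powr (2 / N)) * T_form v u * Lnorm 2 u powr (2 / N))
      in half_laplace_solution v Q \<and> \<not> (AE x in lborel. Q x = 0) \<and>
         (\<forall>u \<in> H_half. Lnorm q u powr q \<le> rhs u) \<and>
         Lnorm q Q powr q = rhs Q)"

end

theory Submission
  imports Defs "HOL-Probability.Characteristic_Functions" "HOL-Real_Asymp.Real_Asymp"
begin

text \<open>
  Parts (i) and (ii) are an energy comparison with a boosted test function.  For real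
  \<open>u \<in> C\<^sub>c\<^sup>\<infinity>\<close> put \<open>\<phi>(x) = e\<^bsup>i k\<^sub>0 \<cdot> x\<^esup> u(x)\<close>, where \<open>k\<^sub>0 = m v / \<surd>(1 - |v|\<^sup>2)\<close> minimises the symbol
  \<open>\<surd>(|k|\<^sup>2 + m\<^sup>2) - m - v \<cdot> k\<close>; its minimum \<open>- m (1 - \<surd>(1 - |v|\<^sup>2))\<close> is the constant of the theorem.
  Concavity of the square root bounds the excess over the minimum at \<open>k\<^sub>0 + k\<close> by
  \<open>\<surd>(1 - |v|\<^sup>2) |k|\<^sup>2 / (2 m)\<close> (\<open>boosted_symbol_le\<close>), so the kinetic excess is a multiple of
  \<open>\<parallel>\<nabla>u\<parallel>\<^sup>2\<close>.  The condition \<open>m > m\<^sub>p\<^sup>*(a)\<close> says that some admissible \<open>u\<close> has a nonlinear term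
  exceeding this excess, and its logarithmic term has the favourable sign
  (\<open>min_energy_below_threshold\<close>).

  Parts (iii) and (iv) follow from the dilations \<open>u\<^sub>c(x) = c\<^bsup>N/2\<^esup> u(c x)\<close>, \<open>c \<rightarrow> \<infinity>\<close>.  They keep the
  mass; the kinetic energy grows at most like \<open>c T\<^sub>v(u) / 2\<close>, the power term is multiplied by
  \<open>c\<^bsup>N(p/2 - 1)\<^esup>\<close>, and the logarithmic term contributes \<open>- N a log c / 2\<close>.  Hence the infimum is
  \<open>- \<infinity>\<close> as soon as the power term eventually beats the kinetic one
  (\<open>min_energy_eq_minus_infinity\<close>).  In the supercritical case any Gaussian will do.  In the critical
  case both grow linearly, and a multiple of the optimizer \<open>Q\<^sub>v\<close> of mass \<open>a \<ge> a\<^sub>v\<^sup>*\<close> makes the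
  difference nonpositive; at \<open>a = a\<^sub>v\<^sup>*\<close> it vanishes and the logarithm alone decides.

  This use of \<open>Q\<^sub>v\<close> requires \<open>|Q\<^sub>v|\<^sup>2 log |Q\<^sub>v|\<^sup>2 \<in> L\<^sup>1\<close>, that is, some decay, whereas only
  \<open>Q\<^sub>v \<in> H\<^sup>1\<^sup>/\<^sup>2\<close> is given.  The decay comes from the equation (\<open>GN_optimizer_oscillation\<close>): testing it
  with \<open>|e\<^bsup>i \<xi> \<cdot> x\<^esup> - 1|\<^sup>2 Q\<^sub>v\<close> bounds the form of \<open>\<surd>(-\<Delta>) + i v \<cdot> \<nabla> + 1\<close> at
  \<open>(e\<^bsup>i \<xi> \<cdot> x\<^esup> - 1) Q\<^sub>v\<close> by a nonlinear term and a commutator of order \<open>|\<xi>|\<^sup>2\<close>.  Where \<open>|x|\<close> is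
  bounded, so is the nonlinear term by \<open>O(|\<xi>|\<^sup>2)\<close>; on the tail it is a small multiple of the form
  itself, by the Gagliardo-Nirenberg inequality.  Dividing by \<open>|\<xi>|\<^sup>2\<close> and letting \<open>\<xi> \<rightarrow> 0\<close> gives a
  finite second moment, which controls the entropy where \<open>Q\<^sub>v\<close> is small.

  All of this uses the Fourier transform on \<open>L\<^sup>2\<close>: Plancherel's theorem, existence and uniqueness of
  the transform, and its behaviour under modulations and dilations.
\<close>

section \<open>Integration on Euclidean space\<close>

lemma borel_measurable_cis [measurable (raw)]:
  "f \<in> borel_measurable M \<Longrightarrow> (\<lambda>x. cis (f x)) \<in> borel_measurable M"
  by (rule borel_measurable_continuous_on[where f = cis]) (auto intro: continuous_intros)

lemma nn_integral_affine:
  fixes f :: "'a::euclidean_space \<Rightarrow> ennreal"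
  assumes [measurable]: "f \<in> borel_measurable borel" and c: "c \<noteq> 0"
  shows "(\<integral>\<^sup>+x. f x \<partial>lborel) = ennreal (\<bar>c\<bar> ^ DIM('a)) * (\<integral>\<^sup>+x. f (t + c *\<^sub>R x) \<partial>lborel)"
  by (subst lborel_affine[OF c, of t])
     (simp add: nn_integral_density nn_integral_distr nn_integral_cmult)

lemma integrable_affine:
  fixes f :: "'a::euclidean_space \<Rightarrow> 'b :: {banach, second_countable_topology}"
  assumes f: "integrable lborel f" and c: "c \<noteq> 0"
  shows "integrable lborel (\<lambda>x. f (t + c *\<^sub>R x))"
proof -
  have [measurable]: "f \<in> borel_measurable borel"
    using f by auto
  have "(\<integral>\<^sup>+x. norm (f x) \<partial>lborel) = ennreal (\<bar>c\<bar> ^ DIM('a)) * (\<integral>\<^sup>+x. norm (f (t + c *\<^sub>R x)) \<partial>lborel)"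
    by (rule nn_integral_affine) (use c in auto)
  moreover have "(\<integral>\<^sup>+x. norm (f x) \<partial>lborel) < \<infinity>"
    using f by (simp add: integrable_iff_bounded)
  moreover have "ennreal (\<bar>c\<bar> ^ DIM('a)) \<noteq> 0"
    using c by (simp add: ennreal_eq_0_iff not_le)
  ultimately have "(\<integral>\<^sup>+x. norm (f (t + c *\<^sub>R x)) \<partial>lborel) < \<infinity>"
    by (auto simp: ennreal_mult_less_top)
  then show ?thesis by (intro integrableI_bounded) auto
qed

lemma integral_affine:
  fixes f :: "'a::euclidean_space \<Rightarrow> 'b :: {banach, second_countable_topology}"
  assumes f: "integrable lborel f" and c: "c \<noteq> 0"
  shows "(\<integral>x. f x \<partial>lborel) = (\<bar>c\<bar> ^ DIM('a)) *\<^sub>R (\<integral>x. f (t + c *\<^sub>R x) \<partial>lborel)"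
proof -
  have [measurable]: "f \<in> borel_measurable borel" using f by auto
  show ?thesis
    by (subst lborel_affine[OF c, of t]) (simp add: integral_density integral_distr)
qed

lemmas nn_integral_translation = nn_integral_affine[where c = 1, simplified]
lemmas integrable_translation = integrable_affine[where c = 1, simplified]
lemmas integral_translation = integral_affine[where c = 1, simplified]

lemma
  fixes f :: "'a::euclidean_space \<Rightarrow> real \<Rightarrow> complex"
  assumes f: "\<And>b. b \<in> Basis \<Longrightarrow> integrable lborel (f b)"
  shows integrable_lborel_prod: "integrable lborel (\<lambda>x::'a. \<Prod>b\<in>Basis. f b (x \<bullet> b))"
    and integral_lborel_prod:
      "(\<integral>x. (\<Prod>b\<in>Basis. f b ((x::'a) \<bullet> b)) \<partial>lborel) = (\<Prod>b\<in>Basis. (\<integral>t. f b t \<partial>lborel))"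
proof -
  interpret product_sigma_finite "\<lambda>_::'a. lborel :: real measure" ..
  have m [measurable]: "\<And>b. b \<in> Basis \<Longrightarrow> f b \<in> borel_measurable borel"
    using f borel_measurable_integrable by fastforce
  have eq: "(\<Prod>b\<in>Basis. f b ((\<Sum>c\<in>Basis. y c *\<^sub>R c) \<bullet> b)) = (\<Prod>b\<in>Basis. f b (y b))" for y :: "'a \<Rightarrow> real"
    by (intro prod.cong) auto
  have m2 [measurable]: "(\<lambda>x::'a. \<Prod>b\<in>Basis. f b (x \<bullet> b)) \<in> borel_measurable borel"
    by measurable
  show "integrable lborel (\<lambda>x::'a. \<Prod>b\<in>Basis. f b (x \<bullet> b))"
    unfolding lborel_eq[where 'a='a]
    by (subst integrable_distr_eq) (simp_all add: eq product_integrable_prod f)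
  show "(\<integral>x. (\<Prod>b\<in>Basis. f b ((x::'a) \<bullet> b)) \<partial>lborel) = (\<Prod>b\<in>Basis. (\<integral>t. f b t \<partial>lborel))"
    unfolding lborel_eq[where 'a='a]
    by (subst integral_distr) (simp_all add: eq product_integral_prod f)
qed

lemma integrable_pair_bounded:
  fixes f g :: "'a::euclidean_space \<Rightarrow> complex"
  assumes f: "integrable lborel f" and g: "integrable lborel g"
    and b [measurable]: "b \<in> borel_measurable (lborel \<Otimes>\<^sub>M lborel)" and b1: "\<And>x y. norm (b (x, y)) \<le> 1"
  shows "integrable (lborel \<Otimes>\<^sub>M lborel) (\<lambda>(x, y). b (x, y) * (f x * g y) :: complex)"
proof (rule integrableI_bounded)
  have [measurable]: "f \<in> borel_measurable borel" "g \<in> borel_measurable borel"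
    using f g by auto
  show "(\<lambda>(x, y). b (x, y) * (f x * g y)) \<in> borel_measurable (lborel \<Otimes>\<^sub>M lborel)"
    by measurable
  have "(\<integral>\<^sup>+ p. norm (case p of (x, y) \<Rightarrow> b (x, y) * (f x * g y)) \<partial>(lborel \<Otimes>\<^sub>M lborel))
     \<le> (\<integral>\<^sup>+ p. ennreal (norm (f (fst p))) * ennreal (norm (g (snd p))) \<partial>(lborel \<Otimes>\<^sub>M lborel))"
    using b1 by (intro nn_integral_mono)
       (auto simp: norm_mult ennreal_mult[symmetric] intro!: ennreal_leI mult_left_le_one_le)
  also have "\<dots> = (\<integral>\<^sup>+ x. \<integral>\<^sup>+ y. ennreal (norm (f x)) * ennreal (norm (g y)) \<partial>lborel \<partial>lborel)"
    by (subst lborel.nn_integral_fst[symmetric]) simp_all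
  also have "\<dots> = (\<integral>\<^sup>+ x. ennreal (norm (f x)) \<partial>lborel) * (\<integral>\<^sup>+ y. ennreal (norm (g y)) \<partial>lborel)"
    by (simp add: nn_integral_cmult nn_integral_multc)
  also have "\<dots> < \<infinity>"
    using f g by (simp add: integrable_iff_bounded ennreal_mult_less_top)
  finally show "(\<integral>\<^sup>+ p. norm (case p of (x, y) \<Rightarrow> b (x, y) * (f x * g y)) \<partial>(lborel \<Otimes>\<^sub>M lborel)) < \<infinity>" .
qed

section \<open>Gaussians\<close>

definition gauss :: "'a::euclidean_space \<Rightarrow> real" where
  "gauss x = exp (- (norm x)\<^sup>2 / 2)"

lemma gauss_pos: "gauss x > 0"
  by (simp add: gauss_def)

lemma borel_measurable_gauss [measurable]: "gauss \<in> borel_measurable borel"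
  unfolding gauss_def by measurable

lemma gauss_real_integrable: "integrable lborel (\<lambda>t::real. cis (- (s * t)) * complex_of_real (exp (- t\<^sup>2 / 2)))"
proof -
  have "integrable lborel (\<lambda>t. sqrt (2 * pi) * std_normal_density t)"
    by (intro integrable_mult_right integrable_normal_density) simp
  then have "integrable lborel (\<lambda>t::real. exp (- t\<^sup>2 / 2))"
    by (simp add: std_normal_density_def)
  then show ?thesis
    by (rule Bochner_Integration.integrable_bound) (auto simp: norm_mult)
qed

lemma gauss_real_integral:
  "(\<integral>t. cis (- (s * t)) * complex_of_real (exp (- t\<^sup>2 / 2)) \<partial>lborel) = complex_of_real (sqrt (2 * pi) * exp (- s\<^sup>2 / 2))"
proof -
  have "complex_of_real (exp (- s\<^sup>2 / 2)) = char std_normal_distribution (- s)"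
    by (simp add: char_std_normal_distribution)
  also have "\<dots> = (\<integral>t. std_normal_density t *\<^sub>R iexp (- s * t) \<partial>lborel)"
    unfolding char_def complex_of_real_def[symmetric]
    by (subst integral_density) auto
  also have "\<dots> = (\<integral>t. complex_of_real (1 / sqrt (2 * pi)) * (cis (- (s * t)) * complex_of_real (exp (- t\<^sup>2 / 2))) \<partial>lborel)"
    by (intro Bochner_Integration.integral_cong)
       (auto simp: std_normal_density_def scaleR_conv_of_real cis_conv_exp mult_ac)
  also have "\<dots> = complex_of_real (1 / sqrt (2 * pi)) * (\<integral>t. cis (- (s * t)) * complex_of_real (exp (- t\<^sup>2 / 2)) \<partial>lborel)"
    by (rule integral_mult_right_zero)
  finally show ?thesis
    by (simp add: field_simps)
qed

lemma gauss_prod: "gauss (x::'a::euclidean_space) = (\<Prod>b\<in>Basis. exp (- (x \<bullet> b)\<^sup>2 / 2))"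
proof -
  have "(norm x)^2 = (\<Sum>b\<in>Basis. (x \<bullet> b)^2)"
    unfolding power2_norm_eq_inner by (subst euclidean_inner) (simp add: power2_eq_square)
  then show ?thesis
    by (simp add: gauss_def exp_sum[symmetric] sum_negf[symmetric] sum_divide_distrib)
qed

lemma cis_inner: "cis (- (k \<bullet> x)) = (\<Prod>b\<in>Basis. cis (- ((k \<bullet> b) * ((x::'a::euclidean_space) \<bullet> b))))"
proof -
  have "cis (\<Sum>b\<in>B. f b) = (\<Prod>b\<in>B. cis (f b))" for B :: "'a set" and f
    by (induction B rule: infinite_finite_induct) (auto simp: cis_mult[symmetric])
  then show ?thesis
    by (subst euclidean_inner) (simp add: sum_negf[symmetric])
qed

lemma gauss_fourier:
  fixes k :: "'a::euclidean_space"
  shows "integrable lborel (\<lambda>x::'a. cis (- (k \<bullet> x)) * complex_of_real (gauss x))"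
    and "(\<integral>x. cis (- (k \<bullet> x)) * complex_of_real (gauss x) \<partial>lborel)
      = complex_of_real ((2 * pi) powr (real DIM('a) / 2) * gauss k)"
proof -
  have eq: "cis (- (k \<bullet> x)) * complex_of_real (gauss x)
     = (\<Prod>b\<in>Basis. cis (- ((k \<bullet> b) * (x \<bullet> b))) * complex_of_real (exp (- (x \<bullet> b)\<^sup>2 / 2)))" for x :: 'a
    by (simp add: gauss_prod cis_inner prod.distrib)
  show "integrable lborel (\<lambda>x::'a. cis (- (k \<bullet> x)) * complex_of_real (gauss x))"
    unfolding eq by (rule integrable_lborel_prod) (rule gauss_real_integrable)
  have "(\<integral>x. cis (- (k \<bullet> x)) * complex_of_real (gauss x) \<partial>lborel)
    = (\<Prod>b\<in>(Basis::'a set). complex_of_real (sqrt (2 * pi) * exp (- (k \<bullet> b)\<^sup>2 / 2)))"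
    unfolding eq by (subst integral_lborel_prod) (simp_all only: gauss_real_integrable gauss_real_integral)
  also have "\<dots> = complex_of_real (sqrt (2 * pi) ^ DIM('a) * gauss k)"
    unfolding of_real_prod[symmetric] prod.distrib by (simp add: gauss_prod)
  also have "sqrt (2 * pi) ^ DIM('a) = (2 * pi) powr (real DIM('a) / 2)"
    by (simp add: powr_half_sqrt[symmetric] powr_realpow[symmetric] powr_powr)
  finally show "(\<integral>x. cis (- (k \<bullet> x)) * complex_of_real (gauss x) \<partial>lborel)
      = complex_of_real ((2 * pi) powr (real DIM('a) / 2) * gauss k)" .
qed

lemma integrable_gauss: "integrable lborel (gauss :: 'a::euclidean_space \<Rightarrow> real)"
  using integrable_norm[OF gauss_fourier(1)[of 0]] by (simp add: gauss_pos abs_of_pos norm_mult)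

lemma integral_gauss:
  "integral\<^sup>L lborel (gauss :: 'a::euclidean_space \<Rightarrow> real) = (2 * pi) powr (real DIM('a) / 2)"
proof -
  have "complex_of_real (integral\<^sup>L lborel (gauss :: 'a \<Rightarrow> real)) = complex_of_real ((2 * pi) powr (real DIM('a) / 2))"
    using gauss_fourier(2)[of "0::'a"] by (simp add: gauss_def[of 0])
  then show ?thesis unfolding of_real_eq_iff .
qed

section \<open>The Fourier integral of integrable functions\<close>

abbreviation fourier_const :: "'n::finite itself \<Rightarrow> real" where
  "fourier_const _ \<equiv> (2 * pi) powr (- real CARD('n) / 2)"

lemma L1_setD [dest]: "f \<in> L1_set \<Longrightarrow> integrable lborel f"
  by (auto simp: L1_set_def integrable_iff_bounded)

lemma L1_setI: "integrable lborel f \<Longrightarrow> f \<in> L1_set"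
  by (auto simp: L1_set_def)

lemma borel_measurable_fourier_integral [measurable]:
  fixes f :: "real ^ 'n \<Rightarrow> complex"
  assumes [measurable]: "f \<in> borel_measurable borel"
  shows "fourier_integral f \<in> borel_measurable borel"
  unfolding fourier_integral_def by measurable

lemma integrable_cis_mult:
  fixes f :: "real ^ 'n \<Rightarrow> complex"
  assumes "integrable lborel f"
  shows "integrable lborel (\<lambda>x. cis (- (k \<bullet> x)) * f x)" "integrable lborel (\<lambda>x. cis (k \<bullet> x) * f x)"
  using assms borel_measurable_integrable[OF assms]
  by (auto intro!: Bochner_Integration.integrable_bound[OF assms] simp: norm_mult)

lemma norm_fourier_integral_le:
  fixes f :: "real ^ 'n \<Rightarrow> complex"
  shows "norm (fourier_integral f k) \<le> fourier_const TYPE('n) * (\<integral>x. norm (f x) \<partial>lborel)"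
proof -
  have "norm (\<integral>x. cis (- (k \<bullet> x)) * f x \<partial>lborel) \<le> (\<integral>x. norm (cis (- (k \<bullet> x)) * f x) \<partial>lborel)"
    by (rule integral_norm_bound)
  then show ?thesis
    by (simp add: fourier_integral_def norm_mult mult_left_mono)
qed

lemma fourier_integral_lincomb:
  fixes f g :: "real ^ 'n \<Rightarrow> complex"
  assumes "integrable lborel f" "integrable lborel g"
  shows "fourier_integral (\<lambda>x. a * f x + b * g x) k = a * fourier_integral f k + b * fourier_integral g k"
proof -
  have "(\<integral>x. cis (- (k \<bullet> x)) * (a * f x + b * g x) \<partial>lborel)
      = (\<integral>x. a * (cis (- (k \<bullet> x)) * f x) + b * (cis (- (k \<bullet> x)) * g x) \<partial>lborel)"
    by (simp add: algebra_simps)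
  also have "\<dots> = a * (\<integral>x. cis (- (k \<bullet> x)) * f x \<partial>lborel) + b * (\<integral>x. cis (- (k \<bullet> x)) * g x \<partial>lborel)"
    using assms by (subst Bochner_Integration.integral_add) (auto intro: integrable_cis_mult)
  finally show ?thesis by (simp add: fourier_integral_def algebra_simps)
qed

lemma fourier_integral_diff:
  fixes f g :: "real ^ 'n \<Rightarrow> complex"
  assumes "integrable lborel f" "integrable lborel g"
  shows "fourier_integral (\<lambda>x. f x - g x) k = fourier_integral f k - fourier_integral g k"
  using fourier_integral_lincomb[OF assms, of 1 "-1"] by simp

lemma fourier_integral_modulation:
  "fourier_integral (\<lambda>x. cis (\<xi> \<bullet> x) * f x) k = fourier_integral f (k - \<xi>)"
  by (simp add: fourier_integral_def mult.assoc[symmetric] cis_mult inner_diff_left)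

lemma fourier_integral_affine:
  fixes f :: "real ^ 'n \<Rightarrow> complex"
  assumes f: "integrable lborel f" and c: "c > 0"
  shows "fourier_integral (\<lambda>x. f (h + c *\<^sub>R x)) k
    = complex_of_real (1 / c ^ CARD('n)) * cis ((k \<bullet> h) / c) * fourier_integral f (k /\<^sub>R c)"
proof -
  let ?F = "\<lambda>y. cis (- ((k /\<^sub>R c) \<bullet> y)) * f y"
  have "(\<integral>y. ?F y \<partial>lborel) = (c ^ CARD('n)) *\<^sub>R (\<integral>x. ?F (h + c *\<^sub>R x) \<partial>lborel)"
    using integral_affine[OF integrable_cis_mult(1)[OF f], of c "k /\<^sub>R c" h] c by simp
  also have "(\<lambda>x. ?F (h + c *\<^sub>R x)) = (\<lambda>x. cis (- ((k \<bullet> h) / c)) * (cis (- (k \<bullet> x)) * f (h + c *\<^sub>R x)))"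
  proof
    fix x
    have "- ((k /\<^sub>R c) \<bullet> (h + c *\<^sub>R x)) = - ((k \<bullet> h) / c) + - (k \<bullet> x)"
      using c by (simp add: inner_add_right field_simps)
    then show "?F (h + c *\<^sub>R x) = cis (- ((k \<bullet> h) / c)) * (cis (- (k \<bullet> x)) * f (h + c *\<^sub>R x))"
      by (simp only: cis_mult[symmetric] mult.assoc)
  qed
  finally have "(\<integral>y. ?F y \<partial>lborel)
      = complex_of_real (c ^ CARD('n)) * cis (- ((k \<bullet> h) / c)) * (\<integral>x. cis (- (k \<bullet> x)) * f (h + c *\<^sub>R x) \<partial>lborel)"
    by (simp add: scaleR_conv_of_real)
  then have "complex_of_real (1 / c ^ CARD('n)) * cis ((k \<bullet> h) / c) * (\<integral>y. ?F y \<partial>lborel)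
      = (complex_of_real (1 / c ^ CARD('n)) * complex_of_real (c ^ CARD('n))) * (cis ((k \<bullet> h) / c) * cis (- ((k \<bullet> h) / c)))
        * (\<integral>x. cis (- (k \<bullet> x)) * f (h + c *\<^sub>R x) \<partial>lborel)"
    by (simp only: mult_ac)
  also have "complex_of_real (1 / c ^ CARD('n)) * complex_of_real (c ^ CARD('n)) = 1"
    using c by (simp flip: of_real_mult of_real_power)
  finally have e: "complex_of_real (1 / c ^ CARD('n)) * cis ((k \<bullet> h) / c) * (\<integral>y. ?F y \<partial>lborel)
      = (\<integral>x. cis (- (k \<bullet> x)) * f (h + c *\<^sub>R x) \<partial>lborel)"
    by (simp only: cis_mult) simp
  show ?thesis
    unfolding fourier_integral_def e[symmetric] by (simp only: mult_ac)
qed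

text \<open>Fubini's theorem for the kernel \<open>e\<^bsup>- i k \<cdot> x\<^esup>\<close>; it transposes the Fourier integral.\<close>

lemma fourier_integral_transpose:
  fixes f g :: "real ^ 'n \<Rightarrow> complex"
  assumes f: "integrable lborel f" and g: "integrable lborel g"
  shows "(\<integral>k. fourier_integral f k * g k \<partial>lborel) = (\<integral>x. f x * fourier_integral g x \<partial>lborel)"
proof -
  have int: "integrable (lborel \<Otimes>\<^sub>M lborel) (\<lambda>(k, x). cis (- (k \<bullet> x)) * (g k * f x))"
    using integrable_pair_bounded[OF g f, where b = "\<lambda>(k, x). cis (- (k \<bullet> x))"] by simp
  have "(\<integral>k. (\<integral>x. cis (- (k \<bullet> x)) * (g k * f x) \<partial>lborel) \<partial>lborel)
      = (\<integral>x. (\<integral>k. cis (- (k \<bullet> x)) * (g k * f x) \<partial>lborel) \<partial>lborel)"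
    using lborel_pair.Fubini_integral[OF int] by simp
  moreover have "(\<integral>x. cis (- (k \<bullet> x)) * (g k * f x) \<partial>lborel) = g k * (\<integral>x. cis (- (k \<bullet> x)) * f x \<partial>lborel)" for k
    by (subst integral_mult_right_zero[symmetric]) (simp add: mult_ac)
  moreover have "(\<integral>k. cis (- (k \<bullet> x)) * (g k * f x) \<partial>lborel) = f x * (\<integral>k. cis (- (x \<bullet> k)) * g k \<partial>lborel)" for x
    by (subst integral_mult_right_zero[symmetric]) (simp add: mult_ac inner_commute)
  ultimately have "(\<integral>k. g k * (\<integral>x. cis (- (k \<bullet> x)) * f x \<partial>lborel) \<partial>lborel)
      = (\<integral>x. f x * (\<integral>k. cis (- (x \<bullet> k)) * g k \<partial>lborel) \<partial>lborel)"
    by simp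
  moreover have "(\<integral>k. fourier_integral f k * g k \<partial>lborel)
      = complex_of_real (fourier_const TYPE('n)) * (\<integral>k. g k * (\<integral>x. cis (- (k \<bullet> x)) * f x \<partial>lborel) \<partial>lborel)"
    unfolding fourier_integral_def
    by (subst integral_mult_right_zero[symmetric]) (simp only: mult_ac)
  moreover have "(\<integral>x. f x * fourier_integral g x \<partial>lborel)
      = complex_of_real (fourier_const TYPE('n)) * (\<integral>x. f x * (\<integral>k. cis (- (x \<bullet> k)) * g k \<partial>lborel) \<partial>lborel)"
    unfolding fourier_integral_def
    by (subst (2) integral_mult_right_zero[symmetric]) (simp only: mult_ac)
  ultimately show ?thesis by simp
qed

lemma fourier_integral_gauss:
  "fourier_integral (\<lambda>x. complex_of_real (gauss x)) k = complex_of_real (gauss (k :: real ^ 'n))"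
proof -
  have "(2 * pi) powr (- real CARD('n) / 2) * (2 * pi) powr (real CARD('n) / 2) = 1"
    by (simp flip: powr_add)
  then show ?thesis
    unfolding fourier_integral_def gauss_fourier(2) of_real_mult[symmetric]
    by (simp add: mult.assoc[symmetric])
qed

lemma fourier_integral_modulated_gauss:
  fixes x y :: "real ^ 'n"
  assumes s: "s > 0"
  shows "fourier_integral (\<lambda>k. cis (x \<bullet> k) * complex_of_real (gauss (s *\<^sub>R k))) y
    = complex_of_real (gauss ((y - x) /\<^sub>R s) / s ^ CARD('n))"
  using fourier_integral_affine[of "\<lambda>x. complex_of_real (gauss x)" s 0 "y - x"] s
    integrable_gauss[where 'a = "real ^ 'n"]
  by (simp add: fourier_integral_modulation fourier_integral_gauss)

section \<open>Continuity of translations in \<open>L\<^sup>2\<close>\<close>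

definition L2sq :: "(real ^ 'n \<Rightarrow> complex) \<Rightarrow> ennreal" where
  "L2sq f = (\<integral>\<^sup>+ x. ennreal ((norm (f x))^2) \<partial>lborel)"

lemma L2_tendsto_iff: "L2_tendsto f g \<longleftrightarrow> (\<lambda>j. L2sq (\<lambda>x. f j x - g x)) \<longlonglongrightarrow> 0"
  by (simp add: L2_tendsto_def L2sq_def)

lemma L2_set_iff: "f \<in> L2_set \<longleftrightarrow> f \<in> borel_measurable borel \<and> L2sq f < \<infinity>"
  by (auto simp: L2_set_def L2sq_def integrable_iff_bounded)

lemma L2_set_measurable [measurable_dest]: "f \<in> L2_set \<Longrightarrow> f \<in> borel_measurable borel"
  by (simp add: L2_set_iff)

lemma L2_set_integrable: "f \<in> L2_set \<Longrightarrow> integrable lborel (\<lambda>x. (norm (f x))^2)"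
  by (simp add: L2_set_def)

lemma L2sq_eq_integral: "f \<in> L2_set \<Longrightarrow> L2sq f = ennreal (\<integral>x. (norm (f x))^2 \<partial>lborel)"
  unfolding L2sq_def by (rule nn_integral_eq_integral) (auto simp: L2_set_def)

lemma L2sq_minus_commute: "L2sq (\<lambda>x. f x - g x) = L2sq (\<lambda>x. g x - f x)"
  unfolding L2sq_def by (simp add: norm_minus_commute)

lemma L2sq_cmult: "f \<in> borel_measurable borel \<Longrightarrow> L2sq (\<lambda>x. c * f x) = ennreal ((norm c)^2) * L2sq f"
  unfolding L2sq_def
  by (subst nn_integral_cmult[symmetric]) (auto simp: norm_mult power_mult_distrib ennreal_mult)

text \<open>
  The free weight \<open>e\<close> lets the first constant tend to \<open>1\<close>, which replaces the triangle inequality for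
  the \<open>L\<^sup>2\<close> norm when its continuity is needed.
\<close>

lemma norm_add_sq_le: "(norm (a + b :: complex))^2 \<le> (1 + e) * (norm a)^2 + (1 + 1 / e) * (norm b)^2" if "e > 0"
proof -
  have "0 \<le> (sqrt e * norm a - norm b / sqrt e)^2"
    by simp
  also have "\<dots> = e * (norm a)^2 + (norm b)^2 / e - 2 * norm a * norm b"
    using that by (simp add: power2_diff power_mult_distrib power_divide)
  finally have "2 * norm a * norm b \<le> e * (norm a)^2 + (norm b)^2 / e" by simp
  moreover have "(norm (a + b))^2 \<le> (norm a + norm b)^2"
    by (intro power_mono norm_triangle_ineq) simp
  ultimately show ?thesis
    by (simp add: power2_sum algebra_simps)
qed

lemma L2sq_add_le:
  assumes [measurable]: "f \<in> borel_measurable borel" "g \<in> borel_measurable borel" and e: "e > 0"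
  shows "L2sq (\<lambda>x. f x + g x) \<le> ennreal (1 + e) * L2sq f + ennreal (1 + 1 / e) * L2sq g"
proof -
  have "L2sq (\<lambda>x. f x + g x)
      \<le> (\<integral>\<^sup>+ x. ennreal (1 + e) * ennreal ((norm (f x))^2) + ennreal (1 + 1 / e) * ennreal ((norm (g x))^2) \<partial>lborel)"
    unfolding L2sq_def using norm_add_sq_le[OF e] e
    by (intro nn_integral_mono) (auto simp: ennreal_mult[symmetric] ennreal_plus[symmetric] simp del: ennreal_plus)
  also have "\<dots> = ennreal (1 + e) * L2sq f + ennreal (1 + 1 / e) * L2sq g"
    unfolding L2sq_def by (simp add: nn_integral_add nn_integral_cmult)
  finally show ?thesis .
qed

lemma L2sq_add_le2:
  assumes "f \<in> borel_measurable borel" "g \<in> borel_measurable borel"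
  shows "L2sq (\<lambda>x. f x + g x) \<le> 2 * L2sq f + 2 * L2sq g"
  using L2sq_add_le[OF assms, of 1] by simp

lemma L2_set_cmult [intro]: "f \<in> L2_set \<Longrightarrow> (\<lambda>x. c * f x) \<in> L2_set"
  by (auto simp: L2_set_iff L2sq_cmult ennreal_mult_less_top)

lemma L2_set_add [intro]: "f \<in> L2_set \<Longrightarrow> g \<in> L2_set \<Longrightarrow> (\<lambda>x. f x + g x) \<in> L2_set"
  using L2sq_add_le2[of f g]
  by (auto simp: L2_set_iff ennreal_mult_less_top elim!: order.strict_trans1)

lemma L2_set_diff [intro]: "f \<in> L2_set \<Longrightarrow> g \<in> L2_set \<Longrightarrow> (\<lambda>x. f x - g x) \<in> L2_set"
  using L2_set_add[of f "\<lambda>x. - 1 * g x"] L2_set_cmult[of g "-1"] by simp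

lemma L2_set_bound:
  assumes "g \<in> L2_set" "f \<in> borel_measurable borel" "\<And>x. norm (f x) \<le> norm (g x)"
  shows "f \<in> L2_set"
proof -
  have "L2sq f \<le> L2sq g"
    unfolding L2sq_def using assms(3) by (intro nn_integral_mono ennreal_leI power_mono) auto
  then show ?thesis using assms by (auto simp: L2_set_iff)
qed

lemma tendsto_L2sq_dominated:
  fixes u :: "nat \<Rightarrow> real ^ 'n \<Rightarrow> complex"
  assumes [measurable]: "\<And>j. u j \<in> borel_measurable borel"
    and w: "integrable lborel w" and b: "\<And>j. AE x in lborel. (norm (u j x))^2 \<le> w x"
    and lim: "AE x in lborel. (\<lambda>j. u j x) \<longlonglongrightarrow> 0"
  shows "(\<lambda>j. L2sq (u j)) \<longlonglongrightarrow> 0"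
proof -
  have [measurable]: "w \<in> borel_measurable borel" using w by auto
  have "(\<lambda>j. \<integral>\<^sup>+x. ennreal ((norm (u j x))^2) \<partial>lborel) \<longlonglongrightarrow> (\<integral>\<^sup>+x. 0 \<partial>(lborel :: (real ^ 'n) measure))"
  proof (rule nn_integral_dominated_convergence[where w = "\<lambda>x. ennreal (w x)"])
    show "(\<integral>\<^sup>+x. ennreal (w x) \<partial>lborel) < \<infinity>"
      using integrableD(2)[OF w] by (simp add: less_top)
    show "AE x in lborel. ennreal ((norm (u j x))^2) \<le> ennreal (w x)" for j
      using b[of j] by eventually_elim (rule ennreal_leI)
    show "AE x in lborel. (\<lambda>j. ennreal ((norm (u j x))^2)) \<longlonglongrightarrow> 0"
      using lim
    proof eventually_elim
      fix x assume "(\<lambda>j. u j x) \<longlonglongrightarrow> 0"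
      then have "(\<lambda>j. (norm (u j x))^2) \<longlonglongrightarrow> (norm (0::complex))\<^sup>2"
        by (intro tendsto_intros)
      then have "(\<lambda>j. ennreal ((norm (u j x))^2)) \<longlonglongrightarrow> ennreal ((norm (0::complex))^2)"
        by (intro tendsto_ennrealI)
      then show "(\<lambda>j. ennreal ((norm (u j x))^2)) \<longlonglongrightarrow> 0" by simp
    qed
  qed auto
  then show ?thesis by (simp add: L2sq_def)
qed

lemma ennreal_numeral_mult: "0 \<le> r \<Longrightarrow> numeral w * ennreal r = ennreal (numeral w * r)"
  by (simp add: ennreal_mult)

lemma integrable_indicator_cball:
  "integrable lborel (\<lambda>x::'a::euclidean_space. c * indicator (cball 0 r) x :: real)"
  by (intro integrable_mult_right integrable_real_indicator) (use emeasure_lborel_cball_finite[of "0::'a" r] in auto)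

lemma L2_approx_bounded:
  fixes f :: "real ^ 'n \<Rightarrow> complex"
  assumes f: "f \<in> L2_set" and e: "e > 0"
  obtains r g where "r > 0" "g \<in> borel_measurable borel" "\<And>x. norm (g x) \<le> r" "\<And>x. norm x > r \<Longrightarrow> g x = 0"
    "L2sq (\<lambda>x. f x - g x) < e"
proof -
  have [measurable]: "f \<in> borel_measurable borel" using f by measurable
  define g where "g n x = (if norm x \<le> real n \<and> norm (f x) \<le> real n then f x else 0)" for n x
  have [measurable]: "g n \<in> borel_measurable borel" for n
    unfolding g_def by measurable
  have "(\<lambda>n. L2sq (\<lambda>x. f x - g n x)) \<longlonglongrightarrow> 0"
  proof (rule tendsto_L2sq_dominated[OF _ L2_set_integrable[OF f]])
    show "AE x in lborel. (\<lambda>n. f x - g n x) \<longlonglongrightarrow> 0"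
    proof (rule AE_I2)
      fix x
      have "eventually (\<lambda>n. real n \<ge> max (norm x) (norm (f x))) sequentially"
        using filterlim_real_sequentially[unfolded filterlim_at_top] by (rule spec)
      then have "eventually (\<lambda>n. f x - g n x = 0) sequentially"
        by eventually_elim (auto simp: g_def)
      then show "(\<lambda>n. f x - g n x) \<longlonglongrightarrow> 0"
        by (rule tendsto_eventually)
    qed
  qed (auto simp: g_def)
  then have "eventually (\<lambda>n. L2sq (\<lambda>x. f x - g n x) < e) sequentially"
    using e by (rule order_tendstoD)
  with eventually_gt_at_top[of 0]
  have "eventually (\<lambda>n. n > 0 \<and> L2sq (\<lambda>x. f x - g n x) < e) sequentially"
    by (rule eventually_conj)
  then obtain n where n: "n > 0" "L2sq (\<lambda>x. f x - g n x) < e"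
    by (auto dest: eventually_happens)
  show ?thesis
    by (rule that[of "real n" "g n"]) (use n in \<open>auto simp: g_def\<close>)
qed

text \<open>
  A measurable function is almost everywhere the limit of continuous ones.  Clipping them at the
  bound of a bounded, boundedly supported approximant and cutting them off outside its support
  makes them uniformly dominated, so they converge in \<open>L\<^sup>2\<close>.
\<close>

lemma L2_approx_continuous:
  fixes f :: "real ^ 'n \<Rightarrow> complex"
  assumes f: "f \<in> L2_set" and e: "e > 0"
  obtains r g where "continuous_on UNIV g" "\<And>x. norm (g x) \<le> r" "\<And>x. norm x > r \<Longrightarrow> g x = 0"
    "L2sq (\<lambda>x. f x - g x) < e"
proof -
  have e4: "e / 4 > 0" using e by (simp add: ennreal_divide_eq_0_iff zero_less_iff_neq_zero)
  have fm [measurable]: "f \<in> borel_measurable borel" using f by measurable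
  obtain r b where r: "r > 0" and b [measurable]: "b \<in> borel_measurable borel"
    and br: "\<And>x. norm (b x) \<le> r" "\<And>x. norm x > r \<Longrightarrow> b x = 0" and bf: "L2sq (\<lambda>x. f x - b x) < e / 4"
    using L2_approx_bounded[OF f e4] by metis
  have "b \<in> borel_measurable (lebesgue_on UNIV)"
    using measurable_completion[of b lborel borel] b by simp
  then have "b measurable_on UNIV"
    by (subst measurable_on_iff_borel_measurable) auto
  then obtain Z u where Z: "negligible Z" and cont: "\<And>n. continuous_on UNIV (u n)"
    and lim: "\<And>x. x \<notin> Z \<Longrightarrow> (\<lambda>n. u n x) \<longlonglongrightarrow> b x"
    unfolding measurable_on_def by auto
  define cut where "cut x = max 0 (min 1 (r + 1 - norm x))" for x :: "real ^ 'n"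
  define w where "w n x = (cut x * (r / max r (norm (u n x)))) *\<^sub>R u n x" for n x
  have wc: "continuous_on UNIV (w n)" for n
    unfolding w_def cut_def using r by (intro continuous_intros cont) (auto simp: max_def)
  have wm [measurable]: "w n \<in> borel_measurable borel" for n
    using wc by (rule borel_measurable_continuous_onI)
  have clip: "(r / max r (norm z)) * norm z \<le> r" for z :: complex
    using r by (auto simp: max_def field_simps)
  have wb: "norm (w n x) \<le> r" for n x
  proof -
    have "norm (w n x) = cut x * ((r / max r (norm (u n x))) * norm (u n x))"
      using r by (simp add: w_def cut_def abs_mult)
    also have "\<dots> \<le> 1 * r"
      using r by (intro mult_mono clip) (auto simp: cut_def)
    finally show ?thesis by simp
  qed
  have w0: "w n x = 0" if "norm x > r + 1" for n x
    using that by (simp add: w_def cut_def)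
  have wlim: "(\<lambda>n. w n x) \<longlonglongrightarrow> b x" if "x \<notin> Z" for x
  proof -
    have "(\<lambda>n. w n x) \<longlonglongrightarrow> (cut x * (r / max r (norm (b x)))) *\<^sub>R b x"
      unfolding w_def using r by (intro tendsto_intros lim that) (auto simp: max_def)
    also have "(cut x * (r / max r (norm (b x)))) *\<^sub>R b x = b x"
      using br[of x] r by (cases "norm x > r") (auto simp: cut_def max_def)
    finally show ?thesis .
  qed
  have "(\<lambda>n. L2sq (\<lambda>x. b x - w n x)) \<longlonglongrightarrow> 0"
  proof (rule tendsto_L2sq_dominated[OF _ integrable_indicator_cball[of "(2 * r)^2" "r + 1"]])
    show "AE x in lborel. (norm (b x - w n x))^2 \<le> (2 * r)^2 * indicator (cball 0 (r + 1)) x" for n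
    proof (rule AE_I2)
      fix x
      have "norm (b x - w n x) \<le> 2 * r"
        using norm_triangle_ineq4[of "b x" "w n x"] br(1)[of x] wb[of n x] by linarith
      then have "(norm (b x - w n x))^2 \<le> (2 * r)^2" by (intro power_mono) auto
      then show "(norm (b x - w n x))^2 \<le> (2 * r)^2 * indicator (cball 0 (r + 1)) x"
        using br(2)[of x] w0[of x n] by (cases "norm x \<le> r + 1") (auto simp: indicator_def)
    qed
    have "Z \<in> null_sets lebesgue"
      using Z by (simp add: negligible_iff_null_sets)
    then have "AE x in lebesgue. x \<notin> Z"
      by (rule AE_not_in)
    then have "AE x in lborel. x \<notin> Z"
      by (simp add: AE_completion_iff)
    then show "AE x in lborel. (\<lambda>n. b x - w n x) \<longlonglongrightarrow> 0"
      by eventually_elim (use wlim in \<open>auto intro!: tendsto_eq_intros\<close>)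
  qed auto
  then have "eventually (\<lambda>n. L2sq (\<lambda>x. b x - w n x) < e / 4) sequentially"
    using e4 by (rule order_tendstoD)
  then obtain n where n: "L2sq (\<lambda>x. b x - w n x) < e / 4"
    by (auto dest: eventually_happens)
  have "L2sq (\<lambda>x. f x - w n x) = L2sq (\<lambda>x. (f x - b x) + (b x - w n x))"
    by simp
  also have "\<dots> \<le> 2 * L2sq (\<lambda>x. f x - b x) + 2 * L2sq (\<lambda>x. b x - w n x)"
    by (rule L2sq_add_le2) auto
  also have "\<dots> < 2 * (e / 4) + 2 * (e / 4)"
    by (intro add_strict_mono ennreal_mult_strict_left_mono bf n) auto
  also have "\<dots> \<le> e"
  proof (cases e)
    case (real r)
    then show ?thesis
      by (simp add: ennreal_divide_numeral ennreal_numeral_mult ennreal_plus[symmetric] del: ennreal_plus)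
  qed simp
  finally have *: "L2sq (\<lambda>x. f x - w n x) < e" .
  have wb': "norm (w n x) \<le> r + 1" for x
    using wb[of n x] by linarith
  show ?thesis
    by (rule that[OF wc wb' w0 *])
qed

lemma tendsto_translation_continuous:
  fixes g :: "real ^ 'n \<Rightarrow> complex"
  assumes g: "continuous_on UNIV g" "\<And>x. norm (g x) \<le> r" "\<And>x. norm x > r \<Longrightarrow> g x = 0"
    and h: "h \<longlonglongrightarrow> 0"
  shows "(\<lambda>j. L2sq (\<lambda>x. g (x + h j) - g x)) \<longlonglongrightarrow> 0"
proof -
  have [measurable]: "g \<in> borel_measurable borel"
    using g(1) by (rule borel_measurable_continuous_onI)
  obtain B where B: "\<And>j. norm (h j) \<le> B"
    using convergent_imp_Bseq[OF convergentI[OF h]] by (auto elim!: BseqE)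
  have r: "0 \<le> r" using g(2)[of 0] norm_ge_zero order_trans by blast
  show ?thesis
  proof (rule tendsto_L2sq_dominated[OF _ integrable_indicator_cball[of "(2 * r)^2" "r + B"]])
    show "AE x in lborel. (norm (g (x + h j) - g x))^2 \<le> (2 * r)^2 * indicator (cball 0 (r + B)) x" for j
    proof (rule AE_I2)
      fix x
      have "norm (g (x + h j) - g x) \<le> 2 * r"
        using norm_triangle_ineq4[of "g (x + h j)" "g x"] g(2)[of x] g(2)[of "x + h j"] by linarith
      then have "(norm (g (x + h j) - g x))^2 \<le> (2 * r)^2" by (intro power_mono) auto
      moreover have "g (x + h j) - g x = 0" if "norm x > r + B"
      proof -
        have "norm x \<le> norm (x + h j) + norm (h j)"
          using norm_triangle_ineq4[of "x + h j" "h j"] by simp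
        then show ?thesis
          using that B[of j] order_trans[OF norm_ge_zero B] g(3)[of x] g(3)[of "x + h j"] by simp
      qed
      ultimately show "(norm (g (x + h j) - g x))^2 \<le> (2 * r)^2 * indicator (cball 0 (r + B)) x"
        by (cases "norm x \<le> r + B") (auto simp: indicator_def)
    qed
    have "(\<lambda>j. g (x + h j) - g x) \<longlonglongrightarrow> 0" for x
    proof -
      have "(\<lambda>j. x + h j) \<longlonglongrightarrow> x + 0" by (intro tendsto_intros h)
      then have "(\<lambda>j. g (x + h j)) \<longlonglongrightarrow> g x"
        using continuous_on_tendsto_compose[OF g(1), of "\<lambda>j. x + h j" x] by simp
      then show ?thesis by (auto intro!: tendsto_eq_intros)
    qed
    then show "AE x in lborel. (\<lambda>j. g (x + h j) - g x) \<longlonglongrightarrow> 0" by simp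
  qed auto
qed

text \<open>
  Translations are isometries, so the claim passes from continuous functions of bounded support to
  their \<open>L\<^sup>2\<close> limits.
\<close>

lemma tendsto_translation_L2:
  fixes f :: "real ^ 'n \<Rightarrow> complex"
  assumes f: "f \<in> L2_set" and h: "h \<longlonglongrightarrow> 0"
  shows "(\<lambda>j. L2sq (\<lambda>x. f (x + h j) - f x)) \<longlonglongrightarrow> 0"
proof (rule order_tendstoI)
  fix e :: ennreal assume "0 < e"
  then have e16: "e / 16 > 0" by (simp add: ennreal_divide_eq_0_iff zero_less_iff_neq_zero)
  have [measurable]: "f \<in> borel_measurable borel" using f by measurable
  obtain r g where g: "continuous_on UNIV g" "\<And>x. norm (g x) \<le> r" "\<And>x. norm x > r \<Longrightarrow> g x = 0"
    and fg: "L2sq (\<lambda>x. f x - g x) < e / 16"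
    using L2_approx_continuous[OF f e16] by metis
  have [measurable]: "g \<in> borel_measurable borel"
    using g(1) by (rule borel_measurable_continuous_onI)
  have "eventually (\<lambda>j. L2sq (\<lambda>x. g (x + h j) - g x) < e / 16) sequentially"
    using tendsto_translation_continuous[OF g h] e16 by (rule order_tendstoD)
  then show "eventually (\<lambda>j. L2sq (\<lambda>x. f (x + h j) - f x) < e) sequentially"
  proof eventually_elim
    fix j assume j: "L2sq (\<lambda>x. g (x + h j) - g x) < e / 16"
    have tr: "L2sq (\<lambda>x. f (x + h j) - g (x + h j)) = L2sq (\<lambda>x. f x - g x)"
      unfolding L2sq_def
      by (subst (2) nn_integral_translation[where t = "h j"]) (auto simp: add.commute)
    have "L2sq (\<lambda>x. f (x + h j) - f x)
        = L2sq (\<lambda>x. (f (x + h j) - g (x + h j)) + ((g (x + h j) - g x) + (g x - f x)))"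
      by simp
    also have "\<dots> \<le> 2 * L2sq (\<lambda>x. f (x + h j) - g (x + h j)) + 2 * L2sq (\<lambda>x. (g (x + h j) - g x) + (g x - f x))"
      by (rule L2sq_add_le2) auto
    also have "\<dots> \<le> 2 * L2sq (\<lambda>x. f x - g x) + 2 * (2 * L2sq (\<lambda>x. g (x + h j) - g x) + 2 * L2sq (\<lambda>x. f x - g x))"
      unfolding tr L2sq_minus_commute[of f] by (intro add_left_mono mult_left_mono L2sq_add_le2) auto
    also have "\<dots> < 2 * (e / 16) + 2 * (2 * (e / 16) + 2 * (e / 16))"
      by (intro add_strict_mono ennreal_mult_strict_left_mono fg j) auto
    also have "\<dots> \<le> e"
    proof (cases e)
      case (real r)
      then show ?thesis
        by (simp add: ennreal_divide_numeral ennreal_numeral_mult ennreal_plus[symmetric] del: ennreal_plus)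
    qed (simp)
    finally show "L2sq (\<lambda>x. f (x + h j) - f x) < e" .
  qed
qed simp

section \<open>Plancherel's theorem\<close>

lemma borel_measurable_cnj [measurable (raw)]:
  "f \<in> borel_measurable M \<Longrightarrow> (\<lambda>x. cnj (f x)) \<in> borel_measurable M"
  by (rule borel_measurable_continuous_on[where f = cnj]) (auto intro: continuous_intros)

lemma borel_measurable_complex_of_real [measurable (raw)]:
  "f \<in> borel_measurable M \<Longrightarrow> (\<lambda>x. complex_of_real (f x)) \<in> borel_measurable M"
  by (rule borel_measurable_continuous_on[where f = complex_of_real]) (auto intro: continuous_intros)

lemma norm_diff_sq: "(norm (b - a :: complex))^2 = (norm a)^2 + (norm b)^2 - 2 * Re (a * cnj b)"
  unfolding cmod_power2 by (simp add: power2_eq_square algebra_simps)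

lemma norm_mult_le_sq: "norm a * norm b \<le> (norm a)^2 + (norm b)^2"
  using sum_squares_bound[of "norm a" "norm b"] mult_nonneg_nonneg[OF norm_ge_zero norm_ge_zero, of a b]
  by linarith

lemma integrable_mult_L2:
  fixes f g :: "real ^ 'n \<Rightarrow> complex"
  assumes f: "f \<in> L2_set" and g: "g \<in> L2_set"
  shows "integrable lborel (\<lambda>x. f x * g x)"
proof (rule Bochner_Integration.integrable_bound)
  show "integrable lborel (\<lambda>x. (norm (f x))^2 + (norm (g x))^2)"
    using f g by (intro Bochner_Integration.integrable_add L2_set_integrable)
  show "(\<lambda>x. f x * g x) \<in> borel_measurable lborel"
    using f[THEN L2_set_measurable] g[THEN L2_set_measurable] by simp
  have "norm (a * b) \<le> (norm a)^2 + (norm b)^2" for a b :: complex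
    unfolding norm_mult by (rule norm_mult_le_sq)
  then show "AE x in lborel. norm (f x * g x) \<le> norm ((norm (f x))^2 + (norm (g x))^2)"
    by (auto intro: order_trans)
qed

lemma L2_set_cnj [intro]: "f \<in> L2_set \<Longrightarrow> (\<lambda>x. cnj (f x)) \<in> L2_set"
  unfolding L2_set_iff L2sq_def complex_mod_cnj by (simp add: borel_measurable_cnj)

lemma L2sq_affine:
  fixes f :: "real ^ 'n \<Rightarrow> complex"
  assumes "f \<in> borel_measurable borel" "c \<noteq> 0"
  shows "ennreal (\<bar>c\<bar> ^ CARD('n)) * L2sq (\<lambda>x. f (h + c *\<^sub>R x)) = L2sq f"
  unfolding L2sq_def using assms by (subst (2) nn_integral_affine[where c = c and t = h]) auto

lemma L2sq_translation:
  fixes f :: "real ^ 'n \<Rightarrow> complex"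
  assumes "f \<in> borel_measurable borel"
  shows "L2sq (\<lambda>x. f (x + h)) = L2sq f"
  using L2sq_affine[OF assms, of 1 h] by (simp add: add.commute)

lemma L2_set_translation:
  assumes f: "f \<in> L2_set"
  shows "(\<lambda>x. f (x + h)) \<in> L2_set"
proof -
  have [measurable]: "f \<in> borel_measurable borel" using f by measurable
  show ?thesis using f by (simp add: L2_set_iff L2sq_translation)
qed

lemma gauss_le_1: "gauss x \<le> 1"
  by (simp add: gauss_def)

lemma gauss_nonneg [simp]: "0 \<le> gauss x"
  by (simp add: gauss_def)

lemma abs_gauss [simp]: "\<bar>gauss x\<bar> = gauss x"
  by simp

lemma gauss_convolution_integrable:
  fixes f :: "real ^ 'n \<Rightarrow> complex"
  assumes f: "f \<in> L2_set"
  shows "integrable (lborel \<Otimes>\<^sub>M lborel) (\<lambda>(x, z). f x * cnj (f (x + s *\<^sub>R z)) * complex_of_real (gauss z))"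
  (is "integrable _ ?K")
proof (rule integrableI_bounded)
  have [measurable]: "f \<in> borel_measurable borel" using f by measurable
  show "?K \<in> borel_measurable (lborel \<Otimes>\<^sub>M lborel)"
    by measurable
  have bd: "ennreal (norm (a * cnj b * complex_of_real (gauss z)))
      \<le> ennreal (gauss z) * (ennreal ((norm a)^2) + ennreal ((norm b)^2))" for a b :: complex and z :: "real ^ 'n"
  proof -
    have "norm (a * cnj b * complex_of_real (gauss z)) \<le> gauss z * ((norm a)^2 + (norm b)^2)"
      using gauss_pos[of z] norm_mult_le_sq[of a b] by (simp add: norm_mult mult.commute)
    then show ?thesis
      using gauss_pos[of z] by (simp add: ennreal_mult[symmetric] ennreal_plus[symmetric] ennreal_leI del: ennreal_plus)
  qed
  have "(\<integral>\<^sup>+ p. norm (?K p) \<partial>(lborel \<Otimes>\<^sub>M lborel))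
     \<le> (\<integral>\<^sup>+ p. ennreal (gauss (snd p)) * (ennreal ((norm (f (fst p)))^2) + ennreal ((norm (f (fst p + s *\<^sub>R snd p)))^2)) \<partial>(lborel \<Otimes>\<^sub>M lborel))"
    by (intro nn_integral_mono) (auto simp: bd split: prod.split)
  also have "\<dots> = (\<integral>\<^sup>+ z. \<integral>\<^sup>+ x. ennreal (gauss z) * (ennreal ((norm (f x))^2) + ennreal ((norm (f (x + s *\<^sub>R z)))^2)) \<partial>lborel \<partial>lborel)"
    by (subst lborel_pair.nn_integral_snd[symmetric]) simp_all
  also have "\<dots> = (\<integral>\<^sup>+ z. ennreal (gauss z) * (L2sq f + L2sq (\<lambda>x. f (x + s *\<^sub>R z))) \<partial>lborel)"
    by (simp add: nn_integral_cmult nn_integral_add L2sq_def)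
  also have "\<dots> = (\<integral>\<^sup>+ z. ennreal (gauss z) \<partial>(lborel :: (real ^ 'n) measure)) * (L2sq f + L2sq f)"
    by (simp add: L2sq_translation nn_integral_multc)
  also have "\<dots> < \<infinity>"
    using f gauss_pos
    by (subst nn_integral_eq_integral[OF integrable_gauss])
       (auto simp: L2_set_iff ennreal_mult_less_top less_imp_le)
  finally show "(\<integral>\<^sup>+ p. norm (?K p) \<partial>(lborel \<Otimes>\<^sub>M lborel)) < \<infinity>" .
qed

definition autocorr :: "(real ^ 'n \<Rightarrow> complex) \<Rightarrow> real ^ 'n \<Rightarrow> complex" where
  "autocorr f h = (\<integral>x. f x * cnj (f (x + h)) \<partial>lborel)"

lemma Re_autocorr:
  fixes f :: "real ^ 'n \<Rightarrow> complex"
  assumes f: "f \<in> L2_set"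
  shows "Re (autocorr f h) = (\<integral>x. (norm (f x))^2 \<partial>lborel) - (\<integral>x. (norm (f (x + h) - f x))^2 \<partial>lborel) / 2"
proof -
  have i1: "integrable lborel (\<lambda>x. f x * cnj (f (x + h)))"
    using f by (intro integrable_mult_L2 L2_set_cnj L2_set_translation)
  have i2: "integrable lborel (\<lambda>x. (norm (f x))^2)" "integrable lborel (\<lambda>x. (norm (f (x + h)))^2)"
    using f by (auto intro!: L2_set_integrable L2_set_translation)
  have "(\<integral>x. (norm (f (x + h) - f x))^2 \<partial>lborel)
      = (\<integral>x. ((norm (f x))^2 + (norm (f (x + h)))^2) - 2 * Re (f x * cnj (f (x + h))) \<partial>lborel)"
    by (intro Bochner_Integration.integral_cong) (auto simp: norm_diff_sq)
  also have "\<dots> = (\<integral>x. (norm (f x))^2 \<partial>lborel) + (\<integral>x. (norm (f (x + h)))^2 \<partial>lborel) - 2 * (\<integral>x. Re (f x * cnj (f (x + h))) \<partial>lborel)"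
    using i2 integrable_Re[OF i1]
    by (subst Bochner_Integration.integral_diff) (auto simp del: times_complex.sel)
  also have "(\<integral>x. (norm (f (x + h)))^2 \<partial>lborel) = (\<integral>x. (norm (f x))^2 \<partial>lborel)"
    using integral_translation[OF i2(1), of h] by (simp add: add.commute)
  also have "(\<integral>x. Re (f x * cnj (f (x + h))) \<partial>lborel) = Re (autocorr f h)"
    unfolding autocorr_def using i1 by (rule integral_Re)
  finally show ?thesis by (simp add: field_simps)
qed

text \<open>
  The Gaussian factor makes \<open>|\<F> f|\<^sup>2\<close> integrable; transposing twice turns the regularised
  integral into a Gaussian average of the autocorrelation of \<open>f\<close>.
\<close>

lemma regularized_plancherel:
  fixes f :: "real ^ 'n \<Rightarrow> complex"
  assumes f1: "integrable lborel f" and f2: "f \<in> L2_set" and s: "s > 0"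
  shows "complex_of_real (\<integral>k. (norm (fourier_integral f k))^2 * gauss (s *\<^sub>R k) \<partial>lborel)
    = complex_of_real (fourier_const TYPE('n)) * (\<integral>z. autocorr f (s *\<^sub>R z) * complex_of_real (gauss z) \<partial>lborel)"
proof -
  have [measurable]: "f \<in> borel_measurable borel" using f1 by auto
  have gs: "integrable lborel (\<lambda>k::real ^ 'n. complex_of_real (gauss (s *\<^sub>R k)))"
    using integrable_affine[OF integrable_gauss, of s "0::real ^ 'n"] s by simp
  define \<psi> where "\<psi> k = complex_of_real (gauss (s *\<^sub>R k)) * cnj (fourier_integral f k)" for k
  obtain C where C: "\<And>k. norm (fourier_integral f k) \<le> C"
    using norm_fourier_integral_le by blast
  have \<psi>: "integrable lborel \<psi>"
  proof (rule Bochner_Integration.integrable_bound)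
    show "integrable lborel (\<lambda>k::real ^ 'n. C * complex_of_real (gauss (s *\<^sub>R k)))"
      by (intro integrable_mult_right gs)
    show "AE k in lborel. norm (\<psi> k) \<le> norm (C * complex_of_real (gauss (s *\<^sub>R k)))"
      using C order_trans[OF norm_ge_zero C]
      by (intro AE_I2) (auto simp: \<psi>_def norm_mult mult.commute[of C] intro!: mult_left_mono)
  qed (simp add: \<psi>_def[abs_def])
  have F\<psi>: "fourier_integral \<psi> x = complex_of_real (fourier_const TYPE('n)) * (\<integral>z. cnj (f (x + s *\<^sub>R z)) * complex_of_real (gauss z) \<partial>lborel)" for x
  proof -
    let ?\<chi> = "\<lambda>k. cis (x \<bullet> k) * complex_of_real (gauss (s *\<^sub>R k))"
    have \<chi>: "integrable lborel ?\<chi>"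
      using integrable_cis_mult(2)[OF gs] .
    have fg: "integrable lborel (\<lambda>y. f y * complex_of_real (gauss ((y - x) /\<^sub>R s) / s ^ CARD('n)))"
    proof (rule Bochner_Integration.integrable_bound)
      show "integrable lborel (\<lambda>y. f y * (1 / s ^ CARD('n)))"
        using f1 by (rule integrable_mult_left)
      show "AE y in lborel. norm (f y * complex_of_real (gauss ((y - x) /\<^sub>R s) / s ^ CARD('n))) \<le> norm (f y * (1 / s ^ CARD('n)))"
        using s gauss_le_1
        by (intro AE_I2) (auto simp: norm_mult norm_divide norm_power intro!: divide_right_mono mult_left_le)
    qed simp
    have "fourier_integral \<psi> x = complex_of_real (fourier_const TYPE('n)) * cnj (\<integral>k. fourier_integral f k * ?\<chi> k \<partial>lborel)"
      unfolding fourier_integral_def[of \<psi>]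
      by (subst Bochner_Integration.integral_cnj[symmetric]) (simp add: \<psi>_def cis_cnj mult_ac inner_commute del: Bochner_Integration.integral_cnj)
    also have "(\<integral>k. fourier_integral f k * ?\<chi> k \<partial>lborel) = (\<integral>y. f y * fourier_integral ?\<chi> y \<partial>lborel)"
      by (rule fourier_integral_transpose[OF f1 \<chi>])
    also have "\<dots> = (\<integral>y. f y * complex_of_real (gauss ((y - x) /\<^sub>R s) / s ^ CARD('n)) \<partial>lborel)"
      unfolding fourier_integral_modulated_gauss[OF s] ..
    also have "\<dots> = s ^ CARD('n) *\<^sub>R (\<integral>z. f (x + s *\<^sub>R z) * complex_of_real (gauss z / s ^ CARD('n)) \<partial>lborel)"
      using integral_affine[OF fg, of s x] s by simp
    also have "\<dots> = (\<integral>z. f (x + s *\<^sub>R z) * complex_of_real (gauss z) \<partial>lborel)"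
      unfolding integral_scaleR_right[symmetric] using s by (simp add: scaleR_conv_of_real)
    finally show ?thesis
      unfolding Bochner_Integration.integral_cnj[symmetric] by simp
  qed
  have nsq: "(complex_of_real (norm z))^2 = z * cnj z" for z
    by (metis complex_norm_square of_real_power)
  have int: "integrable (lborel \<Otimes>\<^sub>M lborel) (\<lambda>(x, z). f x * cnj (f (x + s *\<^sub>R z)) * complex_of_real (gauss z))"
    by (rule gauss_convolution_integrable[OF f2])
  have "complex_of_real (\<integral>k. (norm (fourier_integral f k))^2 * gauss (s *\<^sub>R k) \<partial>lborel)
      = (\<integral>k. fourier_integral f k * \<psi> k \<partial>lborel)"
    unfolding integral_complex_of_real[symmetric] \<psi>_def
    by (intro Bochner_Integration.integral_cong) (simp_all add: nsq mult_ac)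
  also have "\<dots> = (\<integral>x. f x * fourier_integral \<psi> x \<partial>lborel)"
    by (rule fourier_integral_transpose[OF f1 \<psi>])
  also have "\<dots> = complex_of_real (fourier_const TYPE('n)) * (\<integral>x. f x * (\<integral>z. cnj (f (x + s *\<^sub>R z)) * complex_of_real (gauss z) \<partial>lborel) \<partial>lborel)"
    unfolding F\<psi> by (subst integral_mult_right_zero[symmetric]) (simp only: mult_ac)
  also have "(\<integral>x. f x * (\<integral>z. cnj (f (x + s *\<^sub>R z)) * complex_of_real (gauss z) \<partial>lborel) \<partial>lborel)
      = (\<integral>x. (\<integral>z. f x * cnj (f (x + s *\<^sub>R z)) * complex_of_real (gauss z) \<partial>lborel) \<partial>lborel)"
    by (subst integral_mult_right_zero[symmetric]) (simp only: mult.assoc)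
  also have "\<dots> = (\<integral>z. (\<integral>x. f x * cnj (f (x + s *\<^sub>R z)) * complex_of_real (gauss z) \<partial>lborel) \<partial>lborel)"
    using lborel_pair.Fubini_integral[OF int] by simp
  also have "\<dots> = (\<integral>z. autocorr f (s *\<^sub>R z) * complex_of_real (gauss z) \<partial>lborel)"
    by (simp add: autocorr_def)
  finally show ?thesis .
qed

text \<open>
  As \<open>s \<rightarrow> 0\<close> the Gaussian average of the autocorrelation tends to its value \<open>\<parallel>f\<parallel>\<^sup>2\<close> at \<open>0\<close>, by
  continuity of translations.  On the other side, Fatou's lemma first shows that \<open>|\<F> f|\<^sup>2\<close> is
  integrable, and then dominated convergence identifies the limit.
\<close>

lemma L2_set_fourier_integral_and_norm:
  fixes f :: "real ^ 'n \<Rightarrow> complex"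
  assumes f1: "integrable lborel f" and f2: "f \<in> L2_set"
  shows "fourier_integral f \<in> L2_set" "L2sq (fourier_integral f) = L2sq f"
proof -
  have fm [measurable]: "f \<in> borel_measurable borel" using f1 by auto
  define A where "A = (\<integral>x. (norm (f x))^2 \<partial>lborel)"
  define s where "s n = 1 / real (Suc n)" for n
  have s: "s n > 0" for n by (simp add: s_def)
  have s0: "s \<longlonglongrightarrow> 0" unfolding s_def by (rule LIMSEQ_Suc[OF lim_1_over_n])
  define I where "I n z = fourier_const TYPE('n) * (Re (autocorr f (s n *\<^sub>R z)) * gauss z)" for n and z :: "real ^ 'n"
  have am [measurable]: "(\<lambda>z. autocorr f (c *\<^sub>R z)) \<in> borel_measurable borel" for c
    unfolding autocorr_def by measurable
  have ab: "\<bar>Re (autocorr f h)\<bar> \<le> A" for h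
  proof -
    have d: "integrable lborel (\<lambda>x. (norm (f (x + h) - f x))^2)"
      using f2 by (intro L2_set_integrable L2_set_diff L2_set_translation)
    have sq: "integrable lborel (\<lambda>x. (norm (f x))^2)" "integrable lborel (\<lambda>x. (norm (f (x + h)))^2)"
      using f2 by (auto intro!: L2_set_integrable L2_set_translation)
    have "(\<integral>x. (norm (f (x + h) - f x))^2 \<partial>lborel) \<le> (\<integral>x. 2 * (norm (f (x + h)))^2 + 2 * (norm (f x))^2 \<partial>lborel)"
      using norm_add_sq_le[of 1 "f (_ + h)" "- f _"] sq d
      by (intro integral_mono) auto
    also have "\<dots> = 4 * A"
      using sq integral_translation[OF sq(1), of h] by (simp add: A_def add.commute)
    finally have "(\<integral>x. (norm (f (x + h) - f x))^2 \<partial>lborel) \<le> 4 * A" .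
    moreover have "0 \<le> (\<integral>x. (norm (f (x + h) - f x))^2 \<partial>lborel)" by simp
    ultimately show ?thesis
      unfolding Re_autocorr[OF f2] A_def[symmetric] by linarith
  qed
  have alim: "(\<lambda>n. Re (autocorr f (s n *\<^sub>R z))) \<longlonglongrightarrow> A" for z
  proof -
    have "(\<lambda>n. s n *\<^sub>R z) \<longlonglongrightarrow> 0 *\<^sub>R z" by (intro tendsto_intros s0)
    then have "(\<lambda>n. L2sq (\<lambda>x. f (x + s n *\<^sub>R z) - f x)) \<longlonglongrightarrow> 0"
      using tendsto_translation_L2[OF f2] by simp
    then have "(\<lambda>n. ennreal (\<integral>x. (norm (f (x + s n *\<^sub>R z) - f x))^2 \<partial>lborel)) \<longlonglongrightarrow> ennreal 0"
      using f2 by (subst L2sq_eq_integral[symmetric]) (auto intro: L2_set_translation)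
    then have "(\<lambda>n. (\<integral>x. (norm (f (x + s n *\<^sub>R z) - f x))^2 \<partial>lborel)) \<longlonglongrightarrow> 0"
      by (subst (asm) tendsto_ennreal_iff) auto
    then show ?thesis
      unfolding Re_autocorr[OF f2] A_def[symmetric] by (auto intro!: tendsto_eq_intros)
  qed
  let ?J = "\<lambda>n k. (norm (fourier_integral f k))^2 * gauss (s n *\<^sub>R k)"
  have J: "(\<integral>k. ?J n k \<partial>lborel) = (\<integral>z. I n z \<partial>lborel)" for n
  proof -
    have i: "integrable lborel (\<lambda>z. autocorr f (s n *\<^sub>R z) * complex_of_real (gauss z))"
      unfolding autocorr_def
      using lborel_pair.integrable_snd[OF gauss_convolution_integrable[OF f2, of "s n"]] by simp
    have "(\<integral>k. ?J n k \<partial>lborel)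
       = Re (complex_of_real (fourier_const TYPE('n)) * (\<integral>z. autocorr f (s n *\<^sub>R z) * complex_of_real (gauss z) \<partial>lborel))"
      using regularized_plancherel[OF f1 f2 s] Re_complex_of_real by metis
    also have "\<dots> = fourier_const TYPE('n) * (\<integral>z. Re (autocorr f (s n *\<^sub>R z) * complex_of_real (gauss z)) \<partial>lborel)"
      unfolding integral_Re[OF i] by simp
    also have "\<dots> = (\<integral>z. I n z \<partial>lborel)"
      unfolding I_def by simp
    finally show ?thesis .
  qed
  have "(\<lambda>n. \<integral>z. I n z \<partial>lborel) \<longlonglongrightarrow> (\<integral>z. fourier_const TYPE('n) * (A * gauss (z :: real ^ 'n)) \<partial>lborel)"
  proof (rule integral_dominated_convergence[where w = "\<lambda>z. fourier_const TYPE('n) * (A * gauss z)"])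
    show "AE z in lborel. (\<lambda>n. I n z) \<longlonglongrightarrow> fourier_const TYPE('n) * (A * gauss z)"
      unfolding I_def by (intro AE_I2 tendsto_intros alim)
    show "AE z in lborel. norm (I n z) \<le> fourier_const TYPE('n) * (A * gauss z)" for n
      using ab gauss_pos by (intro AE_I2) (auto simp: I_def abs_mult less_imp_le intro!: mult_left_mono mult_right_mono)
  qed (auto simp: I_def[abs_def] integrable_gauss)
  also have "(\<integral>z. fourier_const TYPE('n) * (A * gauss (z :: real ^ 'n)) \<partial>lborel) = A * ((2 * pi) powr (- real CARD('n) / 2) * (2 * pi) powr (real CARD('n) / 2))"
    by (simp add: integral_gauss)
  also have "\<dots> = A"
    by (simp flip: powr_add)
  finally have lim: "(\<lambda>n. \<integral>k. ?J n k \<partial>lborel) \<longlonglongrightarrow> A"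
    unfolding J .
  have gs: "(\<lambda>n. gauss (s n *\<^sub>R k)) \<longlonglongrightarrow> 1" for k :: "real ^ 'n"
    unfolding gauss_def by (auto intro!: tendsto_eq_intros s0)
  have ji: "integrable lborel (\<lambda>k. ?J n k)" for n
  proof -
    obtain C where C: "\<And>k. norm (fourier_integral f k) \<le> C"
      using norm_fourier_integral_le by blast
    show ?thesis
    proof (rule Bochner_Integration.integrable_bound)
      show "integrable lborel (\<lambda>k::real ^ 'n. C\<^sup>2 * gauss (s n *\<^sub>R k))"
        using integrable_affine[OF integrable_gauss, of "s n" "0::real ^ 'n"] s[of n] by simp
      show "AE k in lborel. norm (?J n k) \<le> norm (C\<^sup>2 * gauss (s n *\<^sub>R k))"
        using C gauss_pos by (auto simp: abs_mult less_imp_le intro!: mult_right_mono power_mono)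
    qed simp
  qed
  have "L2sq (fourier_integral f) = (\<integral>\<^sup>+k. liminf (\<lambda>n. ennreal (?J n k)) \<partial>lborel)"
    unfolding L2sq_def
  proof (intro nn_integral_cong)
    fix k
    have "(\<lambda>n. ?J n k) \<longlonglongrightarrow> (norm (fourier_integral f k))\<^sup>2 * 1"
      by (intro tendsto_intros gs)
    then have "(\<lambda>n. ennreal (?J n k)) \<longlonglongrightarrow> ennreal ((norm (fourier_integral f k))^2)"
      by (intro tendsto_ennrealI) simp
    then show "ennreal ((norm (fourier_integral f k))^2) = liminf (\<lambda>n. ennreal (?J n k))"
      using lim_imp_Liminf[OF sequentially_bot] by metis
  qed
  also have "\<dots> \<le> liminf (\<lambda>n. \<integral>\<^sup>+k. ennreal (?J n k) \<partial>lborel)"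
    by (rule nn_integral_liminf) simp
  also have "(\<lambda>n. \<integral>\<^sup>+k. ennreal (?J n k) \<partial>lborel)
      = (\<lambda>n. ennreal (\<integral>k. ?J n k \<partial>lborel))"
    using gauss_pos by (intro ext nn_integral_eq_integral ji) (auto simp: less_imp_le)
  also have "liminf \<dots> = ennreal A"
    using lim_imp_Liminf[OF sequentially_bot tendsto_ennrealI[OF lim]] .
  finally have "L2sq (fourier_integral f) < \<infinity>"
    by (rule order.strict_trans1) simp
  then show L2: "fourier_integral f \<in> L2_set"
    by (simp add: L2_set_iff)
  have "(\<lambda>n. \<integral>k. ?J n k \<partial>lborel) \<longlonglongrightarrow> (\<integral>k. (norm (fourier_integral f k))^2 * 1 \<partial>lborel)"
  proof (rule integral_dominated_convergence[where w = "\<lambda>k. (norm (fourier_integral f k))^2"])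
    show "AE k in lborel. (\<lambda>n. ?J n k) \<longlonglongrightarrow> (norm (fourier_integral f k))\<^sup>2 * 1"
      by (intro AE_I2 tendsto_intros gs)
    show "AE k in lborel. norm (?J n k) \<le> (norm (fourier_integral f k))^2" for n
      using gauss_pos gauss_le_1 by (intro AE_I2) (auto simp: abs_mult less_imp_le intro!: mult_left_le)
  qed (auto intro: L2_set_integrable L2)
  from LIMSEQ_unique[OF lim this] show "L2sq (fourier_integral f) = L2sq f"
    using L2 f2 by (simp add: L2sq_eq_integral A_def)
qed

section \<open>The Fourier transform on \<open>L\<^sup>2\<close>\<close>

lemma L2_setD_is_fourier:
  assumes "is_fourier u g"
  shows "u \<in> L2_set" "g \<in> L2_set"
  using assms by (auto simp: is_fourier_def)

lemma is_fourier_integral: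
  assumes "integrable lborel f" "f \<in> L2_set"
  shows "is_fourier f (fourier_integral f)"
  unfolding is_fourier_def
  using assms L2_set_fourier_integral_and_norm(1)[OF assms]
  by (auto simp: L2_tendsto_def intro!: exI[of _ "\<lambda>_. f"] L1_setI)

text \<open>
  The weights \<open>e j\<close> tend to \<open>0\<close> slowly enough that the error term \<open>D j / e j\<close> still vanishes; the summand
  \<open>1 / real (Suc j)\<close> only keeps them positive.
\<close>

lemma L2sq_limit:
  fixes u :: "real ^ 'n \<Rightarrow> complex"
  assumes fu: "L2_tendsto f u" and f: "\<And>j. f j \<in> Defs.L2_set" and u: "u \<in> Defs.L2_set"
  shows "(\<lambda>j. L2sq (f j)) \<longlonglongrightarrow> L2sq u"
proof -
  define n where "n h = (LINT x|lborel. (norm (h x))^2)" for h :: "real ^ 'n \<Rightarrow> complex"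
  define D where "D j = n (\<lambda>x. f j x - u x)" for j
  define e where "e j = sqrt (D j) + 1 / real (Suc j)" for j
  have nn: "0 \<le> n h" for h by (simp add: n_def)
  have e: "0 < e j" for j using nn by (simp add: e_def D_def add_nonneg_pos)
  have "(\<lambda>j. ennreal (D j)) \<longlonglongrightarrow> ennreal 0"
    using fu f u by (simp add: L2_tendsto_iff L2sq_eq_integral D_def n_def L2_set_diff)
  then have D: "D \<longlonglongrightarrow> 0"
    using nn by (subst (asm) tendsto_ennreal_iff) (auto simp: D_def)
  then have "e \<longlonglongrightarrow> sqrt 0 + 0"
    unfolding e_def by (intro tendsto_intros LIMSEQ_Suc[OF lim_1_over_n])
  then have e0: "e \<longlonglongrightarrow> 0" by simp
  have step: "n w \<le> (1 + e j) * n h + (D j + e j)"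
    if "h \<in> Defs.L2_set" "w \<in> Defs.L2_set" "n (\<lambda>x. w x - h x) = D j" for h w j
  proof -
    have i: "integrable lborel (\<lambda>x. (norm (h x))^2)" "integrable lborel (\<lambda>x. (norm (w x))^2)"
      "integrable lborel (\<lambda>x. (norm (w x - h x))^2)"
      using that by (auto intro: L2_set_integrable)
    have "n w \<le> (LINT x|lborel. (1 + e j) * (norm (h x))^2 + (1 + 1 / e j) * (norm (w x - h x))^2)"
      unfolding n_def using norm_add_sq_le[OF e, of "h x" "w x - h x" j for x] i
      by (intro integral_mono) simp_all
    also have "\<dots> = (1 + e j) * n h + (D j + D j / e j)"
      using i that(3) by (simp add: n_def distrib_right)
    also have "D j / e j \<le> e j"
    proof -
      have "D j = (sqrt (D j))^2" using nn by (simp add: D_def)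
      also have "\<dots> \<le> (e j)^2" using nn by (intro power_mono) (auto simp: e_def D_def)
      finally show ?thesis using e[of j] by (simp add: divide_le_eq power2_eq_square)
    qed
    finally show ?thesis by simp
  qed
  have "(\<lambda>j. n (f j)) \<longlonglongrightarrow> n u"
  proof (rule tendsto_sandwich)
    show "eventually (\<lambda>j. (n u - (D j + e j)) / (1 + e j) \<le> n (f j)) sequentially"
    proof (intro always_eventually allI)
      fix j
      have "n u \<le> (1 + e j) * n (f j) + (D j + e j)"
        by (rule step[OF f u]) (simp add: D_def n_def norm_minus_commute)
      then show "(n u - (D j + e j)) / (1 + e j) \<le> n (f j)"
        using e[of j] by (simp add: pos_divide_le_eq mult.commute)
    qed
    show "eventually (\<lambda>j. n (f j) \<le> (1 + e j) * n u + (D j + e j)) sequentially"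
      by (intro always_eventually allI step u f) (simp add: D_def)
    show "(\<lambda>j. (n u - (D j + e j)) / (1 + e j)) \<longlonglongrightarrow> n u"
      "(\<lambda>j. (1 + e j) * n u + (D j + e j)) \<longlonglongrightarrow> n u"
      using D e0 by (auto intro!: tendsto_eq_intros)
  qed
  then show ?thesis
    using f u by (simp add: L2sq_eq_integral n_def[symmetric] tendsto_ennrealI)
qed

text \<open>
  Both sides are limits of the same numbers, because the approximating integrable functions satisfy
  the identity.
\<close>

theorem plancherel:
  assumes "is_fourier u g"
  shows "L2sq g = L2sq u"
proof -
  obtain f where f: "\<And>j. f j \<in> L1_set" "\<And>j. f j \<in> Defs.L2_set" and fu: "L2_tendsto f u"
    and fg: "L2_tendsto (\<lambda>j. fourier_integral (f j)) g"
    using assms by (auto simp: is_fourier_def)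
  note P = L2_set_fourier_integral_and_norm[OF L1_setD[OF f(1)] f(2)]
  have "(\<lambda>j. L2sq (f j)) \<longlonglongrightarrow> L2sq g"
    using L2sq_limit[OF fg P(1)] L2_setD_is_fourier[OF assms] by (simp add: P(2))
  then show ?thesis
    using L2sq_limit[OF fu f(2)] L2_setD_is_fourier[OF assms] by (auto intro: LIMSEQ_unique)
qed

lemma L2_tendsto_lincomb:
  assumes "L2_tendsto f u" "L2_tendsto h w"
    and [measurable]: "\<And>j. f j \<in> borel_measurable borel" "\<And>j. h j \<in> borel_measurable borel"
       "u \<in> borel_measurable borel" "w \<in> borel_measurable borel"
  shows "L2_tendsto (\<lambda>j x. a * f j x + b * h j x) (\<lambda>x. a * u x + b * w x)"
  unfolding L2_tendsto_iff
proof (rule tendsto_sandwich[OF _ _ tendsto_const])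
  let ?F = "\<lambda>j. 2 * (ennreal ((norm a)^2) * L2sq (\<lambda>x. f j x - u x)) + 2 * (ennreal ((norm b)^2) * L2sq (\<lambda>x. h j x - w x))"
  have "(\<lambda>x. a * f j x + b * h j x - (a * u x + b * w x)) = (\<lambda>x. a * (f j x - u x) + b * (h j x - w x))" for j
    by (simp add: algebra_simps)
  then show "eventually (\<lambda>j. L2sq (\<lambda>x. a * f j x + b * h j x - (a * u x + b * w x)) \<le> ?F j) sequentially"
    using L2sq_add_le2[of "\<lambda>x. a * (f _ x - u x)" "\<lambda>x. b * (h _ x - w x)"]
    by (simp add: L2sq_cmult)
  have "?F \<longlonglongrightarrow> 2 * (ennreal ((norm a)^2) * 0) + 2 * (ennreal ((norm b)^2) * 0)"
    using assms(1,2) unfolding L2_tendsto_iff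
    by (intro tendsto_add ennreal_tendsto_cmult) auto
  then show "?F \<longlonglongrightarrow> 0" by simp
qed simp

lemma is_fourier_lincomb:
  assumes u: "is_fourier u g" and w: "is_fourier w h"
  shows "is_fourier (\<lambda>x. a * u x + b * w x) (\<lambda>k. a * g k + b * h k)"
proof -
  obtain f where f: "\<And>j. f j \<in> L1_set" "\<And>j. f j \<in> L2_set" and fu: "L2_tendsto f u"
    and fg: "L2_tendsto (\<lambda>j. fourier_integral (f j)) g"
    using u by (auto simp: is_fourier_def)
  obtain f' where f': "\<And>j. f' j \<in> L1_set" "\<And>j. f' j \<in> L2_set" and fu': "L2_tendsto f' w"
    and fg': "L2_tendsto (\<lambda>j. fourier_integral (f' j)) h"
    using w by (auto simp: is_fourier_def)
  note L2 = L2_setD_is_fourier[OF u] L2_setD_is_fourier[OF w]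
  have m [measurable]: "\<And>j. f j \<in> borel_measurable borel" "\<And>j. f' j \<in> borel_measurable borel"
    "u \<in> borel_measurable borel" "g \<in> borel_measurable borel" "w \<in> borel_measurable borel" "h \<in> borel_measurable borel"
    using L2 f(2) f'(2) by (auto dest: L2_set_measurable)
  have "fourier_integral (\<lambda>x. a * f j x + b * f' j x)
      = (\<lambda>k. a * fourier_integral (f j) k + b * fourier_integral (f' j) k)" for j
    by (intro ext fourier_integral_lincomb L1_setD f f')
  then have lim2: "L2_tendsto (\<lambda>j. fourier_integral (\<lambda>x. a * f j x + b * f' j x)) (\<lambda>k. a * g k + b * h k)"
    using L2_tendsto_lincomb[OF fg fg'] by simp
  show ?thesis
    unfolding is_fourier_def
  proof (intro conjI exI[of _ "\<lambda>j x. a * f j x + b * f' j x"] allI IntI)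
    show "L2_tendsto (\<lambda>j x. a * f j x + b * f' j x) (\<lambda>x. a * u x + b * w x)"
      by (rule L2_tendsto_lincomb[OF fu fu']) auto
    show "(\<lambda>x. a * f j x + b * f' j x) \<in> L1_set" for j
      using f(1)[of j] f'(1)[of j] by (intro L1_setI Bochner_Integration.integrable_add integrable_mult_right) auto
    show "(\<lambda>x. a * f j x + b * f' j x) \<in> Defs.L2_set" for j
      by (intro L2_set_add L2_set_cmult f f')
    show "(\<lambda>x. a * u x + b * w x) \<in> Defs.L2_set" "(\<lambda>k. a * g k + b * h k) \<in> Defs.L2_set"
      by (intro L2_set_add L2_set_cmult L2)+
  qed (rule lim2)
qed

lemma is_fourier_unique:
  assumes u: "is_fourier u g" and h: "is_fourier u h"
  shows "AE k in lborel. g k = h k"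
proof -
  have "is_fourier (\<lambda>x. 0) (\<lambda>k. g k - h k)"
    using is_fourier_lincomb[OF assms, of 1 "-1"] by simp
  from plancherel[OF this] have z: "L2sq (\<lambda>k. g k - h k) = 0"
    by (simp add: L2sq_def)
  have [measurable]: "g \<in> borel_measurable borel" "h \<in> borel_measurable borel"
    using L2_setD_is_fourier[OF u] L2_setD_is_fourier[OF h] by (auto dest: L2_set_measurable)
  show ?thesis
    using z unfolding L2sq_def by (subst (asm) nn_integral_0_iff_AE) (auto simp: ennreal_eq_0_iff)
qed

lemma is_fourier_modulation:
  assumes "is_fourier u g"
  shows "is_fourier (\<lambda>x. cis (\<xi> \<bullet> x) * u x) (\<lambda>k. g (k - \<xi>))"
proof -
  obtain f where f: "\<And>j. f j \<in> L1_set" "\<And>j. f j \<in> L2_set" and fu: "L2_tendsto f u"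
    and fg: "L2_tendsto (\<lambda>j. fourier_integral (f j)) g"
    using assms by (auto simp: is_fourier_def)
  note L2 = L2_setD_is_fourier[OF assms]
  have m [measurable]: "\<And>j. f j \<in> borel_measurable borel" "u \<in> borel_measurable borel" "g \<in> borel_measurable borel"
    using L2 f(2) by (auto dest: L2_set_measurable)
  have cm: "(\<lambda>x. cis (\<xi> \<bullet> x) * w x) \<in> L2_set" if "w \<in> L2_set" for w
    by (rule L2_set_bound[OF that]) (use L2_set_measurable[OF that] in \<open>auto simp: norm_mult\<close>)
  show ?thesis
    unfolding is_fourier_def
  proof (intro conjI exI[of _ "\<lambda>j x. cis (\<xi> \<bullet> x) * f j x"] allI IntI cm L2 f)
    show "(\<lambda>k. g (k - \<xi>)) \<in> L2_set"
      using L2_set_translation[OF L2(2), of "- \<xi>"] by simp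
    show "(\<lambda>x. cis (\<xi> \<bullet> x) * f j x) \<in> L1_set" for j
      using f(1)[of j] by (intro L1_setI integrable_cis_mult) auto
    show "L2_tendsto (\<lambda>j x. cis (\<xi> \<bullet> x) * f j x) (\<lambda>x. cis (\<xi> \<bullet> x) * u x)"
      using fu unfolding L2_tendsto_def by (simp add: norm_mult flip: right_diff_distrib)
    have "L2sq (\<lambda>k. fourier_integral (f j) (k - \<xi>) - g (k - \<xi>)) = L2sq (\<lambda>k. fourier_integral (f j) k - g k)" for j
      using L2sq_translation[of "\<lambda>k. fourier_integral (f j) k - g k" "- \<xi>"] by simp
    then show "L2_tendsto (\<lambda>j. fourier_integral (\<lambda>x. cis (\<xi> \<bullet> x) * f j x)) (\<lambda>k. g (k - \<xi>))"
      using fg by (simp add: L2_tendsto_iff fourier_integral_modulation[abs_def])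
  qed
qed

lemma L2_set_dilation:
  fixes u :: "real ^ 'n \<Rightarrow> complex"
  assumes "u \<in> L2_set" "c \<noteq> 0"
  shows "(\<lambda>x. u (c *\<^sub>R x)) \<in> L2_set"
proof -
  have [measurable]: "u \<in> borel_measurable borel" using assms by measurable
  have "ennreal (\<bar>c\<bar> ^ CARD('n)) * L2sq (\<lambda>x. u (c *\<^sub>R x)) < \<infinity>"
    using L2sq_affine[of u c 0] assms by (simp add: L2_set_iff)
  moreover have "\<not> \<bar>c\<bar> ^ CARD('n) \<le> 0"
    using assms by (simp add: not_le)
  ultimately show ?thesis
    by (auto simp: L2_set_iff ennreal_mult_less_top ennreal_eq_0_iff)
qed

lemma is_fourier_dilation:
  fixes u :: "real ^ 'n \<Rightarrow> complex"
  assumes u: "is_fourier u g" and c: "c > 0"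
  shows "is_fourier (\<lambda>x. u (c *\<^sub>R x)) (\<lambda>k. complex_of_real (1 / c ^ CARD('n)) * g (k /\<^sub>R c))"
proof -
  obtain f where f: "\<And>j. f j \<in> L1_set" "\<And>j. f j \<in> L2_set" and fu: "L2_tendsto f u"
    and fg: "L2_tendsto (\<lambda>j. fourier_integral (f j)) g"
    using u by (auto simp: is_fourier_def)
  note L2 = L2_setD_is_fourier[OF u]
  have m [measurable]: "\<And>j. f j \<in> borel_measurable borel" "u \<in> borel_measurable borel" "g \<in> borel_measurable borel"
    using L2 f(2) by (auto dest: L2_set_measurable)
  have dilate: "L2sq (\<lambda>x. h (d *\<^sub>R x)) = ennreal (1 / d ^ CARD('n)) * L2sq h"
    if "d > 0" and [measurable]: "h \<in> borel_measurable borel" for d and h :: "real ^ 'n \<Rightarrow> complex"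
  proof -
    have "ennreal (1 / d ^ CARD('n)) * L2sq h = ennreal (1 / d ^ CARD('n)) * (ennreal (d ^ CARD('n)) * L2sq (\<lambda>x. h (d *\<^sub>R x)))"
      using L2sq_affine[of h d 0] that by simp
    also have "\<dots> = L2sq (\<lambda>x. h (d *\<^sub>R x))"
      using that by (simp add: mult.assoc[symmetric] ennreal_mult[symmetric])
    finally show ?thesis ..
  qed
  have "(\<lambda>j. ennreal (1 / c ^ CARD('n)) * L2sq (\<lambda>x. f j x - u x)) \<longlonglongrightarrow> ennreal (1 / c ^ CARD('n)) * 0"
    using fu unfolding L2_tendsto_iff by (intro ennreal_tendsto_cmult) auto
  then have lim1: "L2_tendsto (\<lambda>j x. f j (c *\<^sub>R x)) (\<lambda>x. u (c *\<^sub>R x))"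
    using dilate[of c "\<lambda>x. f _ x - u x"] c by (simp add: L2_tendsto_iff)
  let ?s = "complex_of_real (1 / c ^ CARD('n))"
  have eq: "L2sq (\<lambda>k. ?s * fourier_integral (f j) (k /\<^sub>R c) - ?s * g (k /\<^sub>R c))
    = ennreal ((norm ?s)^2) * (ennreal (1 / (1 / c) ^ CARD('n)) * L2sq (\<lambda>k. fourier_integral (f j) k - g k))" for j
    using dilate[of "inverse c" "\<lambda>k. fourier_integral (f j) k - g k"] c
    by (simp only: right_diff_distrib[symmetric]) (simp add: L2sq_cmult divide_inverse)
  have "(\<lambda>j. ennreal ((norm ?s)^2) * (ennreal (1 / (1 / c) ^ CARD('n)) * L2sq (\<lambda>k. fourier_integral (f j) k - g k)))
     \<longlonglongrightarrow> ennreal ((norm ?s)^2) * (ennreal (1 / (1 / c) ^ CARD('n)) * 0)"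
    using fg unfolding L2_tendsto_iff by (intro ennreal_tendsto_cmult) auto
  then have lim2: "L2_tendsto (\<lambda>j k. ?s * fourier_integral (f j) (k /\<^sub>R c)) (\<lambda>k. ?s * g (k /\<^sub>R c))"
    unfolding L2_tendsto_iff eq by simp
  have fi: "fourier_integral (\<lambda>x. f j (c *\<^sub>R x)) = (\<lambda>k. ?s * fourier_integral (f j) (k /\<^sub>R c))" for j
    using fourier_integral_affine[OF L1_setD[OF f(1)[of j]] c, of 0] by auto
  show ?thesis
    unfolding is_fourier_def
  proof (intro conjI exI[of _ "\<lambda>j x. f j (c *\<^sub>R x)"] allI IntI)
    show "(\<lambda>x. f j (c *\<^sub>R x)) \<in> L1_set" for j
      using integrable_affine[OF L1_setD[OF f(1)[of j]], of c 0] c by (intro L1_setI) auto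
    show "(\<lambda>k. ?s * g (k /\<^sub>R c)) \<in> L2_set"
      using c by (intro L2_set_cmult L2_set_dilation L2) auto
  qed (use c L2 f lim1 lim2 fi in \<open>auto intro: L2_set_dilation\<close>)
qed

lemma L2_approx_L1:
  fixes u :: "real ^ 'n \<Rightarrow> complex"
  assumes u: "u \<in> L2_set" and e: "e > 0"
  obtains f where "integrable lborel f" "f \<in> L2_set" "L2sq (\<lambda>x. u x - f x) < e"
proof -
  obtain r g where r: "r > 0" and g [measurable]: "g \<in> borel_measurable borel"
    and gr: "\<And>x. norm (g x) \<le> r" "\<And>x. norm x > r \<Longrightarrow> g x = 0" and gu: "L2sq (\<lambda>x. u x - g x) < e"
    using L2_approx_bounded[OF u e] by metis
  have "integrable lborel g"
    by (rule Bochner_Integration.integrable_bound[OF integrable_indicator_cball[of r r]])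
       (use r gr in \<open>auto simp: indicator_def not_le\<close>)
  moreover have "integrable lborel (\<lambda>x. (norm (g x))^2)"
    by (rule Bochner_Integration.integrable_bound[OF integrable_indicator_cball[of "r\<^sup>2" r]])
       (use r gr in \<open>auto simp: indicator_def not_le intro!: power_mono\<close>)
  ultimately show ?thesis
    using that[of g] gu by (simp add: L2_set_def)
qed

text \<open>
  The Riesz-Fischer argument: for approximants at distances \<open>4\<^bsup>- j\<^esup>\<close> the transforms are Cauchy so fast
  that the series of their weighted squared increments is integrable; hence they converge almost
  everywhere, and Fatou's lemma turns the pointwise limit into an \<open>L\<^sup>2\<close> limit.
\<close>

lemma is_fourier_exists:
  fixes u :: "real ^ 'n \<Rightarrow> complex"
  assumes u: "u \<in> L2_set"
  shows "\<exists>g. is_fourier u g"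
proof -
  have um [measurable]: "u \<in> borel_measurable borel" using u by measurable
  have "\<forall>j. \<exists>f. integrable lborel f \<and> f \<in> L2_set \<and> L2sq (\<lambda>x. u x - f x) < ennreal ((1 / 4) ^ j)"
  proof
    fix j
    have "ennreal ((1 / 4) ^ j) > 0" by simp
    then show "\<exists>f. integrable lborel f \<and> f \<in> L2_set \<and> L2sq (\<lambda>x. u x - f x) < ennreal ((1 / 4) ^ j)"
      using L2_approx_L1[OF u] by metis
  qed
  then obtain f where f1: "\<And>j. integrable lborel (f j)" and f2: "\<And>j. f j \<in> L2_set"
    and fu: "\<And>j. L2sq (\<lambda>x. u x - f j x) < ennreal ((1 / 4) ^ j)"
    by metis
  have fm [measurable]: "\<And>j. f j \<in> borel_measurable borel" using f1 by auto
  let ?F = "\<lambda>j. fourier_integral (f j)"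
  have dist: "L2sq (\<lambda>k. ?F i k - ?F j k) \<le> ennreal (4 * (1 / 4) ^ j)" if "i \<ge> j" for i j
  proof -
    have "(\<lambda>k. ?F i k - ?F j k) = fourier_integral (\<lambda>x. f i x - f j x)"
      by (intro ext fourier_integral_diff[symmetric] f1)
    then have "L2sq (\<lambda>k. ?F i k - ?F j k) = L2sq (fourier_integral (\<lambda>x. f i x - f j x))"
      by (rule arg_cong)
    also have "\<dots> = L2sq (\<lambda>x. f i x - f j x)"
      using f1 f2 by (intro L2_set_fourier_integral_and_norm) auto
    also have "\<dots> = L2sq (\<lambda>x. (u x - f j x) + (f i x - u x))" by simp
    also have "\<dots> \<le> 2 * L2sq (\<lambda>x. u x - f j x) + 2 * L2sq (\<lambda>x. u x - f i x)"
      unfolding L2sq_minus_commute[of u "f i"] by (rule L2sq_add_le2) auto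
    also have "\<dots> \<le> 2 * ennreal ((1 / 4) ^ j) + 2 * ennreal ((1 / 4) ^ i)"
      using fu by (intro add_mono mult_left_mono) (auto intro: less_imp_le)
    also have "\<dots> = ennreal (2 * (1 / 4) ^ j + 2 * (1 / 4) ^ i)"
      by (simp add: ennreal_numeral_mult ennreal_plus[symmetric] del: ennreal_plus)
    also have "\<dots> \<le> ennreal (4 * (1 / 4) ^ j)"
      using power_decreasing[OF that, of "1/4 :: real"] by (intro ennreal_leI) auto
    finally show ?thesis .
  qed
  let ?d = "\<lambda>j k. norm (?F (Suc j) k - ?F j k)"
  define S where "S k = (\<Sum>j. ennreal (2 ^ j) * ennreal ((?d j k)^2))" for k
  have "(\<integral>\<^sup>+k. S k \<partial>lborel) = (\<Sum>j. ennreal (2 ^ j) * L2sq (\<lambda>k. ?F (Suc j) k - ?F j k))"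
    unfolding S_def L2sq_def by (subst nn_integral_suminf) (auto simp: nn_integral_cmult)
  also have "\<dots> \<le> (\<Sum>j. ennreal (4 * (1 / 2) ^ j))"
  proof (intro suminf_le summableI)
    fix j
    have "ennreal (2 ^ j) * L2sq (\<lambda>k. ?F (Suc j) k - ?F j k) \<le> ennreal (2 ^ j) * ennreal (4 * (1 / 4) ^ j)"
      by (intro mult_left_mono dist) auto
    also have "\<dots> = ennreal (4 * (1 / 2) ^ j)"
    proof -
      have "(4::real) ^ j = 2 ^ j * 2 ^ j" by (simp add: power_mult_distrib[symmetric])
      then show ?thesis by (simp add: ennreal_mult[symmetric] power_divide)
    qed
    finally show "ennreal (2 ^ j) * L2sq (\<lambda>k. ?F (Suc j) k - ?F j k) \<le> ennreal (4 * (1 / 2) ^ j)" .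
  qed
  also have "\<dots> = ennreal (\<Sum>j. 4 * (1 / 2) ^ j)"
    by (intro suminf_ennreal2 summable_mult summable_geometric) auto
  finally have "(\<integral>\<^sup>+k. S k \<partial>lborel) \<noteq> \<infinity>"
    by (auto simp: top_unique)
  then have S: "AE k in lborel. S k \<noteq> \<infinity>"
    by (intro nn_integral_noteq_infinite) (auto simp: S_def[abs_def])
  have conv: "AE k in lborel. (\<lambda>j. ?F j k) \<longlonglongrightarrow> lim (\<lambda>j. ?F j k)"
    using S
  proof eventually_elim
    fix k assume "S k \<noteq> \<infinity>"
    then obtain C where C: "S k = ennreal C" "C \<ge> 0" by (cases "S k") auto
    have le: "?d j k \<le> sqrt C * (sqrt (1 / 2)) ^ j" for j
    proof -
      have "(\<Sum>i\<in>{j}. ennreal (2 ^ i) * ennreal ((?d i k)^2)) \<le> S k"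
        unfolding S_def by (rule sum_le_suminf) auto
      then have "ennreal (2 ^ j * (?d j k)^2) \<le> ennreal C"
        using C by (simp add: ennreal_mult)
      then have "(?d j k)^2 \<le> C * (1 / 2) ^ j"
        using C by (simp add: field_simps power_divide)
      then have "?d j k \<le> sqrt (C * (1 / 2) ^ j)"
        by (rule real_le_rsqrt)
      then show ?thesis by (simp only: real_sqrt_mult real_sqrt_power)
    qed
    have "summable (\<lambda>j. sqrt C * (sqrt (1 / 2)) ^ j)"
      by (intro summable_mult summable_geometric) (simp add: real_less_rsqrt real_sqrt_lt_1_iff)
    then have "summable (\<lambda>j. ?F (Suc j) k - ?F j k)"
      by (rule summable_comparison_test'[where N = 0]) (rule le)
    then have "convergent (\<lambda>n. \<Sum>j<n. (?F (Suc j) k - ?F j k))"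
      by (simp add: summable_iff_convergent)
    then have "convergent (\<lambda>n. ?F n k - ?F 0 k)"
    proof -
      have "(\<Sum>j<n. (?F (Suc j) k - ?F j k)) = ?F n k - ?F 0 k" for n
        by (induction n) auto
      then show ?thesis using \<open>convergent (\<lambda>n. \<Sum>j<n. _ j)\<close> by simp
    qed
    then have "convergent (\<lambda>n. (?F n k - ?F 0 k) + ?F 0 k)"
      by (intro convergent_add convergent_const)
    then show "(\<lambda>j. ?F j k) \<longlonglongrightarrow> lim (\<lambda>j. ?F j k)"
      by (simp add: convergent_LIMSEQ_iff)
  qed
  define g where "g k = lim (\<lambda>j. ?F j k)" for k
  have gm [measurable]: "g \<in> borel_measurable borel"
    unfolding g_def[abs_def] by (rule borel_measurable_lim_metric) auto
  have gF: "L2sq (\<lambda>k. g k - ?F j k) \<le> ennreal (4 * (1 / 4) ^ j)" for j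
  proof -
    have "L2sq (\<lambda>k. g k - ?F j k) = (\<integral>\<^sup>+k. liminf (\<lambda>i. ennreal ((norm (?F i k - ?F j k))^2)) \<partial>lborel)"
      unfolding L2sq_def
    proof (rule nn_integral_cong_AE)
      show "AE k in lborel. ennreal ((norm (g k - ?F j k))^2) = liminf (\<lambda>i. ennreal ((norm (?F i k - ?F j k))^2))"
        using conv
      proof eventually_elim
        fix k assume "(\<lambda>j. ?F j k) \<longlonglongrightarrow> lim (\<lambda>j. ?F j k)"
        then have "(\<lambda>i. ?F i k) \<longlonglongrightarrow> g k" by (simp add: g_def)
        then have "(\<lambda>i. ennreal ((norm (?F i k - ?F j k))^2)) \<longlonglongrightarrow> ennreal ((norm (g k - ?F j k))^2)"
          by (intro tendsto_ennrealI tendsto_intros)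
        then show "ennreal ((norm (g k - ?F j k))^2) = liminf (\<lambda>i. ennreal ((norm (?F i k - ?F j k))^2))"
          using lim_imp_Liminf[OF sequentially_bot] by metis
      qed
    qed
    also have "\<dots> \<le> liminf (\<lambda>i. L2sq (\<lambda>k. ?F i k - ?F j k))"
      unfolding L2sq_def by (rule nn_integral_liminf) simp
    also have "\<dots> \<le> ennreal (4 * (1 / 4) ^ j)"
      by (rule Liminf_le) (auto intro!: eventually_sequentiallyI[of j] dist)
    finally show ?thesis .
  qed
  have F2: "?F j \<in> L2_set" for j
    using f1 f2 by (rule L2_set_fourier_integral_and_norm)
  have "(\<lambda>k. g k - ?F 0 k) \<in> L2_set"
    using gF[of 0] by (auto simp: L2_set_iff elim!: order.strict_trans1)
  from L2_set_add[OF this F2[of 0]] have g2: "g \<in> L2_set" by simp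
  have geo: "(\<lambda>j. ennreal (c * (1 / 4) ^ j)) \<longlonglongrightarrow> 0" for c
  proof -
    have "(\<lambda>j. c * (1 / 4) ^ j) \<longlonglongrightarrow> c * 0"
      by (intro tendsto_intros LIMSEQ_power_zero) auto
    then have "(\<lambda>j. ennreal (c * (1 / 4) ^ j)) \<longlonglongrightarrow> ennreal (c * 0)"
      by (rule tendsto_ennrealI)
    then show ?thesis by simp
  qed
  have "L2_tendsto f u"
    unfolding L2_tendsto_iff
    by (rule tendsto_sandwich[OF _ _ tendsto_const geo[of 1]])
       (use fu in \<open>auto simp: L2sq_minus_commute[of _ u] intro!: always_eventually less_imp_le\<close>)
  moreover have "L2_tendsto ?F g"
    unfolding L2_tendsto_iff
    by (rule tendsto_sandwich[OF _ _ tendsto_const geo[of 4]])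
       (use gF in \<open>auto simp: L2sq_minus_commute[of _ g]\<close>)
  ultimately have "is_fourier u g"
    unfolding is_fourier_def using f1 f2 u g2 by (auto intro!: exI[of _ f] L1_setI)
  then show ?thesis by (rule exI[of "is_fourier u" g])
qed

lemma is_fourier_fourier: "u \<in> L2_set \<Longrightarrow> is_fourier u (fourier u)"
  unfolding fourier_def by (rule someI_ex[OF is_fourier_exists])

lemma fourier_AE_eq: "is_fourier u g \<Longrightarrow> AE k in lborel. fourier u k = g k"
  by (blast intro: is_fourier_unique is_fourier_fourier dest: L2_setD_is_fourier)

section \<open>Quadratic forms and norms\<close>

lemma H_half_L2: "u \<in> H_half \<Longrightarrow> u \<in> L2_set"
  by (simp add: H_half_def)

lemma integral_fourier_cong:
  assumes u: "is_fourier u g" and [measurable]: "w \<in> borel_measurable borel"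
  shows "(LINT k|lborel. w k * (norm (fourier u k))^2) = (LINT k|lborel. w k * (norm (g k))^2)"
    and "integrable lborel (\<lambda>k. w k * (norm (fourier u k))^2) \<longleftrightarrow> integrable lborel (\<lambda>k. w k * (norm (g k))^2)"
proof -
  have [measurable]: "g \<in> borel_measurable borel" "fourier u \<in> borel_measurable borel"
    using L2_setD_is_fourier[OF u] L2_setD_is_fourier[OF is_fourier_fourier]
    by (auto dest: L2_set_measurable)
  have ae: "AE k in lborel. w k * (norm (fourier u k))^2 = w k * (norm (g k))^2"
    using fourier_AE_eq[OF u] by eventually_elim simp
  show "(LINT k|lborel. w k * (norm (fourier u k))^2) = (LINT k|lborel. w k * (norm (g k))^2)"
    by (rule integral_cong_AE) (use ae in auto)
  show "integrable lborel (\<lambda>k. w k * (norm (fourier u k))^2) \<longleftrightarrow> integrable lborel (\<lambda>k. w k * (norm (g k))^2)"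
    by (rule integrable_cong_AE) (use ae in auto)
qed

text \<open>
  On \<open>L\<^sup>2\<close> the weights \<open>\<surd>(1 + |k|\<^sup>2)\<close> and \<open>|k|\<close> give the same finiteness condition, and the second
  scales exactly.
\<close>

lemma H_half_iff:
  fixes u :: "real ^ 'n \<Rightarrow> complex"
  assumes u: "is_fourier u g"
  shows "u \<in> H_half \<longleftrightarrow> integrable lborel (\<lambda>k. norm k * (norm (g k))^2)"
proof -
  have L2: "g \<in> L2_set" "u \<in> L2_set" using L2_setD_is_fourier[OF u] by auto
  have [measurable]: "g \<in> borel_measurable borel" using L2 by (auto dest: L2_set_measurable)
  have "u \<in> H_half \<longleftrightarrow> integrable lborel (\<lambda>k. sqrt (1 + (norm k)^2) * (norm (g k))^2)"
    using L2 integral_fourier_cong(2)[OF u, of "\<lambda>k. sqrt (1 + (norm k)^2)"] by (simp add: H_half_def)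
  also have "\<dots> \<longleftrightarrow> integrable lborel (\<lambda>k. norm k * (norm (g k))^2)"
  proof
    assume "integrable lborel (\<lambda>k. sqrt (1 + (norm k)^2) * (norm (g k))^2)"
    then show "integrable lborel (\<lambda>k. norm k * (norm (g k))^2)"
      by (rule Bochner_Integration.integrable_bound)
         (auto simp: abs_mult intro!: mult_right_mono real_le_rsqrt)
  next
    assume "integrable lborel (\<lambda>k. norm k * (norm (g k))^2)"
    then have "integrable lborel (\<lambda>k. norm k * (norm (g k))^2 + (norm (g k))^2)"
      using L2 by (intro Bochner_Integration.integrable_add L2_set_integrable)
    then show "integrable lborel (\<lambda>k. sqrt (1 + (norm k)^2) * (norm (g k))^2)"
    proof (rule Bochner_Integration.integrable_bound)
      have le: "sqrt (1 + (norm k)^2) \<le> norm k + 1" for k :: "real ^ 'n"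
        by (rule real_le_lsqrt) (auto simp: power2_eq_square algebra_simps)
      then show "AE k in lborel. norm (sqrt (1 + (norm k)^2) * (norm (g k))^2) \<le> norm (norm k * (norm (g k))^2 + (norm (g k))^2)"
        using mult_right_mono[OF le, of "(norm (g _))^2"]
        by (intro AE_I2) (simp add: abs_mult distrib_right)
    qed simp
  qed
  finally show ?thesis .
qed

lemma integrable_weight:
  fixes g :: "real ^ 'n \<Rightarrow> complex"
  assumes i: "integrable lborel (\<lambda>k. norm k * (norm (g k))^2)" and g: "g \<in> L2_set"
    and [measurable]: "w \<in> borel_measurable borel" and w: "\<And>k. \<bar>w k\<bar> \<le> C * (norm k + 1)"
  shows "integrable lborel (\<lambda>k. w k * (norm (g k))^2)"
proof (rule Bochner_Integration.integrable_bound)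
  show "integrable lborel (\<lambda>k. C * (norm k * (norm (g k))^2 + (norm (g k))^2))"
    using i g by (intro Bochner_Integration.integrable_add L2_set_integrable integrable_mult_right)
  show "AE k in lborel. norm (w k * (norm (g k))^2) \<le> norm (C * (norm k * (norm (g k))^2 + (norm (g k))^2))"
  proof (rule AE_I2)
    fix k
    have "norm (w k * (norm (g k))^2) \<le> C * (norm k + 1) * (norm (g k))^2"
      using w[of k] by (simp add: abs_mult mult_right_mono)
    also have "\<dots> = C * (norm k * (norm (g k))^2 + (norm (g k))^2)"
      by (simp add: algebra_simps)
    finally show "norm (w k * (norm (g k))^2) \<le> norm (C * (norm k * (norm (g k))^2 + (norm (g k))^2))"
      by simp
  qed
  have [measurable]: "g \<in> borel_measurable borel" using g by measurable
  show "(\<lambda>k. w k * (norm (g k))^2) \<in> borel_measurable lborel" by simp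
qed

lemma inner_le_norm_of_lt1:
  fixes v k :: "'a::euclidean_space"
  assumes "norm v < 1"
  shows "\<bar>v \<bullet> k\<bar> \<le> norm k"
  using Cauchy_Schwarz_ineq2[of v k] assms mult_right_mono[of "norm v" 1 "norm k"] by simp

lemma half_wave_weight:
  fixes v k :: "'a::euclidean_space"
  assumes "norm v < 1"
  shows "0 \<le> norm k - v \<bullet> k" "\<bar>norm k - v \<bullet> k\<bar> \<le> 2 * (norm k + 1)"
  using inner_le_norm_of_lt1[OF assms, of k] by auto

lemma kinetic_weight:
  fixes v k :: "'a::euclidean_space"
  assumes "norm v < 1" "m > 0"
  shows "sqrt ((norm k)^2 + m\<^sup>2) - m - v \<bullet> k \<le> norm k - v \<bullet> k"
    "\<bar>sqrt ((norm k)^2 + m\<^sup>2) - m - v \<bullet> k\<bar> \<le> 2 * (norm k + 1)"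
proof -
  have iv: "v \<bullet> k \<le> norm k" "- (v \<bullet> k) \<le> norm k"
    using inner_le_norm_of_lt1[OF assms(1), of k] by (auto simp: abs_le_iff)
  have le: "sqrt ((norm k)^2 + m\<^sup>2) \<le> norm k + m"
    using assms by (intro real_le_lsqrt) (auto simp: power2_eq_square algebra_simps)
  moreover have "m \<le> sqrt ((norm k)^2 + m\<^sup>2)"
    using assms by (intro real_le_rsqrt) simp
  moreover note iv norm_ge_zero[of k]
  ultimately have "sqrt ((norm k)^2 + m\<^sup>2) - m - v \<bullet> k \<le> norm k - v \<bullet> k"
    and "sqrt ((norm k)^2 + m\<^sup>2) - m - v \<bullet> k \<le> 2 * norm k"
    and "- (sqrt ((norm k)^2 + m\<^sup>2) - m - v \<bullet> k) \<le> norm k"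
    by linarith+
  then show "sqrt ((norm k)^2 + m\<^sup>2) - m - v \<bullet> k \<le> norm k - v \<bullet> k"
    "\<bar>sqrt ((norm k)^2 + m\<^sup>2) - m - v \<bullet> k\<bar> \<le> 2 * (norm k + 1)"
    using norm_ge_zero[of k] unfolding abs_le_iff distrib_left by (linarith, linarith)
qed

lemma T_form_eq: "is_fourier u g \<Longrightarrow> T_form v u = (LINT k|lborel. (norm k - v \<bullet> k) * (norm (g k))^2)"
  unfolding T_form_def by (rule integral_fourier_cong) auto

lemma kinetic_eq:
  "is_fourier u g \<Longrightarrow> kinetic v m u = (LINT k|lborel. (sqrt ((norm k)^2 + m\<^sup>2) - m - v \<bullet> k) * (norm (g k))^2)"
  unfolding kinetic_def by (rule integral_fourier_cong) auto

lemma Lnorm_powr: "q > 0 \<Longrightarrow> Lnorm q u powr q = (LINT x|lborel. norm (u x) powr q)"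
  by (simp add: Lnorm_def powr_powr)

lemma Lnorm_2_sq: "(Lnorm 2 u)^2 = (LINT x|lborel. (norm (u x))^2)"
proof -
  have "(Lnorm 2 u)^2 = Lnorm 2 u powr 2"
    by (simp add: Lnorm_def)
  also have "\<dots> = (LINT x|lborel. (norm (u x))^2)"
    by (simp add: Lnorm_powr)
  finally show ?thesis .
qed

lemma Lnorm_nonneg: "0 \<le> Lnorm q u"
  by (simp add: Lnorm_def)

section \<open>Mass preserving dilations\<close>

definition dilate :: "real \<Rightarrow> (real ^ 'n \<Rightarrow> complex) \<Rightarrow> real ^ 'n \<Rightarrow> complex" where
  "dilate c u x = complex_of_real (c powr (real CARD('n) / 2)) * u (c *\<^sub>R x)"

lemma integral_dilation:
  fixes F :: "real ^ 'n \<Rightarrow> real"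
  assumes "integrable lborel F" "c > 0"
  shows "(LINT x|lborel. F (c *\<^sub>R x)) = c powr (- real CARD('n)) * (LINT x|lborel. F x)"
  using integral_affine[of F c 0] assms by (simp add: powr_minus powr_realpow)

lemma integrable_dilation:
  fixes F :: "real ^ 'n \<Rightarrow> real"
  assumes "integrable lborel F" "c > 0"
  shows "integrable lborel (\<lambda>x. F (c *\<^sub>R x))"
  using integrable_affine[of F c 0] assms by simp

lemma norm_dilate: "norm (dilate c u x) = c powr (real CARD('n) / 2) * norm (u (c *\<^sub>R x))"
  for u :: "real ^ 'n \<Rightarrow> complex"
  by (simp add: dilate_def norm_mult)

lemma norm_dilate_sq: "c > 0 \<Longrightarrow> (norm (dilate c u x))\<^sup>2 = c powr real CARD('n) * (norm (u (c *\<^sub>R x)))^2"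
  for u :: "real ^ 'n \<Rightarrow> complex"
  by (simp add: norm_dilate power_mult_distrib power2_eq_square[of "_ powr _"] flip: powr_add)

lemma is_fourier_dilate:
  fixes u :: "real ^ 'n \<Rightarrow> complex"
  assumes u: "is_fourier u g" and c: "c > 0"
  shows "is_fourier (dilate c u) (dilate (1 / c) g)"
proof -
  have "c powr (real CARD('n) / 2) * (1 / c ^ CARD('n)) = c powr (real CARD('n) / 2) * c powr (- real CARD('n))"
    by (simp only: powr_minus powr_realpow[OF c] inverse_eq_divide)
  also have "\<dots> = c powr (real CARD('n) / 2 + - real CARD('n))"
    by (rule powr_add[symmetric])
  also have "real CARD('n) / 2 + - real CARD('n) = - (real CARD('n) / 2)"
    by simp
  also have "c powr (- (real CARD('n) / 2)) = (1 / c) powr (real CARD('n) / 2)"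
    using c by (simp only: powr_minus inverse_eq_divide powr_divide powr_one_eq_one less_imp_le zero_le_one)
  finally have e: "c powr (real CARD('n) / 2) * (1 / c ^ CARD('n)) = (1 / c) powr (real CARD('n) / 2)" .
  have "is_fourier (\<lambda>x. complex_of_real (c powr (real CARD('n) / 2)) * u (c *\<^sub>R x))
     (\<lambda>k. complex_of_real (c powr (real CARD('n) / 2)) * (complex_of_real (1 / c ^ CARD('n)) * g (k /\<^sub>R c)))"
    using is_fourier_lincomb[OF is_fourier_dilation[OF u c] is_fourier_dilation[OF u c],
      of "complex_of_real (c powr (real CARD('n) / 2))" 0] by simp
  then show ?thesis
    unfolding dilate_def[abs_def] e[symmetric] by (simp add: mult.assoc inverse_eq_divide)
qed

text \<open>
  The mass term \<open>m\<close> spoils exact scaling of the kinetic energy, but the bound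
  \<open>\<surd>(|k|\<^sup>2 + m\<^sup>2) - m \<le> |k|\<close> replaces it by the homogeneous form \<open>T\<^sub>v\<close> uniformly in \<open>c\<close>.
\<close>

lemma dilate_energy:
  fixes u :: "real ^ 'n \<Rightarrow> complex"
  assumes v: "norm v < 1" and m: "m > 0" and u: "u \<in> W_half" and c: "c > 0" and p: "p > 0"
    and up: "integrable lborel (\<lambda>x. norm (u x) powr p)"
  defines "N \<equiv> real CARD('n)" and "a \<equiv> (Lnorm 2 u)\<^sup>2"
  shows "dilate c u \<in> mass_sphere a"
    and "energy v m p (dilate c u) \<le> c * (T_form v u / 2) - c powr (N * p / 2 - N) * ((LINT x|lborel. norm (u x) powr p) / p)
      - log_term u / 2 - N * a * ln c / 2"
proof -
  have uH: "u \<in> H_half" and ul: "integrable lborel (\<lambda>x. (norm (u x))^2 * ln ((norm (u x))^2))"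
    using u by (auto simp: W_half_def)
  have u2: "u \<in> L2_set" using uH by (rule H_half_L2)
  have [measurable]: "u \<in> borel_measurable borel" using u2 by measurable
  have i2: "integrable lborel (\<lambda>x. (norm (u x))^2)" using u2 by (rule L2_set_integrable)
  define g where "g = fourier u"
  have g: "is_fourier u g" unfolding g_def by (rule is_fourier_fourier[OF u2])
  have g2: "g \<in> L2_set" using L2_setD_is_fourier[OF g] by auto
  have gi: "integrable lborel (\<lambda>k. norm k * (norm (g k))^2)"
    using uH H_half_iff[OF g] by simp
  have F: "is_fourier (dilate c u) (dilate (1 / c) g)" by (rule is_fourier_dilate[OF g c])
  have dg2: "dilate (1 / c) g \<in> L2_set" and du2: "dilate c u \<in> L2_set" using L2_setD_is_fourier[OF F] by auto
  have cN: "c powr (- N) * c powr N = 1" using c by (simp flip: powr_add)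
  have icN: "(1 / c) powr N = c powr (- N)" "(1 / c) powr (- N) = c powr N"
    using c by (simp_all add: powr_divide powr_minus_divide)
  have w: "(norm k - v \<bullet> k) * (norm (dilate (1 / c) g k))^2
      = c * c powr (- N) * ((norm (k /\<^sub>R c) - v \<bullet> (k /\<^sub>R c)) * (norm (g (k /\<^sub>R c)))^2)" for k v
    using c by (simp add: norm_dilate_sq icN N_def[symmetric] inverse_eq_divide field_simps)
  have w0: "norm k * (norm (dilate (1 / c) g k))^2 = c * c powr (- N) * (norm (k /\<^sub>R c) * (norm (g (k /\<^sub>R c)))^2)" for k
    using w[of k 0] by (simp only: inner_zero_left diff_zero)
  have dgi: "integrable lborel (\<lambda>k. norm k * (norm (dilate (1 / c) g k))^2)"
    unfolding w0 using integrable_dilation[OF gi, of "inverse c"] c by (intro integrable_mult_right) simp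
  then have duH: "dilate c u \<in> H_half"
    using H_half_iff[OF F] by simp
  have ln_dil: "(norm (dilate c u x))^2 * ln ((norm (dilate c u x))^2)
      = c powr N * ((norm (u (c *\<^sub>R x)))^2 * ln ((norm (u (c *\<^sub>R x)))^2) + N * ln c * (norm (u (c *\<^sub>R x)))^2)" for x
    using c by (cases "u (c *\<^sub>R x) = 0") (auto simp: norm_dilate_sq N_def[symmetric] ln_mult ln_powr algebra_simps)
  have "integrable lborel (\<lambda>x. c powr N * ((norm (u (c *\<^sub>R x)))^2 * ln ((norm (u (c *\<^sub>R x)))^2) + N * ln c * (norm (u (c *\<^sub>R x)))^2))"
    by (intro integrable_mult_right Bochner_Integration.integrable_add integrable_dilation[OF ul c] integrable_dilation[OF i2 c])
  then have duW: "dilate c u \<in> W_half"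
    using duH unfolding W_half_def ln_dil[symmetric] by simp
  have mass: "(Lnorm 2 (dilate c u))^2 = a"
    unfolding a_def Lnorm_2_sq norm_dilate_sq[OF c] using c cN
    by (simp add: integral_dilation[OF i2 c] N_def[symmetric] mult.assoc[symmetric] mult.commute[of "c powr N"])
  show "dilate c u \<in> mass_sphere a"
    using duW mass by (simp add: mass_sphere_def)
  have "kinetic v m (dilate c u) \<le> (LINT k|lborel. (norm k - v \<bullet> k) * (norm (dilate (1 / c) g k))^2)"
    unfolding kinetic_eq[OF F]
    by (intro integral_mono integrable_weight[OF dgi dg2, where C = 2] mult_right_mono kinetic_weight[OF v m] half_wave_weight[OF v]) auto
  also have "\<dots> = c * c powr (- N) * ((1 / c) powr (- N) * T_form v u)"
    unfolding w T_form_eq[OF g]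
    using integral_dilation[of "\<lambda>k. (norm k - v \<bullet> k) * (norm (g k))^2" "1 / c"] c
      integrable_weight[OF gi g2 _ half_wave_weight(2)[OF v]]
    by (simp add: N_def inverse_eq_divide)
  also have "\<dots> = c * (c powr (- N) * c powr N) * T_form v u"
    unfolding icN by (simp only: mult_ac)
  finally have kin: "kinetic v m (dilate c u) \<le> c * T_form v u"
    unfolding cN by simp
  have "Lnorm p (dilate c u) powr p = (LINT x|lborel. c powr (N * p / 2) * norm (u (c *\<^sub>R x)) powr p)"
    using p by (simp add: Lnorm_powr norm_dilate powr_mult powr_powr N_def)
  also have "\<dots> = c powr (N * p / 2) * (c powr (- N) * (LINT x|lborel. norm (u x) powr p))"
    by (simp add: integral_dilation[OF up c] N_def)
  also have "\<dots> = c powr (N * p / 2 - N) * (LINT x|lborel. norm (u x) powr p)"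
    using powr_add[of c "N * p / 2" "- N"] by simp
  finally have pot: "Lnorm p (dilate c u) powr p = c powr (N * p / 2 - N) * (LINT x|lborel. norm (u x) powr p)" .
  have lt: "(norm (dilate c u x))^2 * (ln ((norm (dilate c u x))^2) - 1)
      = c powr N * ((norm (u (c *\<^sub>R x)))^2 * (ln ((norm (u (c *\<^sub>R x)))^2) - 1)) + c powr N * (N * ln c * (norm (u (c *\<^sub>R x)))^2)" for x
    using ln_dil[of x] c by (simp add: norm_dilate_sq N_def[symmetric] algebra_simps)
  have ul1: "integrable lborel (\<lambda>x. (norm (u x))^2 * (ln ((norm (u x))^2) - 1))"
    using Bochner_Integration.integrable_diff[OF ul i2] by (simp add: right_diff_distrib)
  have "log_term (dilate c u) = c powr N * (c powr (- N) * log_term u) + c powr N * (N * ln c * (c powr (- N) * a))"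
    unfolding log_term_def lt a_def Lnorm_2_sq
    by (subst Bochner_Integration.integral_add)
       (simp_all add: integrable_dilation[OF ul1 c] integrable_dilation[OF i2 c] integral_dilation[OF ul1 c] integral_dilation[OF i2 c] N_def)
  also have "\<dots> = (c powr (- N) * c powr N) * (log_term u + N * ln c * a)"
    by (simp add: algebra_simps)
  finally have lg: "log_term (dilate c u) = log_term u + N * ln c * a"
    unfolding cN by simp
  show "energy v m p (dilate c u) \<le> c * (T_form v u / 2) - c powr (N * p / 2 - N) * ((LINT x|lborel. norm (u x) powr p) / p)
      - log_term u / 2 - N * a * ln c / 2"
    unfolding energy_def pot lg using kin by (simp add: algebra_simps)
qed

text \<open>
  Once the power term dominates the kinetic one, the term \<open>- N a ln c / 2\<close> coming from the logarithmic
  nonlinearity drives the energy to \<open>- \<infinity>\<close>.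
\<close>

lemma min_energy_eq_minus_infinity:
  fixes u :: "real ^ 'n \<Rightarrow> complex"
  assumes v: "norm v < 1" and m: "m > 0" and u: "u \<in> W_half" and p: "p > 0"
    and up: "integrable lborel (\<lambda>x. norm (u x) powr p)" and a: "(Lnorm 2 u)^2 = a" "a > 0"
    and ev: "eventually (\<lambda>c. c * (T_form v u / 2)
      \<le> c powr (real CARD('n) * p / 2 - real CARD('n)) * ((LINT x|lborel. norm (u x) powr p) / p)) at_top"
  shows "min_energy v m p a = - \<infinity>"
proof -
  define N where "N = real CARD('n)"
  have N: "N > 0" by (simp add: N_def)
  have "\<exists>w\<in>mass_sphere a. energy v m p w \<le> B" for B
  proof -
    have "eventually (\<lambda>c. ln c \<ge> 2 / (N * a) * (- log_term u / 2 - B)) at_top"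
      using ln_at_top unfolding filterlim_at_top by blast
    from eventually_conj[OF eventually_conj[OF this ev] eventually_gt_at_top[of 0]]
    obtain c where c: "ln c \<ge> 2 / (N * a) * (- log_term u / 2 - B)" "c > 0"
      and le: "c * (T_form v u / 2) \<le> c powr (N * p / 2 - N) * ((LINT x|lborel. norm (u x) powr p) / p)"
      by (auto simp: N_def dest: eventually_happens)
    have "N * a / 2 * ln c \<ge> N * a / 2 * (2 / (N * a) * (- log_term u / 2 - B))"
      using c N a by (intro mult_left_mono) auto
    also have "N * a / 2 * (2 / (N * a) * (- log_term u / 2 - B)) = - log_term u / 2 - B"
      using N a by simp
    finally have "- log_term u / 2 - N * a * ln c / 2 \<le> B" by simp
    then have "energy v m p (dilate c u) \<le> B"
      using dilate_energy(2)[OF v m u c(2) p up] le unfolding a N_def[symmetric] by linarith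
    then show ?thesis
      using dilate_energy(1)[OF v m u c(2) p up] a by auto
  qed
  then have "min_energy v m p a \<le> ereal B" for B
    unfolding min_energy_def by (meson INF_lower2 ereal_less_eq(3))
  then show ?thesis
    by (metis ereal_bot)
qed

section \<open>The supercritical case\<close>

lemma exp_half_sq_ge: "1 + r\<^sup>2 / 2 \<le> exp (r\<^sup>2 / 2)" for r :: real
  by (rule exp_ge_add_one_self)

lemma gauss_moments:
  fixes x :: "'a::euclidean_space"
  shows "norm x * (gauss x)^2 \<le> gauss x" "(norm x)^2 * (gauss x)^2 \<le> 2 * gauss x" "(gauss x)^2 \<le> gauss x"
proof -
  have e: "exp ((norm x)^2 / 2) * gauss x = 1"
    by (simp add: gauss_def flip: exp_add)
  have "0 \<le> (norm x - 1)^2" by simp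
  then have "2 * norm x \<le> (norm x)^2 + 1" by (simp add: power2_diff)
  then have "norm x \<le> exp ((norm x)^2 / 2)"
    using exp_half_sq_ge[of "norm x"] by linarith
  then have "norm x * gauss x \<le> 1"
    using mult_right_mono[of "norm x" _ "gauss x"] e by fastforce
  from mult_right_mono[OF this, of "gauss x"] show "norm x * (gauss x)^2 \<le> gauss x"
    by (simp add: power2_eq_square mult.assoc)
  have "(norm x)^2 \<le> 2 * exp ((norm x)^2 / 2)"
    using exp_half_sq_ge[of "norm x"] by linarith
  then have "(norm x)^2 * gauss x \<le> 2"
    using mult_right_mono[of "(norm x)^2" "2 * exp ((norm x)^2 / 2)" "gauss x"] e by (simp add: mult.assoc)
  from mult_right_mono[OF this, of "gauss x"] show "(norm x)^2 * (gauss x)^2 \<le> 2 * gauss x"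
    by (simp add: power2_eq_square mult.assoc)
  show "(gauss x)^2 \<le> gauss x"
    using gauss_le_1[of x] by (simp add: power2_eq_square mult_left_le)
qed

lemma gauss_W_half:
  fixes s :: real
  assumes s: "s > 0" and p: "p \<ge> 1"
  defines "u \<equiv> \<lambda>x :: real ^ 'n. complex_of_real (s * gauss x)"
  shows "u \<in> W_half" "integrable lborel (\<lambda>x. norm (u x) powr p)" "0 < (LINT x|lborel. norm (u x) powr p)"
proof -
  have b: "integrable lborel f" if "f \<in> borel_measurable borel" "\<And>x. \<bar>f x\<bar> \<le> C * gauss x" for f :: "real ^ 'n \<Rightarrow> real" and C
    by (rule Bochner_Integration.integrable_bound[OF integrable_mult_right[OF integrable_gauss, of C]])
       (use that(1) in \<open>auto intro!: AE_I2 order_trans[OF that(2)]\<close>)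
  have g2: "integrable lborel (\<lambda>x :: real ^ 'n. (gauss x)^2)"
    by (rule b[where C = 1]) (auto simp: gauss_moments)
  have g1: "integrable lborel (\<lambda>x :: real ^ 'n. norm x * (gauss x)^2)"
    by (rule b[where C = 1]) (auto simp: gauss_moments)
  have g3: "integrable lborel (\<lambda>x :: real ^ 'n. (norm x)^2 * (gauss x)^2)"
    by (rule b[where C = 2]) (auto simp: gauss_moments)
  have "is_fourier (\<lambda>x :: real ^ 'n. complex_of_real (gauss x)) (fourier_integral (\<lambda>x. complex_of_real (gauss x)))"
    using g2 integrable_gauss by (intro is_fourier_integral) (auto simp: L2_set_def)
  then have "is_fourier (\<lambda>x :: real ^ 'n. complex_of_real (gauss x)) (\<lambda>k. complex_of_real (gauss k))"
    by (simp add: fourier_integral_gauss[abs_def])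
  from is_fourier_lincomb[OF this this, of "complex_of_real s" 0]
  have F: "is_fourier u u" by (simp add: u_def)
  have H: "u \<in> H_half"
    unfolding H_half_iff[OF F] using integrable_mult_right[OF g1, of "s\<^sup>2"]
    by (simp add: u_def norm_mult power_mult_distrib mult_ac)
  have "(norm (u x))^2 * ln ((norm (u x))^2) = s\<^sup>2 * (2 * ln s * (gauss x)^2 - (norm x)^2 * (gauss x)^2)" for x
  proof -
    have l: "ln ((norm (u x))^2) = 2 * ln s - (norm x)^2"
      using s by (simp add: u_def norm_mult power_mult_distrib ln_mult ln_realpow gauss_pos) (simp add: gauss_def)
    show ?thesis
      unfolding l by (simp add: u_def norm_mult power_mult_distrib algebra_simps)
  qed
  then show "u \<in> W_half"
    using H g2 g3 by (simp add: W_half_def)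
  have up: "norm (u x) powr p = s powr p * gauss x powr p" for x
    using s by (simp add: u_def norm_mult powr_mult)
  have "gauss x powr p \<le> gauss x powr 1" for x :: "real ^ 'n"
    by (rule powr_mono') (use p gauss_le_1 in auto)
  then have "integrable lborel (\<lambda>x :: real ^ 'n. gauss x powr p)"
    by (intro b[where C = 1]) auto
  then show ip: "integrable lborel (\<lambda>x. norm (u x) powr p)"
    unfolding up by (rule integrable_mult_right)
  have pos: "norm (u x) powr p > 0" for x
    unfolding up using s gauss_pos[of x] by simp
  have "(LINT x|lborel. norm (u x) powr p) \<noteq> 0"
  proof
    assume "(LINT x|lborel. norm (u x) powr p) = 0"
    then have "AE x in lborel. norm (u x) powr p = 0"
      using ip by (subst (asm) integral_nonneg_eq_0_iff_AE) auto
    then have "AE x in (lborel :: (real ^ 'n) measure). False"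
      by eventually_elim (use pos in \<open>auto simp: less_le\<close>)
    then obtain Z :: "(real ^ 'n) set" where "UNIV \<subseteq> Z" "emeasure lborel Z = 0"
      by (auto elim: AE_E)
    then show False by (simp add: top.extremum_unique)
  qed
  then show "0 < (LINT x|lborel. norm (u x) powr p)"
    by (simp add: less_le)
qed

text \<open>
  The exponent \<open>N p / 2 - N\<close> of the power term exceeds \<open>1\<close>, the growth rate of the kinetic term.
\<close>

lemma min_energy_supercritical:
  fixes v :: "real ^ 'n"
  assumes v: "norm v < 1" and p: "2 + 2 / real CARD('n) < p" and a: "a > 0" and m: "m > 0"
  shows "min_energy v m p a = - \<infinity>"
proof -
  define N where "N = real CARD('n)"
  have N: "N > 0" by (simp add: N_def)
  have p0: "p > 2" using p N by (smt (verit) N_def divide_pos_pos)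
  define I where "I = (LINT x|lborel. (gauss (x :: real ^ 'n))^2)"
  have I: "I > 0"
    using gauss_W_half(3)[of 1 2, where 'n = 'n] by (simp add: I_def)
  define s where "s = sqrt (a / I)"
  have s: "s > 0" using a I by (simp add: s_def)
  define u where "u = (\<lambda>x :: real ^ 'n. complex_of_real (s * gauss x))"
  have p1: "p \<ge> 1" using p0 by simp
  have W: "u \<in> W_half" "integrable lborel (\<lambda>x. norm (u x) powr p)" "0 < (LINT x|lborel. norm (u x) powr p)"
    unfolding u_def by (rule gauss_W_half[OF s p1])+
  have mass: "(Lnorm 2 u)^2 = a"
    using a I by (simp add: Lnorm_2_sq u_def norm_mult power_mult_distrib s_def flip: I_def)
  define b where "b = (LINT x|lborel. norm (u x) powr p) / p"
  have b: "b > 0" using W(3) p0 by (simp add: b_def)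
  define q where "q = N * p / 2 - N"
  have "2 / N * N < (p - 2) * N"
    using p N by (intro mult_strict_right_mono) (auto simp: N_def)
  then have q: "q - 1 > 0" using N by (simp add: q_def algebra_simps)
  have "filterlim (\<lambda>c. b * c powr (q - 1)) at_top at_top"
    using b q by real_asymp
  then have "eventually (\<lambda>c. b * c powr (q - 1) \<ge> T_form v u / 2) at_top"
    unfolding filterlim_at_top by blast
  then have "eventually (\<lambda>c. c * (T_form v u / 2) \<le> c powr q * b) at_top"
    using eventually_gt_at_top[of 0]
  proof eventually_elim
    fix c :: real assume "T_form v u / 2 \<le> b * c powr (q - 1)" "0 < c"
    then have "c * (T_form v u / 2) \<le> c * (b * c powr (q - 1))"
      by (intro mult_left_mono) auto
    also have "\<dots> = c powr q * b"
      using \<open>0 < c\<close> by (simp add: powr_diff)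
    finally show "c * (T_form v u / 2) \<le> c powr q * b" .
  qed
  then show ?thesis
    using p0 by (intro min_energy_eq_minus_infinity[OF v m W(1) _ W(2) mass a]) (auto simp: b_def q_def N_def)
qed

section \<open>Decay of the optimizers\<close>

lemma plancherel_integral:
  assumes "is_fourier u g"
  shows "(LINT k|lborel. (norm (g k))^2) = (LINT x|lborel. (norm (u x))^2)"
  using plancherel[OF assms] L2_setD_is_fourier[OF assms] by (simp add: L2sq_eq_integral)

lemma AE_eq_0_if_L2sq: "u \<in> L2_set \<Longrightarrow> L2sq u = 0 \<Longrightarrow> AE x in lborel. u x = 0"
  unfolding L2sq_def by (subst (asm) nn_integral_0_iff_AE) (auto simp: ennreal_eq_0_iff dest: L2_set_measurable)

lemma integrable_norm_weight_lincomb: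
  fixes g h :: "real ^ 'n \<Rightarrow> complex"
  assumes g: "integrable lborel (\<lambda>k. norm k * (norm (g k))^2)" and h: "integrable lborel (\<lambda>k. norm k * (norm (h k))^2)"
    and [measurable]: "g \<in> borel_measurable borel" "h \<in> borel_measurable borel"
  shows "integrable lborel (\<lambda>k. norm k * (norm (a * g k + b * h k))^2)"
proof (rule Bochner_Integration.integrable_bound)
  show "integrable lborel (\<lambda>k. 2 * (norm a)^2 * (norm k * (norm (g k))^2) + 2 * (norm b)^2 * (norm k * (norm (h k))^2))"
    by (intro Bochner_Integration.integrable_add integrable_mult_right g h)
  show "AE k in lborel. norm (norm k * (norm (a * g k + b * h k))^2)
      \<le> norm (2 * (norm a)^2 * (norm k * (norm (g k))^2) + 2 * (norm b)^2 * (norm k * (norm (h k))^2))"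
  proof (rule AE_I2)
    fix k
    have "norm k * (norm (a * g k + b * h k))^2 \<le> norm k * (2 * (norm (a * g k))^2 + 2 * (norm (b * h k))^2)"
      using norm_add_sq_le[of 1 "a * g k" "b * h k"] by (intro mult_left_mono) auto
    also have "\<dots> = 2 * (norm a)^2 * (norm k * (norm (g k))^2) + 2 * (norm b)^2 * (norm k * (norm (h k))^2)"
      by (simp add: norm_mult power_mult_distrib algebra_simps)
    finally show "norm (norm k * (norm (a * g k + b * h k))^2)
      \<le> norm (2 * (norm a)^2 * (norm k * (norm (g k))^2) + 2 * (norm b)^2 * (norm k * (norm (h k))^2))"
      by simp
  qed
qed simp

lemma integrable_norm_weight_translation:
  fixes g :: "real ^ 'n \<Rightarrow> complex"
  assumes g: "integrable lborel (\<lambda>k. norm k * (norm (g k))^2)" and g2: "g \<in> L2_set"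
  shows "integrable lborel (\<lambda>k. norm k * (norm (g (k - \<xi>)))^2)"
proof (rule Bochner_Integration.integrable_bound)
  have [measurable]: "g \<in> borel_measurable borel" using g2 by measurable
  show "integrable lborel (\<lambda>k. norm (k - \<xi>) * (norm (g (k - \<xi>)))^2 + norm \<xi> * (norm (g (k - \<xi>)))^2)"
    using integrable_translation[OF g, of "- \<xi>"] integrable_translation[OF L2_set_integrable[OF g2], of "- \<xi>"]
    by (intro Bochner_Integration.integrable_add integrable_mult_right) auto
  show "AE k in lborel. norm (norm k * (norm (g (k - \<xi>)))^2)
      \<le> norm (norm (k - \<xi>) * (norm (g (k - \<xi>)))^2 + norm \<xi> * (norm (g (k - \<xi>)))^2)"
  proof (rule AE_I2)
    fix k
    have "norm k \<le> norm (k - \<xi>) + norm \<xi>"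
      using norm_triangle_ineq[of "k - \<xi>" \<xi>] by simp
    from mult_right_mono[OF this, of "(norm (g (k - \<xi>)))^2"]
    show "norm (norm k * (norm (g (k - \<xi>)))^2)
      \<le> norm (norm (k - \<xi>) * (norm (g (k - \<xi>)))^2 + norm \<xi> * (norm (g (k - \<xi>)))^2)"
      by (simp add: distrib_right)
  qed
  show "(\<lambda>k. norm k * (norm (g (k - \<xi>)))^2) \<in> borel_measurable lborel" by simp
qed

text \<open>
  With \<open>y = |e\<^bsup>i \<xi> \<cdot> x\<^esup> - 1|\<close> this interpolates between the constant and the critical power.  The exponent
  \<open>- N\<close> is what makes both terms linear in the form when \<open>r\<close> is chosen as \<open>G\<^bsup>- 1/N\<^esup>\<close> below.
\<close>

lemma young_split:
  fixes N r y :: real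
  assumes N: "N > 0" and r: "r > 0" and y: "y \<ge> 0"
  shows "y\<^sup>2 \<le> r powr (- N) + r * y powr (2 + 2 / N)"
proof (cases "r * y powr (2 / N) \<ge> 1")
  case True
  have "y\<^sup>2 * 1 \<le> y\<^sup>2 * (r * y powr (2 / N))"
    using True by (intro mult_left_mono) auto
  also have "\<dots> = r * y powr (2 + 2 / N)"
    using y by (simp add: powr_add)
  finally have "y\<^sup>2 \<le> r * y powr (2 + 2 / N)" by simp
  then show ?thesis using powr_ge_zero[of r "- N"] by linarith
next
  case False
  then have "y powr (2 / N) \<le> 1 / r"
    using r by (simp add: field_simps)
  then have "(y powr (2 / N)) powr N \<le> (1 / r) powr N"
    using N by (intro powr_mono2) auto
  then have "y\<^sup>2 \<le> r powr (- N)"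
    using N y r by (simp add: powr_powr powr_divide powr_minus_divide)
  moreover have "0 \<le> r * y powr (2 + 2 / N)" using r by simp
  ultimately show ?thesis by linarith
qed

text \<open>
  Applied with \<open>t = |u(x)|\<^sup>2\<close> and \<open>y = |x|\<^sup>2\<close>.  Large \<open>t\<close> is controlled by the critical power; for small \<open>t\<close>
  either \<open>t \<ge> e\<^bsup>- y\<^esup>\<close>, and the logarithm is at most \<open>y\<close>, or \<open>t |ln t| \<le> 2 \<surd>t\<close> is below a Gaussian.
\<close>

lemma entropy_bound:
  fixes N t y :: real
  assumes N: "N > 0" and t: "t \<ge> 0" and y: "y \<ge> 0"
  shows "\<bar>t * ln t\<bar> \<le> N * t powr (1 + 1 / N) + y * t + 2 * exp (- y / 2)"
proof -
  have nn: "0 \<le> N * t powr (1 + 1 / N)" "0 \<le> y * t" "0 \<le> 2 * exp (- y / 2)"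
    using assms by auto
  consider "t = 0" | "t \<ge> 1" | "0 < t" "t < 1" "exp (- y) \<le> t" | "0 < t" "t < 1" "t < exp (- y)"
    using t by linarith
  then show ?thesis
  proof cases
    case 1
    then show ?thesis using nn by simp
  next
    case 2
    have "ln t = N * ln (t powr (1 / N))"
      using N 2 by (simp add: ln_powr)
    also have "\<dots> \<le> N * t powr (1 / N)"
      using N 2 ln_bound[of "t powr (1 / N)"] by (intro mult_left_mono) auto
    finally have "t * ln t \<le> t * (N * t powr (1 / N))"
      using 2 by (intro mult_left_mono) auto
    also have "\<dots> = N * t powr (1 + 1 / N)"
      using 2 by (simp add: powr_add)
    finally have "\<bar>t * ln t\<bar> \<le> N * t powr (1 + 1 / N)"
      using 2 by simp
    then show ?thesis using nn by linarith
  next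
    case 3
    then have "- y \<le> ln t"
      by (metis exp_gt_zero ln_exp ln_le_cancel_iff)
    then have "t * (- ln t) \<le> t * y"
      using 3 by (intro mult_left_mono) auto
    moreover have "\<bar>t * ln t\<bar> = t * (- ln t)"
      using 3 by (simp add: abs_mult)
    ultimately show ?thesis using nn unfolding mult.commute[of y] by linarith
  next
    case 4
    have s: "sqrt t > 0" "sqrt t * sqrt t = t" using 4 by auto
    have "ln (1 / sqrt t) \<le> 1 / sqrt t"
      using s by (intro ln_bound) auto
    then have "- ln t \<le> 2 / sqrt t"
      using 4 by (simp add: ln_div ln_sqrt)
    then have "t * (- ln t) \<le> t * (2 / sqrt t)"
      using 4 by (intro mult_left_mono) auto
    also have "\<dots> = 2 * sqrt t"
      using s by (simp add: field_simps)
    also have "sqrt t \<le> sqrt (exp (- y))"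
      using 4 by simp
    also have "sqrt (exp (- y)) = exp (- y / 2)"
      by (rule real_sqrt_unique) (auto simp: power2_eq_square simp flip: exp_add)
    finally have "t * (- ln t) \<le> 2 * exp (- y / 2)" by simp
    moreover have "\<bar>t * ln t\<bar> = t * (- ln t)"
      using 4 by (simp add: abs_mult)
    ultimately show ?thesis using nn by linarith
  qed
qed

lemma W_half_of_moments:
  fixes u :: "real ^ 'n \<Rightarrow> complex"
  assumes u: "u \<in> H_half" and p: "integrable lborel (\<lambda>x. norm (u x) powr (2 + 2 / real CARD('n)))"
    and m: "integrable lborel (\<lambda>x. (norm x)^2 * (norm (u x))^2)"
  shows "u \<in> W_half"
proof -
  have [measurable]: "u \<in> borel_measurable borel" using H_half_L2[OF u] by measurable
  have "integrable lborel (\<lambda>x. real CARD('n) * norm (u x) powr (2 + 2 / real CARD('n)) + (norm x)^2 * (norm (u x))^2 + 2 * gauss x)"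
    by (intro Bochner_Integration.integrable_add integrable_mult_right p m integrable_gauss)
  then have "integrable lborel (\<lambda>x. (norm (u x))^2 * ln ((norm (u x))^2))"
  proof (rule Bochner_Integration.integrable_bound)
    show "AE x in lborel. norm ((norm (u x))^2 * ln ((norm (u x))^2))
      \<le> norm (real CARD('n) * norm (u x) powr (2 + 2 / real CARD('n)) + (norm x)^2 * (norm (u x))^2 + 2 * gauss x)"
    proof (rule AE_I2)
      fix x
      have "((norm (u x))^2) powr (1 + 1 / real CARD('n)) = (norm (u x) powr 2) powr (1 + 1 / real CARD('n))"
        by simp
      also have "\<dots> = norm (u x) powr (2 + 2 / real CARD('n))"
        unfolding powr_powr by (simp add: distrib_left)
      finally have e: "((norm (u x))^2) powr (1 + 1 / real CARD('n)) = norm (u x) powr (2 + 2 / real CARD('n))" .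
      have "\<bar>(norm (u x))\<^sup>2 * ln ((norm (u x))^2)\<bar>
        \<le> real CARD('n) * norm (u x) powr (2 + 2 / real CARD('n)) + (norm x)^2 * (norm (u x))^2 + 2 * gauss x"
        using entropy_bound[of "real CARD('n)" "(norm (u x))^2" "(norm x)^2"] unfolding e gauss_def by simp
      then show "norm ((norm (u x))^2 * ln ((norm (u x))^2))
        \<le> norm (real CARD('n) * norm (u x) powr (2 + 2 / real CARD('n)) + (norm x)^2 * (norm (u x))^2 + 2 * gauss x)"
        unfolding real_norm_def by linarith
    qed
  qed simp
  with u show ?thesis by (simp add: W_half_def)
qed

text \<open>
  The symbol \<open>|k| - v \<cdot> k\<close> vanishes only at the origin, so a vanishing form forces the transform, and by
  Plancherel's theorem the function, to be null.
\<close>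

lemma T_form_pos:
  fixes v :: "real ^ 'n"
  assumes v: "norm v < 1" and u: "u \<in> H_half" and n0: "\<not> (AE x in lborel. u x = 0)"
  shows "T_form v u > 0"
proof -
  define g where "g = fourier u"
  have g: "is_fourier u g" unfolding g_def by (rule is_fourier_fourier[OF H_half_L2[OF u]])
  have g2: "g \<in> L2_set" using L2_setD_is_fourier[OF g] by auto
  have gi: "integrable lborel (\<lambda>k. norm k * (norm (g k))^2)"
    using u H_half_iff[OF g] by simp
  have i: "integrable lborel (\<lambda>k. (norm k - v \<bullet> k) * (norm (g k))^2)"
    by (rule integrable_weight[OF gi g2 _ half_wave_weight(2)[OF v]]) simp
  have nn: "AE k in lborel. 0 \<le> (norm k - v \<bullet> k) * (norm (g k))^2"
    using half_wave_weight(1)[OF v] by (intro AE_I2 mult_nonneg_nonneg) auto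
  have "T_form v u \<noteq> 0"
  proof
    assume "T_form v u = 0"
    then have "AE k in lborel. (norm k - v \<bullet> k) * (norm (g k))^2 = 0"
      unfolding T_form_eq[OF g] using integral_nonneg_eq_0_iff_AE[OF i nn] by simp
    moreover have "AE k in lborel. k \<noteq> (0 :: real ^ 'n)"
      by (rule AE_lborel_singleton)
    ultimately have "AE k in lborel. g k = 0"
    proof eventually_elim
      fix k assume k: "(norm k - v \<bullet> k) * (norm (g k))^2 = 0" "k \<noteq> 0"
      have "v \<bullet> k \<le> norm v * norm k" by (rule norm_cauchy_schwarz)
      also have "\<dots> < 1 * norm k" using v k by (intro mult_strict_right_mono) auto
      finally show "g k = 0" using k by simp
    qed
    then have "L2sq g = 0"
      unfolding L2sq_def by (subst nn_integral_0_iff_AE) (use L2_set_measurable[OF g2] in auto)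
    then show False
      using plancherel[OF g] AE_eq_0_if_L2sq[of u] H_half_L2[OF u] n0 by simp
  qed
  moreover have "T_form v u \<ge> 0"
    unfolding T_form_eq[OF g] by (rule integral_nonneg_AE[OF nn])
  ultimately show ?thesis by simp
qed

text \<open>
  The form of \<open>(\<surd>(-\<Delta>) + i v \<cdot> \<nabla>) + 1\<close> at \<open>(e\<^bsup>i \<xi> \<cdot> x\<^esup> - 1) Q\<close>, up to a commutator of size \<open>|\<xi>|\<close>,
  is its sesquilinear form between \<open>Q\<close> and \<open>|e\<^bsup>i \<xi> \<cdot> x\<^esup> - 1|\<^sup>2 Q\<close>.
\<close>

lemma commutator_bound:
  fixes g :: "real ^ 'n \<Rightarrow> complex"
  assumes v: "norm v < 1" and gi: "integrable lborel (\<lambda>k. norm k * (norm (g k))^2)" and g2: "g \<in> L2_set"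
  defines "H \<equiv> \<lambda>k. norm k - v \<bullet> k + 1"
  shows "(LINT k|lborel. H k * (norm (g k - g (k - \<xi>)))^2)
    \<le> 2 * Re (LINT k|lborel. complex_of_real (H k) * g k * cnj (2 * g k - g (k - \<xi>) - g (k + \<xi>)))
      + 4 * (norm \<xi>)^2 * (LINT k|lborel. (norm (g k))^2)"
proof -
  let ?W = "LINT k|lborel. complex_of_real (H k) * g k * cnj (2 * g k - g (k - \<xi>) - g (k + \<xi>))"
  have [measurable]: "g \<in> borel_measurable borel" using g2 by measurable
  have [measurable]: "H \<in> borel_measurable borel" unfolding H_def by measurable
  have Hnn: "0 \<le> H k" "1 \<le> H k" "\<bar>H k\<bar> \<le> 3 * (norm k + 1)" for k
    using inner_le_norm_of_lt1[OF v, of k] norm_ge_zero[of k] unfolding H_def abs_le_iff by auto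
  have tr: "integrable lborel (\<lambda>k. norm k * (norm (g (k - \<zeta>)))^2)" for \<zeta>
    by (rule integrable_norm_weight_translation[OF gi g2])
  have tr2: "(\<lambda>k. g (k - \<zeta>)) \<in> L2_set" for \<zeta>
    using L2_set_translation[OF g2, of "- \<zeta>"] by simp
  have Hi: "integrable lborel (\<lambda>k. H k * (norm (g (k - \<zeta>)))^2)" for \<zeta>
    by (rule integrable_weight[OF tr tr2 _ Hnn(3)]) simp
  have pair: "integrable lborel (\<lambda>k. complex_of_real (H k) * g k * cnj (g (k - \<zeta>)))" for \<zeta>
  proof (rule Bochner_Integration.integrable_bound)
    show "integrable lborel (\<lambda>k. H k * (norm (g (k - 0)))^2 + H k * (norm (g (k - \<zeta>)))^2)"
      by (intro Bochner_Integration.integrable_add Hi)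
    show "AE k in lborel. norm (complex_of_real (H k) * g k * cnj (g (k - \<zeta>))) \<le> norm (H k * (norm (g (k - 0)))^2 + H k * (norm (g (k - \<zeta>)))^2)"
    proof (rule AE_I2)
      fix k
      show "norm (complex_of_real (H k) * g k * cnj (g (k - \<zeta>))) \<le> norm (H k * (norm (g (k - 0)))^2 + H k * (norm (g (k - \<zeta>)))^2)"
        using Hnn(1)[of k] mult_left_mono[OF norm_mult_le_sq Hnn(1)[of k], of "g k" "g (k - \<zeta>)"]
        by (simp add: norm_mult distrib_left mult.assoc)
    qed
  qed simp
  define A where "A \<zeta> k = complex_of_real (H k) * g k * cnj (g k - g (k - \<zeta>))" for \<zeta> k
  have Ai: "integrable lborel (A \<zeta>)" for \<zeta>
    using Bochner_Integration.integrable_diff[OF pair[of 0] pair[of \<zeta>]]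
    by (simp add: A_def[abs_def] right_diff_distrib)
  have "?W
      = (LINT k|lborel. A \<xi> k + A (- \<xi>) k)"
    by (intro Bochner_Integration.integral_cong) (auto simp: A_def algebra_simps)
  also have "\<dots> = (LINT k|lborel. A \<xi> k) + (LINT k|lborel. A (- \<xi>) (k - \<xi>))"
    using integral_translation[OF Ai, of "- \<xi>" "- \<xi>"] by (simp add: Bochner_Integration.integral_add[OF Ai Ai])
  also have "\<dots> = (LINT k|lborel. A \<xi> k + A (- \<xi>) (k - \<xi>))"
    using integrable_translation[OF Ai, of "- \<xi>" "- \<xi>"]
    by (subst Bochner_Integration.integral_add) (auto simp: Ai)
  finally have e: "?W
      = (LINT k|lborel. A \<xi> k + A (- \<xi>) (k - \<xi>))" .
  have Bi: "integrable lborel (\<lambda>k. A \<xi> k + A (- \<xi>) (k - \<xi>))"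
    using integrable_translation[OF Ai, of "- \<xi>" "- \<xi>"] by (intro Bochner_Integration.integrable_add Ai) simp
  have Di: "integrable lborel (\<lambda>k. H k * (norm (g k - g (k - \<xi>)))^2)"
  proof (rule integrable_weight[OF _ _ _ Hnn(3)])
    show "integrable lborel (\<lambda>k. norm k * (norm (g k - g (k - \<xi>)))^2)"
      using integrable_norm_weight_lincomb[OF gi tr[of \<xi>], of 1 "-1"] by simp
  qed (use g2 tr2 in auto)
  have "(LINT k|lborel. H k * (norm (g k - g (k - \<xi>)))^2) / 2 - 2 * (norm \<xi>)^2 * (LINT k|lborel. (norm (g k))^2)
      = (LINT k|lborel. H k * (norm (g k - g (k - \<xi>)))^2 / 2 - 2 * (norm \<xi>)^2 * (norm (g (k - \<xi>)))^2)"
    using Di L2_set_integrable[OF tr2[of \<xi>]] integral_translation[OF L2_set_integrable[OF g2], of "- \<xi>"]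
    by (subst Bochner_Integration.integral_diff) auto
  also have "\<dots> \<le> (LINT k|lborel. Re (A \<xi> k + A (- \<xi>) (k - \<xi>)))"
  proof (intro integral_mono)
    show "integrable lborel (\<lambda>k. Re (A \<xi> k + A (- \<xi>) (k - \<xi>)))"
      by (rule integrable_Re[OF Bi])
    show "integrable lborel (\<lambda>k. H k * (norm (g k - g (k - \<xi>)))^2 / 2 - 2 * (norm \<xi>)^2 * (norm (g (k - \<xi>)))^2)"
      using Di L2_set_integrable[OF tr2[of \<xi>]] by auto
    fix k
    define B D where "B = g (k - \<xi>)" and "D = g k - g (k - \<xi>)"
    have gk: "g k = B + D" by (simp add: B_def D_def)
    have "A \<xi> k + A (- \<xi>) (k - \<xi>) = complex_of_real (H k) * (B + D) * cnj D - complex_of_real (H (k - \<xi>)) * B * cnj D"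
      by (simp add: A_def gk B_def[symmetric] algebra_simps)
    also have "\<dots> = complex_of_real (H k * (norm D)^2) + complex_of_real (H k - H (k - \<xi>)) * (B * cnj D)"
      unfolding of_real_mult complex_norm_square by (simp add: algebra_simps)
    finally have r: "Re (A \<xi> k + A (- \<xi>) (k - \<xi>)) = H k * (norm D)^2 + (H k - H (k - \<xi>)) * Re (B * cnj D)"
      by simp
    have "\<bar>norm k - norm (k - \<xi>)\<bar> \<le> norm \<xi>"
      using norm_triangle_ineq3[of k "k - \<xi>"] by simp
    moreover have "\<bar>v \<bullet> \<xi>\<bar> \<le> norm \<xi>"
      by (rule inner_le_norm_of_lt1[OF v])
    moreover have "H k - H (k - \<xi>) = (norm k - norm (k - \<xi>)) - v \<bullet> \<xi>"
      by (simp add: H_def inner_diff_right)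
    ultimately have dH: "\<bar>H k - H (k - \<xi>)\<bar> \<le> 2 * norm \<xi>"
      by linarith
    have "\<bar>(H k - H (k - \<xi>)) * Re (B * cnj D)\<bar> \<le> (2 * norm \<xi>) * (norm B * norm D)"
      unfolding abs_mult using abs_Re_le_cmod[of "B * cnj D"] dH by (intro mult_mono) (auto simp: norm_mult)
    also have "\<dots> \<le> (norm D)^2 / 2 + 2 * (norm \<xi>)^2 * (norm B)^2"
      using sum_squares_bound[of "norm D" "2 * norm \<xi> * norm B"] by (simp add: power_mult_distrib algebra_simps)
    finally have "\<bar>(H k - H (k - \<xi>)) * Re (B * cnj D)\<bar> \<le> (norm D)^2 / 2 + 2 * (norm \<xi>)^2 * (norm B)^2" .
    moreover have "(norm D)^2 / 2 \<le> H k * (norm D)^2 / 2"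
      using mult_right_mono[OF Hnn(2)[of k], of "(norm D)^2"] by simp
    ultimately show "H k * (norm (g k - g (k - \<xi>)))^2 / 2 - 2 * (norm \<xi>)^2 * (norm (g (k - \<xi>)))^2 \<le> Re (A \<xi> k + A (- \<xi>) (k - \<xi>))"
      unfolding r unfolding D_def[symmetric] unfolding B_def[symmetric] by linarith
  qed
  also have "\<dots> = Re (LINT k|lborel. A \<xi> k + A (- \<xi>) (k - \<xi>))"
    by (rule integral_Re[OF Bi])
  finally show ?thesis
    unfolding e by simp
qed

lemma GN_optimizerD:
  fixes v :: "real ^ 'n"
  assumes Q: "GN_optimizer v Q"
  defines "N \<equiv> real CARD('n)"
  defines "C \<equiv> (N + 1) / (N * Lnorm 2 Q powr (2 / N))"
  shows "Q \<in> H_half" "\<not> (AE x in lborel. Q x = 0)"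
    and "\<And>w. w \<in> H_half \<Longrightarrow>
        (LINT k|lborel. complex_of_real (norm k - v \<bullet> k + 1) * fourier Q k * cnj (fourier w k)) =
        (LINT x|lborel. complex_of_real (norm (Q x) powr (2 / N)) * Q x * cnj (w x))"
      (is "\<And>w. _ \<Longrightarrow> ?lhs w = ?rhs w")
    and "\<And>u. u \<in> H_half \<Longrightarrow> (LINT x|lborel. norm (u x) powr (2 + 2 / N)) \<le> C * T_form v u * Lnorm 2 u powr (2 / N)"
      (is "\<And>u. _ \<Longrightarrow> ?pow u \<le> _")
    and "(LINT x|lborel. norm (Q x) powr (2 + 2 / N)) = C * T_form v Q * Lnorm 2 Q powr (2 / N)"
proof -
  have "2 + 2 / N > 0" by (simp add: N_def add_pos_nonneg)
  note D = Q[unfolded GN_optimizer_def half_laplace_solution_def Let_def, folded N_def,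
      unfolded Lnorm_powr[OF this], folded C_def]
  from D show "Q \<in> H_half" "\<not> (AE x in lborel. Q x = 0)" by blast+
  from D show "\<And>w. w \<in> H_half \<Longrightarrow> ?lhs w = ?rhs w" by blast
  from D show "\<And>u. u \<in> H_half \<Longrightarrow> ?pow u \<le> C * T_form v u * Lnorm 2 u powr (2 / N)" by blast
  from D show "?pow Q = C * T_form v Q * Lnorm 2 Q powr (2 / N)" by blast
qed

lemma GN_optimizer_mass_pos:
  assumes Q: "GN_optimizer v Q"
  shows "Lnorm 2 Q > 0"
proof -
  have QH: "Q \<in> H_half" "\<not> (AE x in lborel. Q x = 0)" using GN_optimizerD[OF Q] by auto
  then have "L2sq Q \<noteq> 0" using AE_eq_0_if_L2sq[OF H_half_L2[OF QH(1)]] by auto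
  then have "(Lnorm 2 Q)^2 \<noteq> 0"
    unfolding Lnorm_2_sq L2sq_eq_integral[OF H_half_L2[OF QH(1)]] by auto
  then show ?thesis using Lnorm_nonneg[of 2 Q] by (simp add: less_le)
qed

text \<open>
  Equality in the inequality gives the integral a nonzero value; as the integral of a
  non-integrable function is \<open>0\<close> by convention, integrability follows without the Sobolev embedding.
\<close>

lemma GN_optimizer_power:
  fixes v :: "real ^ 'n"
  assumes v: "norm v < 1" and Q: "GN_optimizer v Q"
  defines "N \<equiv> real CARD('n)"
  shows "(LINT x|lborel. norm (Q x) powr (2 + 2 / N)) = (N + 1) / N * T_form v Q"
    and "integrable lborel (\<lambda>x. norm (Q x) powr (2 + 2 / N))"
proof -
  have L: "Lnorm 2 Q > 0" by (rule GN_optimizer_mass_pos[OF Q])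
  have N: "N > 0" by (simp add: N_def)
  show e: "(LINT x|lborel. norm (Q x) powr (2 + 2 / N)) = (N + 1) / N * T_form v Q"
    unfolding N_def GN_optimizerD(5)[OF Q] using L by simp
  have "T_form v Q > 0"
    using GN_optimizerD(1,2)[OF Q] v by (intro T_form_pos)
  then have "(LINT x|lborel. norm (Q x) powr (2 + 2 / N)) \<noteq> 0"
    unfolding e using N by simp
  then show "integrable lborel (\<lambda>x. norm (Q x) powr (2 + 2 / N))"
    using not_integrable_integral_eq by blast
qed

lemma cis_second_difference: "2 - cis t - cis (- t) = complex_of_real ((norm (cis t - 1))^2)"
  unfolding cmod_power2
  by (simp add: complex_eq_iff power2_eq_square algebra_simps sin_squared_eq)

lemma norm_cis_minus_1_le: "norm (cis t - 1) \<le> \<bar>t\<bar>" "norm (cis t - 1) \<le> 2"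
proof -
  have "(norm (cis t - 1))^2 = 2 - 2 * cos t"
    using cis_second_difference[of t, THEN arg_cong[of _ _ Re]] by simp
  also have "\<dots> = (2 * sin (t / 2))^2"
    using cos_double_sin[of "t / 2"] by (simp add: power_mult_distrib)
  finally have "(norm (cis t - 1))^2 = \<bar>2 * sin (t / 2)\<bar>\<^sup>2"
    by (simp only: power2_abs)
  then have "norm (cis t - 1) = \<bar>2 * sin (t / 2)\<bar>"
    by (rule power2_eq_imp_eq) simp_all
  then show "norm (cis t - 1) \<le> \<bar>t\<bar>" "norm (cis t - 1) \<le> 2"
    using abs_sin_x_le_abs_x[of "t / 2"] abs_sin_le_one[of "t / 2"] by (auto simp: abs_mult)
qed

lemma small_tail:
  fixes f :: "real ^ 'n \<Rightarrow> real"
  assumes f: "integrable lborel f" "\<And>x. 0 \<le> f x" and e: "e > 0"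
  obtains R :: real where "R > 0" "(LINT x|lborel. indicator {x. norm x > R} x * f x) \<le> e"
proof -
  have [measurable]: "f \<in> borel_measurable borel" using f by auto
  have "(\<lambda>n. LINT x|lborel. indicator {x. norm x > real n} x * f x) \<longlonglongrightarrow> (LINT x|(lborel :: (real ^ 'n) measure). 0)"
  proof (rule integral_dominated_convergence[where w = f])
    show "AE x in lborel. (\<lambda>n. indicator {x. norm x > real n} x * f x) \<longlonglongrightarrow> 0"
    proof (rule AE_I2)
      fix x :: "real ^ 'n"
      have "eventually (\<lambda>n. norm x \<le> real n) sequentially"
        using filterlim_real_sequentially[unfolded filterlim_at_top] by (rule spec)
      then have "eventually (\<lambda>n. indicator {x. norm x > real n} x * f x = 0) sequentially"
        by eventually_elim (auto simp: indicator_def)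
      then show "(\<lambda>n. indicator {x. norm x > real n} x * f x) \<longlonglongrightarrow> 0"
        by (rule tendsto_eventually)
    qed
    show "AE x in lborel. norm (indicator {x. norm x > real n} x * f x) \<le> f x" for n
      using f(2) by (intro AE_I2) (auto simp: indicator_def)
  qed (use f in auto)
  then have "(\<lambda>n. LINT x|lborel. indicator {x. norm x > real n} x * f x) \<longlonglongrightarrow> 0" by simp
  then have "eventually (\<lambda>n. (LINT x|lborel. indicator {x. norm x > real n} x * f x) < e) sequentially"
    using e by (rule order_tendstoD)
  with eventually_gt_at_top[of 0]
  have "eventually (\<lambda>n. 0 < n \<and> (LINT x|lborel. indicator {x. norm x > real n} x * f x) < e) sequentially"
    by (rule eventually_conj)
  then obtain n where "0 < n" "(LINT x|lborel. indicator {x. norm x > real n} x * f x) < e"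
    by (auto dest: eventually_happens)
  then show ?thesis by (intro that[of "real n"]) auto
qed

text \<open>
  Write \<open>z = e\<^bsup>i \<xi> \<cdot> x\<^esup> - 1\<close> and let \<open>G\<close> be the form of \<open>\<surd>(-\<Delta>) + i v \<cdot> \<nabla> + 1\<close> at \<open>z Q\<close>.  The equation tested
  with \<open>|z|\<^sup>2 Q\<close> gives \<open>G \<le> 2 \<integral> |z|\<^sup>2 |Q|\<^sup>p + O(|\<xi>|\<^sup>2)\<close>.  Inside the ball of radius \<open>R\<close> one has
  \<open>|z| \<le> R |\<xi>|\<close>.  Outside, \<open>\<integral> |z Q|\<^sup>p \<le> C G\<^bsup>1 + 1/N\<^esup>\<close> by the Gagliardo-Nirenberg inequality, and \<open>young_split\<close>
  with the small tail of \<open>|Q|\<^sup>p\<close> leaves only a fraction of \<open>G\<close>, which is absorbed.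
\<close>

lemma GN_optimizer_oscillation:
  fixes v :: "real ^ 'n"
  assumes v: "norm v < 1" and Q: "GN_optimizer v Q"
  obtains K where "\<And>\<xi>. (LINT x|lborel. (norm ((cis (\<xi> \<bullet> x) - 1) * Q x))^2) \<le> K * (norm \<xi>)^2"
proof -
  define N where "N = real CARD('n)"
  define L where "L = Lnorm 2 Q"
  define C where "C = (N + 1) / (N * L powr (2 / N))"
  have N: "N > 0" by (simp add: N_def)
  have L: "L > 0" unfolding L_def by (rule GN_optimizer_mass_pos[OF Q])
  have C: "C > 0" using N L by (simp add: C_def)
  note QD = GN_optimizerD[OF Q, folded N_def, folded L_def, folded C_def]
  have Q2: "Q \<in> L2_set" using QD(1) by (rule H_half_L2)
  have [measurable]: "Q \<in> borel_measurable borel" using Q2 by measurable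
  define g where "g = fourier Q"
  have g: "is_fourier Q g" unfolding g_def by (rule is_fourier_fourier[OF Q2])
  have g2: "g \<in> L2_set" using L2_setD_is_fourier[OF g] by auto
  have [measurable]: "g \<in> borel_measurable borel" using g2 by measurable
  have gi: "integrable lborel (\<lambda>k. norm k * (norm (g k))^2)"
    using QD(1) H_half_iff[OF g] by simp
  define f where "f x = norm (Q x) powr (2 + 2 / N)" for x
  have fi: "integrable lborel f" unfolding f_def N_def by (rule GN_optimizer_power(2)[OF v Q])
  have fnn: "f x \<ge> 0" for x by (simp add: f_def)
  have [measurable]: "f \<in> borel_measurable borel" using fi by auto
  define P where "P = (LINT x|lborel. f x)"
  \<comment> \<open>Chosen so that the tail, multiplied by the constant \<open>r\<^bsup>- N\<^esup> = (8 C)\<^bsup>N\<^esup> G\<close> below, is at most \<open>G / 8\<close>.\<close>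
  define \<rho> where "\<rho> = 1 / (8 * (8 * C) powr N)"
  have \<rho>: "\<rho> > 0" using C by (simp add: \<rho>_def)
  obtain R where R: "R > 0" "(LINT x|lborel. indicator {x. norm x > R} x * f x) \<le> \<rho>"
    using small_tail[OF fi fnn \<rho>] by metis
  let ?tail = "LINT x|lborel. indicator {x. norm x > R} x * f x"
  define H where "H k = norm k - v \<bullet> k + 1" for k
  have [measurable]: "H \<in> borel_measurable borel" unfolding H_def by measurable
  have Hnn: "0 \<le> H k" "1 \<le> H k" "\<bar>H k\<bar> \<le> 3 * (norm k + 1)" for k
    using inner_le_norm_of_lt1[OF v, of k] norm_ge_zero[of k] unfolding H_def abs_le_iff by auto
  show thesis
  proof (rule that[of "4 * R\<^sup>2 * P + 8 * L\<^sup>2"])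
    fix \<xi> :: "real ^ 'n"
    define z where "z x = cis (\<xi> \<bullet> x) - 1" for x
    have [measurable]: "z \<in> borel_measurable borel" unfolding z_def by measurable
    define d where "d k = g (k - \<xi>) - g k" for k
    have F: "is_fourier (\<lambda>x. z x * Q x) d"
      using is_fourier_lincomb[OF is_fourier_modulation[OF g, of \<xi>] g, of 1 "-1"]
      by (simp add: z_def[abs_def] d_def[abs_def] left_diff_distrib)
    have d2: "d \<in> L2_set" using L2_setD_is_fourier[OF F] by auto
    have di: "integrable lborel (\<lambda>k. norm k * (norm (d k))^2)"
      using integrable_norm_weight_lincomb[OF integrable_norm_weight_translation[OF gi g2, of \<xi>] gi, of 1 "-1"]
      by (simp add: d_def)
    have zQH: "(\<lambda>x. z x * Q x) \<in> H_half" using di H_half_iff[OF F] by simp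
    define G where "G = (LINT k|lborel. H k * (norm (d k))^2)"
    have Gi: "integrable lborel (\<lambda>k. H k * (norm (d k))^2)"
      by (rule integrable_weight[OF di d2 _ Hnn(3)]) simp
    have Gnn: "G \<ge> 0" unfolding G_def using Hnn(1) by simp
    have TG: "T_form v (\<lambda>x. z x * Q x) \<le> G"
      unfolding T_form_eq[OF F] G_def
      by (intro integral_mono Gi integrable_weight[OF di d2 _ half_wave_weight(2)[OF v]] mult_right_mono)
         (auto simp: H_def)
    have Tnn: "0 \<le> T_form v (\<lambda>x. z x * Q x)"
      unfolding T_form_eq[OF F] using half_wave_weight(1)[OF v] by (intro integral_nonneg_AE AE_I2 mult_nonneg_nonneg) auto
    have mG: "(LINT x|lborel. (norm (z x * Q x))^2) \<le> G"
      unfolding plancherel_integral[OF F, symmetric] G_def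
      using mult_right_mono[OF Hnn(2)] by (intro integral_mono Gi L2_set_integrable d2) fastforce
    have LG: "Lnorm 2 (\<lambda>x. z x * Q x) \<le> sqrt G"
      using mG unfolding Lnorm_2_sq[symmetric] by (rule real_le_rsqrt)

    \<comment> \<open>The test function; as a second difference of modulations of \<open>Q\<close> it lies in \<open>H\<^sup>1\<^sup>/\<^sup>2\<close>.\<close>
    define w where "w x = complex_of_real ((norm (z x))^2) * Q x" for x
    have w_eq: "w x = 2 * Q x + (-1) * (1 * (cis (\<xi> \<bullet> x) * Q x) + 1 * (cis ((- \<xi>) \<bullet> x) * Q x))" for x
      unfolding w_def z_def cis_second_difference[symmetric] by (simp add: algebra_simps)
    define wh where "wh k = 2 * g k + (-1) * (1 * g (k - \<xi>) + 1 * g (k - (- \<xi>)))" for k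
    have Fw: "is_fourier w wh"
      unfolding w_eq[abs_def] wh_def[abs_def] by (intro is_fourier_lincomb is_fourier_modulation g)
    have "integrable lborel (\<lambda>k. norm k * (norm (wh k))^2)"
      unfolding wh_def[abs_def]
      by (intro integrable_norm_weight_lincomb integrable_norm_weight_translation gi g2) measurable
    then have wH: "w \<in> H_half" using H_half_iff[OF Fw] by simp
    define S where "S = (LINT x|lborel. (norm (z x))^2 * f x)"
    have [measurable]: "fourier w \<in> borel_measurable borel" "fourier Q \<in> borel_measurable borel"
      using L2_setD_is_fourier[OF is_fourier_fourier[OF H_half_L2[OF wH]]]
        L2_setD_is_fourier[OF is_fourier_fourier[OF Q2]] by (auto dest: L2_set_measurable)
    let ?W = "LINT k|lborel. complex_of_real (H k) * g k * cnj (2 * g k - g (k - \<xi>) - g (k + \<xi>))"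
    have "?W
        = (LINT k|lborel. complex_of_real (H k) * fourier Q k * cnj (fourier w k))"
    proof (rule integral_cong_AE)
      show "AE k in lborel. complex_of_real (H k) * g k * cnj (2 * g k - g (k - \<xi>) - g (k + \<xi>))
          = complex_of_real (H k) * fourier Q k * cnj (fourier w k)"
        using fourier_AE_eq[OF Fw]
      proof eventually_elim
        fix k assume e: "fourier w k = wh k"
        have "wh k = 2 * g k - g (k - \<xi>) - g (k + \<xi>)" by (simp add: wh_def)
        then show "complex_of_real (H k) * g k * cnj (2 * g k - g (k - \<xi>) - g (k + \<xi>))
          = complex_of_real (H k) * fourier Q k * cnj (fourier w k)"
          unfolding e g_def[symmetric] by simp
      qed
    qed measurable
    also have "\<dots> = (LINT x|lborel. complex_of_real (norm (Q x) powr (2 / N)) * Q x * cnj (w x))"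
      unfolding H_def by (rule QD(3)[OF wH])
    also have "\<dots> = (LINT x|lborel. complex_of_real ((norm (z x))^2 * f x))"
    proof (intro Bochner_Integration.integral_cong refl)
      fix x
      have "f x = norm (Q x) powr (2 / N) * (norm (Q x))^2"
        by (simp add: f_def powr_add)
      then have "complex_of_real ((norm (z x))^2 * f x)
          = complex_of_real ((norm (z x))^2) * (complex_of_real (norm (Q x) powr (2 / N)) * (Q x * cnj (Q x)))"
        by (simp only: of_real_mult complex_norm_square)
      then show "complex_of_real (norm (Q x) powr (2 / N)) * Q x * cnj (w x) = complex_of_real ((norm (z x))^2 * f x)"
        by (simp only: w_def complex_cnj_mult complex_cnj_complex_of_real mult_ac)
    qed
    also have "\<dots> = complex_of_real S"
      unfolding S_def by (rule integral_complex_of_real)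
    finally have weak: "?W = complex_of_real S" .
    have L2: "(LINT k|lborel. (norm (g k))^2) = L\<^sup>2"
      unfolding plancherel_integral[OF g] L_def Lnorm_2_sq ..
    have GS: "G \<le> 2 * S + 4 * (norm \<xi>)^2 * L\<^sup>2"
      using commutator_bound[OF v gi g2, of \<xi>, folded H_def] weak
      unfolding L2 G_def d_def by (simp add: norm_minus_commute)

    have "(LINT x|lborel. (norm (z x * Q x))^2) \<le> (4 * R\<^sup>2 * P + 8 * L\<^sup>2) * (norm \<xi>)^2"
    proof (cases "G = 0")
      case True
      have "P \<ge> 0" unfolding P_def using fnn by simp
      then have "0 \<le> (4 * R\<^sup>2 * P + 8 * L\<^sup>2) * (norm \<xi>)^2"
        by (intro mult_nonneg_nonneg add_nonneg_nonneg) auto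
      then show ?thesis using mG True by linarith
    next
      case False
      then have G: "G > 0" using Gnn by simp
      \<comment> \<open>This \<open>r\<close> turns the bound \<open>C G\<^bsup>1 + 1/N\<^esup>\<close> of \<open>\<integral> |z Q|\<^sup>p\<close> into \<open>G / 8\<close>.\<close>
      define r where "r = 1 / (8 * C) * G powr (- 1 / N)"
      have r: "r > 0" using C G by (simp add: r_def)
      define y where "y x = norm (z x) powr (2 + 2 / N) * f x" for x
      have zi: "integrable lborel (\<lambda>x. h (z x) * f x)" if [measurable]: "h \<in> borel_measurable borel" and "\<And>c. norm c \<le> 2 \<Longrightarrow> \<bar>h c\<bar> \<le> B" for h :: "complex \<Rightarrow> real" and B
      proof (rule Bochner_Integration.integrable_bound)
        show "integrable lborel (\<lambda>x. B * f x)" by (rule integrable_mult_right[OF fi])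
        have "\<bar>h (z x)\<bar> * f x \<le> B * f x" for x
          using that(2)[of "z x"] norm_cis_minus_1_le(2) fnn by (intro mult_right_mono) (auto simp: z_def)
        then show "AE x in lborel. norm (h (z x) * f x) \<le> norm (B * f x)"
          using fnn mult_right_mono[OF abs_ge_self[of B] fnn]
          by (intro AE_I2) (auto simp: abs_mult intro: order_trans)
      qed measurable
      have yi: "integrable lborel y"
        unfolding y_def using N
        by (intro zi[where B = "2 powr (2 + 2 / N)"]) (auto intro!: powr_mono2 add_nonneg_nonneg)
      have Si: "integrable lborel (\<lambda>x. (norm (z x))^2 * f x)"
        using power_mono[of "norm _" 2 2] by (intro zi[where B = "2\<^sup>2"]) auto
      have ti: "integrable lborel (\<lambda>x. indicator {x. norm x > R} x * f x)"
        by (rule Bochner_Integration.integrable_bound[OF fi]) (auto simp: indicator_def)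
      have "(LINT x|lborel. y x) = (LINT x|lborel. norm (z x * Q x) powr (2 + 2 / N))"
        by (simp add: y_def f_def norm_mult powr_mult)
      also have "\<dots> \<le> C * T_form v (\<lambda>x. z x * Q x) * Lnorm 2 (\<lambda>x. z x * Q x) powr (2 / N)"
        by (rule QD(4)[OF zQH])
      also have "\<dots> \<le> C * G * sqrt G powr (2 / N)"
        using C Tnn TG LG Gnn N Lnorm_nonneg by (intro mult_mono powr_mono2) auto
      also have "sqrt G powr (2 / N) = G powr (1 / N)"
        using G by (simp add: powr_half_sqrt[symmetric] powr_powr)
      finally have Z: "(LINT x|lborel. y x) \<le> C * G * G powr (1 / N)" .
      have "r * (LINT x|lborel. y x) \<le> r * (C * G * G powr (1 / N))"
        using r Z by (intro mult_left_mono) auto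
      also have "\<dots> = G / 8 * (G powr (- 1 / N) * G powr (1 / N))"
        using C by (simp add: r_def)
      also have "G powr (- 1 / N) * G powr (1 / N) = 1"
        using G by (simp flip: powr_add)
      finally have rZ: "r * (LINT x|lborel. y x) \<le> G / 8" by simp
      have "r powr (- N) = (8 * C) powr N * (G powr (- 1 / N)) powr (- N)"
        using C G by (simp add: r_def powr_mult powr_divide powr_minus_divide)
      also have "(G powr (- 1 / N)) powr (- N) = G"
        using G N by (simp add: powr_powr)
      finally have rN: "r powr (- N) = (8 * C) powr N * G" .
      have "r powr (- N) * ?tail \<le> r powr (- N) * \<rho>"
        by (intro mult_left_mono R) auto
      also have "\<dots> = G / 8"
        unfolding rN \<rho>_def using C by simp
      finally have tail: "r powr (- N) * ?tail \<le> G / 8" .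
      have "S \<le> (LINT x|lborel. (norm \<xi>)^2 * R\<^sup>2 * f x + (r powr (- N) * (indicator {x. norm x > R} x * f x) + r * y x))"
        unfolding S_def
      proof (intro integral_mono Si Bochner_Integration.integrable_add integrable_mult_right fi ti yi)
        fix x
        show "(norm (z x))^2 * f x \<le> (norm \<xi>)^2 * R\<^sup>2 * f x + (r powr (- N) * (indicator {x. norm x > R} x * f x) + r * y x)"
        proof (cases "norm x > R")
          case True
          have "(norm (z x))^2 * f x \<le> (r powr (- N) + r * norm (z x) powr (2 + 2 / N)) * f x"
            by (intro mult_right_mono young_split N r fnn) simp
          moreover have "0 \<le> (norm \<xi>)^2 * R\<^sup>2 * f x" using fnn by simp
          ultimately show ?thesis using True by (simp add: y_def algebra_simps)
        next
          case False
          have "norm (z x) \<le> \<bar>\<xi> \<bullet> x\<bar>" unfolding z_def by (rule norm_cis_minus_1_le)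
          also have "\<dots> \<le> norm \<xi> * norm x" by (rule Cauchy_Schwarz_ineq2)
          also have "\<dots> \<le> norm \<xi> * R" using False by (intro mult_left_mono) auto
          finally have "(norm (z x))^2 \<le> (norm \<xi> * R)^2" by (rule power_mono) simp
          then have "(norm (z x))^2 * f x \<le> (norm \<xi>)^2 * R\<^sup>2 * f x"
            using fnn by (intro mult_right_mono) (auto simp: power_mult_distrib)
          moreover have "0 \<le> r * y x" using r fnn by (simp add: y_def)
          ultimately show ?thesis using False by simp
        qed
      qed
      also have "\<dots> = (norm \<xi>)^2 * R\<^sup>2 * P + (r powr (- N) * ?tail + r * (LINT x|lborel. y x))"
        using fi ti yi by (simp add: P_def)
      finally have "S \<le> (norm \<xi>)^2 * R\<^sup>2 * P + G / 4"
        using tail rZ by linarith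
      then have "G \<le> (4 * R\<^sup>2 * P + 8 * L\<^sup>2) * (norm \<xi>)^2"
        using GS by (simp add: algebra_simps)
      then show ?thesis using mG by linarith
    qed
    then show "(LINT x|lborel. (norm ((cis (\<xi> \<bullet> x) - 1) * Q x))^2) \<le> (4 * R\<^sup>2 * P + 8 * L\<^sup>2) * (norm \<xi>)^2"
      by (simp add: z_def)
  qed
qed

lemma scaled_cis_difference_limit: "(\<lambda>n. (real n)^2 * (norm (cis (t / real n) - 1))^2) \<longlonglongrightarrow> t\<^sup>2"
proof -
  have e: "(norm (cis s - 1))^2 = 2 - 2 * cos s" for s
    using cis_second_difference[of s, THEN arg_cong[of _ _ Re]] by simp
  show ?thesis unfolding e power2_eq_square[of t] by real_asymp
qed

text \<open>
  Fatou's lemma along \<open>\<xi> = e\<^sub>i / n\<close> turns the oscillation bound into a finite second moment.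
\<close>

lemma GN_optimizer_W_half:
  fixes v :: "real ^ 'n"
  assumes v: "norm v < 1" and Q: "GN_optimizer v Q"
  shows "Q \<in> W_half"
proof -
  have QH: "Q \<in> H_half" using GN_optimizerD[OF Q] by auto
  have Q2: "Q \<in> L2_set" using QH by (rule H_half_L2)
  have [measurable]: "Q \<in> borel_measurable borel" using Q2 by measurable
  obtain K where K: "\<And>\<xi>. (LINT x|lborel. (norm ((cis (\<xi> \<bullet> x) - 1) * Q x))^2) \<le> K * (norm \<xi>)^2"
    by (rule GN_optimizer_oscillation[OF v Q], rule that)
  have comp: "integrable lborel (\<lambda>x. (x $ i)^2 * (norm (Q x))^2)" for i
  proof (rule integrableI_bounded)
    define \<xi> where "\<xi> n = (1 / real n) *\<^sub>R (axis i 1 :: real ^ 'n)" for n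
    have in\<xi>: "\<xi> n \<bullet> x = x $ i / real n" for n x
      by (simp add: \<xi>_def inner_axis' )
    let ?J = "\<lambda>n x. (real n)^2 * (norm (cis (\<xi> n \<bullet> x) - 1))^2 * (norm (Q x))^2"
    have "(\<integral>\<^sup>+x. ennreal (norm ((x $ i)^2 * (norm (Q x))^2)) \<partial>lborel)
      = (\<integral>\<^sup>+x. liminf (\<lambda>n. ennreal (?J n x)) \<partial>lborel)"
    proof (intro nn_integral_cong)
      fix x :: "real ^ 'n"
      have "(\<lambda>n. ?J n x) \<longlonglongrightarrow> (x $ i)\<^sup>2 * (norm (Q x))^2"
        unfolding in\<xi> by (intro tendsto_mult scaled_cis_difference_limit tendsto_const)
      then have "(\<lambda>n. ennreal (?J n x)) \<longlonglongrightarrow> ennreal ((x $ i)^2 * (norm (Q x))^2)"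
        by (rule tendsto_ennrealI)
      from lim_imp_Liminf[OF sequentially_bot this]
      show "ennreal (norm ((x $ i)^2 * (norm (Q x))^2)) = liminf (\<lambda>n. ennreal (?J n x))"
        by simp
    qed
    also have "\<dots> \<le> liminf (\<lambda>n. \<integral>\<^sup>+x. ennreal (?J n x) \<partial>lborel)"
      by (rule nn_integral_liminf) measurable
    also have "\<dots> \<le> ennreal \<bar>K\<bar>"
    proof (rule Liminf_le)
      have "(\<integral>\<^sup>+x. ennreal (?J n x) \<partial>lborel) \<le> ennreal \<bar>K\<bar>" for n
      proof -
        have L2: "(\<lambda>x. (cis (\<xi> n \<bullet> x) - 1) * Q x) \<in> L2_set"
          by (rule L2_set_bound[OF L2_set_cmult[OF Q2, of 2]])
             (use norm_cis_minus_1_le(2) in \<open>auto simp: norm_mult intro!: mult_right_mono\<close>)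
        have "(\<integral>\<^sup>+x. ennreal (?J n x) \<partial>lborel)
            = (\<integral>\<^sup>+x. ennreal ((real n)^2) * ennreal ((norm ((cis (\<xi> n \<bullet> x) - 1) * Q x))^2) \<partial>lborel)"
          by (simp add: norm_mult power_mult_distrib ennreal_mult mult.assoc)
        also have "\<dots> = ennreal ((real n)^2) * L2sq (\<lambda>x. (cis (\<xi> n \<bullet> x) - 1) * Q x)"
          unfolding L2sq_def by (rule nn_integral_cmult) measurable
        also have "\<dots> = ennreal ((real n)^2 * (LINT x|lborel. (norm ((cis (\<xi> n \<bullet> x) - 1) * Q x))^2))"
          unfolding L2sq_eq_integral[OF L2] by (simp add: ennreal_mult)
        also have "\<dots> \<le> ennreal \<bar>K\<bar>"
        proof (rule ennreal_leI)
          have "(real n)^2 * (LINT x|lborel. (norm ((cis (\<xi> n \<bullet> x) - 1) * Q x))^2) \<le> (real n)^2 * (K * (norm (\<xi> n))^2)"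
            by (intro mult_left_mono K) auto
          also have "\<dots> \<le> \<bar>K\<bar>"
            by (cases "n = 0") (auto simp: \<xi>_def power_divide)
          finally show "(real n)^2 * (LINT x|lborel. (norm ((cis (\<xi> n \<bullet> x) - 1) * Q x))^2) \<le> \<bar>K\<bar>" .
        qed
        finally show ?thesis .
      qed
      then show "eventually (\<lambda>n. (\<integral>\<^sup>+x. ennreal (?J n x) \<partial>lborel) \<le> ennreal \<bar>K\<bar>) sequentially"
        by (rule always_eventually[OF allI])
    qed simp
    finally show "(\<integral>\<^sup>+x. ennreal (norm ((x $ i)^2 * (norm (Q x))^2)) \<partial>lborel) < \<infinity>"
      by (rule order.strict_trans1) simp
  qed measurable
  have "(norm x)^2 * (norm (Q x))^2 = (\<Sum>i\<in>UNIV. (x $ i)^2 * (norm (Q x))^2)" for x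
    unfolding power2_norm_eq_inner[of x] inner_vec_def sum_distrib_right by (simp add: power2_eq_square)
  then have "integrable lborel (\<lambda>x. (norm x)^2 * (norm (Q x))^2)"
    using comp by simp
  then show ?thesis
    by (intro W_half_of_moments QH GN_optimizer_power(2)[OF v Q])
qed

section \<open>The critical case with large mass\<close>

text \<open>
  The equality case reads \<open>\<parallel>Q\<parallel>\<^sub>p\<^sup>p / p = T\<^sub>v(Q) / 2\<close>, so for \<open>s Q\<close> with \<open>s \<ge> 1\<close> the power term
  \<open>s\<^sup>p T\<^sub>v(Q) / 2\<close> is at least the kinetic term \<open>s\<^sup>2 T\<^sub>v(Q) / 2\<close>; both scale linearly.
\<close>

lemma min_energy_critical:
  fixes v :: "real ^ 'n"
  assumes v: "norm v < 1" and Q: "GN_optimizer v Q" and p: "p = 2 + 2 / real CARD('n)"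
    and a: "a \<ge> (Lnorm 2 Q)\<^sup>2" and m: "m > 0"
  shows "min_energy v m p a = - \<infinity>"
proof -
  define N where "N = real CARD('n)"
  have N: "N > 0" by (simp add: N_def)
  have pN: "p = 2 + 2 / N" by (simp add: p N_def)
  have p0: "p > 2" using N by (simp add: pN)
  define L where "L = Lnorm 2 Q"
  have L: "L > 0" unfolding L_def by (rule GN_optimizer_mass_pos[OF Q])
  have a0: "a > 0" using a L unfolding L_def[symmetric] by (smt (verit) zero_less_power)
  define s where "s = sqrt a / L"
  have s: "s \<ge> 1" using a L a0 by (simp add: s_def L_def[symmetric] real_le_rsqrt)
  define u where "u x = complex_of_real s * Q x" for x
  have QW: "Q \<in> W_half" by (rule GN_optimizer_W_half[OF v Q])
  have QH: "Q \<in> H_half" using QW by (simp add: W_half_def)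
  have Q2: "Q \<in> L2_set" using QH by (rule H_half_L2)
  define g where "g = fourier Q"
  have g: "is_fourier Q g" unfolding g_def by (rule is_fourier_fourier[OF Q2])
  have F: "is_fourier u (\<lambda>k. complex_of_real s * g k)"
    using is_fourier_lincomb[OF g g, of "complex_of_real s" 0] by (simp add: u_def[abs_def])
  have T: "T_form v u = s\<^sup>2 * T_form v Q"
    unfolding T_form_eq[OF F] T_form_eq[OF g]
    by (subst integral_mult_right_zero[symmetric]) (simp add: norm_mult power_mult_distrib mult_ac)
  have "integrable lborel (\<lambda>k. s\<^sup>2 * (norm k * (norm (g k))^2))"
    using QH H_half_iff[OF g] by simp
  then have uH: "u \<in> H_half"
    unfolding H_half_iff[OF F] by (simp add: norm_mult power_mult_distrib mult_ac)
  have ent: "(norm (u x))^2 * ln ((norm (u x))^2)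
      = s\<^sup>2 * ((norm (Q x))^2 * ln ((norm (Q x))^2) + ln (s\<^sup>2) * (norm (Q x))^2)" for x
    using s by (cases "Q x = 0") (auto simp: u_def norm_mult power_mult_distrib ln_mult algebra_simps)
  have "integrable lborel (\<lambda>x. s\<^sup>2 * ((norm (Q x))^2 * ln ((norm (Q x))^2) + ln (s\<^sup>2) * (norm (Q x))^2))"
    using QW L2_set_integrable[OF Q2]
    by (intro integrable_mult_right Bochner_Integration.integrable_add) (auto simp: W_half_def)
  then have uW: "u \<in> W_half"
    using uH unfolding W_half_def ent[symmetric] by simp
  have mass: "(Lnorm 2 u)^2 = a"
  proof -
    have "(Lnorm 2 u)^2 = s\<^sup>2 * L\<^sup>2"
      unfolding L_def Lnorm_2_sq by (simp add: u_def norm_mult power_mult_distrib)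
    then show ?thesis using L a0 by (simp add: s_def power_divide)
  qed
  have up: "norm (u x) powr p = s powr p * norm (Q x) powr p" for x
    using s by (simp add: u_def norm_mult powr_mult)
  have ui: "integrable lborel (\<lambda>x. norm (u x) powr p)"
    unfolding up using GN_optimizer_power(2)[OF v Q] by (intro integrable_mult_right) (simp add: p)
  have "(LINT x|lborel. norm (u x) powr p) = s powr p * ((N + 1) / N * T_form v Q)"
    unfolding up using GN_optimizer_power(1)[OF v Q] by (simp add: p N_def)
  also have "\<dots> = p * (s powr p * (T_form v Q / 2))"
    using N by (simp add: pN field_simps)
  finally have U: "(LINT x|lborel. norm (u x) powr p) / p = s powr p * (T_form v Q / 2)"
    using p0 by simp
  have "T_form v Q > 0"
    using GN_optimizerD(1,2)[OF Q] v by (intro T_form_pos)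
  moreover have "s\<^sup>2 \<le> s powr p"
    using s p0 powr_mono[of 2 p s] by simp
  ultimately have TU: "T_form v u / 2 \<le> (LINT x|lborel. norm (u x) powr p) / p"
    unfolding U T by simp
  have q: "real CARD('n) * p / 2 - real CARD('n) = 1"
    unfolding N_def[symmetric] pN using N by (simp add: field_simps)
  have "eventually (\<lambda>c. c * (T_form v u / 2) \<le> c powr 1 * ((LINT x|lborel. norm (u x) powr p) / p)) at_top"
    using eventually_gt_at_top[of 0]
  proof eventually_elim
    fix c :: real assume "0 < c"
    then show "c * (T_form v u / 2) \<le> c powr 1 * ((LINT x|lborel. norm (u x) powr p) / p)"
      using mult_left_mono[OF TU, of c] by simp
  qed
  then show ?thesis
    using p0 by (intro min_energy_eq_minus_infinity[OF v m uW _ ui mass a0]) (auto simp only: q)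
qed

section \<open>Boosted test functions\<close>

lemma Cc_infinityD:
  fixes u :: "real ^ 'n \<Rightarrow> real"
  assumes u: "u \<in> Cc_infinity"
  shows "continuous_on UNIV u" "u differentiable_on UNIV" "continuous_on UNIV (partial_deriv i u)"
    "\<exists>r>0. \<forall>x. norm x > r \<longrightarrow> u x = 0"
proof -
  have c: "\<And>j. C_k j u" and s: "compact (closure {x. u x \<noteq> 0})"
    using u by (auto simp: Cc_infinity_def)
  show "continuous_on UNIV u" using c[of 0] by simp
  show "u differentiable_on UNIV" "continuous_on UNIV (partial_deriv i u)" using c[of 1] by simp_all
  obtain r where r: "r > 0" "\<And>x. x \<in> closure {x. u x \<noteq> 0} \<Longrightarrow> norm x \<le> r"
    using compact_imp_bounded[OF s] unfolding bounded_pos by auto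
  have "u x = 0" if "norm x > r" for x
    using r(2)[of x] that closure_subset[of "{x. u x \<noteq> 0}"] by force
  then show "\<exists>r>0. \<forall>x. norm x > r \<longrightarrow> u x = 0" using r by auto
qed

lemma integrable_bounded_support:
  fixes f :: "real ^ 'n \<Rightarrow> real"
  assumes "f \<in> borel_measurable borel" "\<And>x. \<bar>f x\<bar> \<le> B" "\<And>x. norm x > r \<Longrightarrow> f x = 0"
  shows "integrable lborel f"
proof (rule Bochner_Integration.integrable_bound[OF integrable_indicator_cball[of B r]])
  show "AE x in lborel. norm (f x) \<le> norm (B * indicator (cball 0 r) x)"
    using assms(2,3) by (intro AE_I2) (auto simp: indicator_def not_le intro: order_trans[OF _ abs_ge_self])
qed (use assms in auto)

lemma Cc_infinity_integrable:
  fixes u :: "real ^ 'n \<Rightarrow> real"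
  assumes u: "u \<in> Cc_infinity" and q: "q > 0"
  shows "integrable lborel (\<lambda>x. \<bar>u x\<bar> powr q)"
proof -
  obtain r where r: "r > 0" "\<And>x. norm x > r \<Longrightarrow> u x = 0" using Cc_infinityD(4)[OF u] by auto
  have [measurable]: "u \<in> borel_measurable borel"
    by (rule borel_measurable_continuous_onI[OF Cc_infinityD(1)[OF u]])
  have "compact (u ` cball 0 r)"
    by (intro compact_continuous_image continuous_on_subset[OF Cc_infinityD(1)[OF u]]) auto
  then obtain B where B: "B > 0" "\<And>x. x \<in> cball 0 r \<Longrightarrow> \<bar>u x\<bar> \<le> B"
    using compact_imp_bounded[of "u ` cball 0 r"] unfolding bounded_pos by auto
  have B': "\<bar>u x\<bar> \<le> B" for x using B r(2)[of x] by (cases "norm x \<le> r") auto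
  show ?thesis
    by (rule integrable_bounded_support[where B = "B powr q" and r = r])
       (use B' r q in \<open>auto intro!: powr_mono2\<close>)
qed

lemma partial_deriv_line:
  fixes u :: "real ^ 'n \<Rightarrow> real"
  assumes "u differentiable_on UNIV"
  shows "((\<lambda>t. u (x + t *\<^sub>R axis i 1)) has_real_derivative partial_deriv i u (x + t *\<^sub>R axis i 1)) (at t)"
proof -
  let ?y = "x + t *\<^sub>R axis i 1"
  have d: "(u has_derivative frechet_derivative u (at ?y)) (at ?y)"
    using assms by (simp add: differentiable_on_def frechet_derivative_works)
  have "((\<lambda>t. x + t *\<^sub>R axis i 1) has_derivative (\<lambda>s. s *\<^sub>R axis i 1)) (at t)"
    by (auto intro!: derivative_eq_intros)
  from has_derivative_compose[OF this d]
  have "((\<lambda>t. u (x + t *\<^sub>R axis i 1)) has_derivative (\<lambda>s. frechet_derivative u (at ?y) (s *\<^sub>R axis i 1))) (at t)" .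
  also have "(\<lambda>s. frechet_derivative u (at ?y) (s *\<^sub>R axis i 1)) = (*) (partial_deriv i u ?y)"
    using linear_scale[OF has_derivative_linear[OF d]] by (auto simp: partial_deriv_def mult.commute)
  finally show ?thesis
    by (simp add: has_field_derivative_def)
qed

text \<open>
  Difference quotients take the place of integration by parts: their transforms carry the
  factors \<open>n (e\<^bsup>i k\<^sub>i / n\<^esup> - 1)\<close>, so Plancherel's theorem and Fatou's lemma give the inequality, the only
  direction required for an upper bound of the energy.
\<close>

lemma fourier_gradient_component:
  fixes u :: "real ^ 'n \<Rightarrow> real"
  assumes u: "u \<in> Cc_infinity"
  defines "U \<equiv> \<lambda>x. complex_of_real (u x)"
  shows "integrable lborel (\<lambda>x. (partial_deriv i u x)^2)"
    and "integrable lborel (\<lambda>k. (k $ i)^2 * (norm (fourier_integral U k))^2)"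
    and "(LINT k|lborel. (k $ i)^2 * (norm (fourier_integral U k))^2) \<le> (LINT x|lborel. (partial_deriv i u x)^2)"
proof -
  let ?I = "\<lambda>k. (k $ i)^2 * (norm (fourier_integral U k))^2"
  obtain r where r: "r > 0" "\<And>x. norm x > r \<Longrightarrow> u x = 0" using Cc_infinityD(4)[OF u] by auto
  have um [measurable]: "u \<in> borel_measurable borel"
    by (rule borel_measurable_continuous_onI[OF Cc_infinityD(1)[OF u]])
  have [measurable]: "partial_deriv i u \<in> borel_measurable borel"
    by (rule borel_measurable_continuous_onI[OF Cc_infinityD(3)[OF u]])
  have "compact (partial_deriv i u ` cball 0 (r + 2))"
    by (intro compact_continuous_image continuous_on_subset[OF Cc_infinityD(3)[OF u]]) auto
  then obtain B where B: "B > 0" "\<And>x. x \<in> cball 0 (r + 2) \<Longrightarrow> \<bar>partial_deriv i u x\<bar> \<le> B"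
    using compact_imp_bounded[of "partial_deriv i u ` cball 0 (r + 2)"] unfolding bounded_pos by auto
  define e where "e = (axis i 1 :: real ^ 'n)"
  have ne: "norm e = 1" by (simp add: e_def)
  define h where "h n = 1 / real (Suc n)" for n
  have h: "0 < h n" "h n \<le> 1" for n by (auto simp: h_def)
  have h0: "h \<longlonglongrightarrow> 0" unfolding h_def by (rule LIMSEQ_Suc[OF lim_1_over_n])
  define q where "q n x = real (Suc n) * (u (x + h n *\<^sub>R e) - u x)" for n x
  have [measurable]: "q n \<in> borel_measurable borel" for n unfolding q_def by measurable
  have q0: "q n x = 0" if "norm x > r + 1" for n x
  proof -
    have "norm x \<le> norm (x + h n *\<^sub>R e) + norm (h n *\<^sub>R e)"
      using norm_triangle_ineq4[of "x + h n *\<^sub>R e" "h n *\<^sub>R e"] by simp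
    then have "norm (x + h n *\<^sub>R e) > r" using that h[of n] by (simp add: ne)
    then show ?thesis using that r(2)[of x] r(2)[of "x + h n *\<^sub>R e"] by (simp add: q_def)
  qed
  have qB: "\<bar>q n x\<bar> \<le> B" for n x
  proof (cases "norm x > r + 1")
    case False
    have "\<exists>z. 0 < z \<and> z < h n \<and> u (x + h n *\<^sub>R e) - u (x + 0 *\<^sub>R e) = (h n - 0) * partial_deriv i u (x + z *\<^sub>R e)"
      unfolding e_def using h[of n] by (intro MVT2 partial_deriv_line Cc_infinityD(2)[OF u]) auto
    then obtain z where z: "0 < z" "z < h n" "u (x + h n *\<^sub>R e) - u x = h n * partial_deriv i u (x + z *\<^sub>R e)"
      by auto
    have "norm (x + z *\<^sub>R e) \<le> norm x + norm (z *\<^sub>R e)" by (rule norm_triangle_ineq)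
    then have "norm (x + z *\<^sub>R e) \<le> r + 2" using False z h[of n] by (simp add: ne)
    then have "\<bar>partial_deriv i u (x + z *\<^sub>R e)\<bar> \<le> B" using B by simp
    moreover have "q n x = partial_deriv i u (x + z *\<^sub>R e)"
      unfolding q_def z(3) by (simp add: h_def)
    ultimately show ?thesis by simp
  qed (use q0 B in simp)
  have qlim: "(\<lambda>n. q n x) \<longlonglongrightarrow> partial_deriv i u x" for x
  proof -
    have "((\<lambda>t. (u (x + t *\<^sub>R e) - u x) / t) \<longlongrightarrow> partial_deriv i u x) (at 0)"
      using partial_deriv_line[OF Cc_infinityD(2)[OF u], of x i 0] by (simp add: has_field_derivative_iff e_def)
    moreover have "filterlim h (at 0) sequentially"
      unfolding filterlim_at using h0 h by (auto simp: less_imp_neq[THEN not_sym])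
    ultimately have "(\<lambda>n. (u (x + h n *\<^sub>R e) - u x) / h n) \<longlonglongrightarrow> partial_deriv i u x"
      by (rule filterlim_compose)
    then show ?thesis by (simp add: q_def h_def mult.commute)
  qed
  have dom: "norm ((q n x)^2) \<le> B\<^sup>2 * indicator (cball 0 (r + 1)) x" for n x
    using power_mono[OF qB, of n x 2] q0[of x n] by (cases "norm x > r + 1") (auto simp: indicator_def)
  have lim2: "AE x in lborel. (\<lambda>n. (q n x)^2) \<longlonglongrightarrow> (partial_deriv i u x)\<^sup>2"
    by (intro AE_I2 tendsto_power qlim)
  note dc = integrable_dominated_convergence[OF _ _ integrable_indicator_cball lim2 AE_I2[OF dom]]
    integral_dominated_convergence[OF _ _ integrable_indicator_cball lim2 AE_I2[OF dom]]
    integrable_dominated_convergence2[OF _ _ integrable_indicator_cball lim2 AE_I2[OF dom]]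
  show "integrable lborel (\<lambda>x. (partial_deriv i u x)^2)" by (rule dc(1)) auto
  have Ilim: "(\<lambda>n. LINT x|lborel. (q n x)^2) \<longlonglongrightarrow> (LINT x|lborel. (partial_deriv i u x)^2)"
    by (rule dc(2)) auto
  have q2: "integrable lborel (\<lambda>x. (q n x)^2)" for n by (rule dc(3)) auto
  have U1: "integrable lborel U"
    using Cc_infinity_integrable[OF u, of 1] integrable_abs_cancel[of lborel u] um by (simp add: U_def)
  let ?Fq = "\<lambda>n. fourier_integral (\<lambda>x. complex_of_real (q n x))"
  have F: "?Fq n k
    = complex_of_real (real (Suc n)) * (cis ((k $ i) / real (Suc n)) - 1) * fourier_integral U k" for n k
  proof -
    have "?Fq n k
      = fourier_integral (\<lambda>x. complex_of_real (real (Suc n)) * U (h n *\<^sub>R e + 1 *\<^sub>R x) + (- complex_of_real (real (Suc n))) * U x) k"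
      by (simp add: q_def[abs_def] U_def algebra_simps)
    also have "\<dots> = complex_of_real (real (Suc n)) * fourier_integral (\<lambda>x. U (h n *\<^sub>R e + 1 *\<^sub>R x)) k + (- complex_of_real (real (Suc n))) * fourier_integral U k"
      by (rule fourier_integral_lincomb[OF integrable_affine[OF U1] U1]) simp
    also have "fourier_integral (\<lambda>x. U (h n *\<^sub>R e + 1 *\<^sub>R x)) k = cis ((k $ i) / real (Suc n)) * fourier_integral U k"
      by (subst fourier_integral_affine[OF U1]) (simp_all add: e_def h_def inner_axis)
    finally show ?thesis by (simp add: algebra_simps)
  qed
  have q1: "integrable lborel (\<lambda>x. complex_of_real (q n x))" for n
    using integrable_bounded_support[of "q n" B "r + 1"] qB q0 by simp
  have qL2: "(\<lambda>x. complex_of_real (q n x)) \<in> Defs.L2_set" for n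
    using q2 by (simp add: Defs.L2_set_def)
  have pl: "L2sq (?Fq n) = ennreal (LINT x|lborel. (q n x)^2)" for n
    using L2_set_fourier_integral_and_norm(2)[OF q1 qL2] L2sq_eq_integral[OF qL2] by simp
  have [measurable]: "fourier_integral U \<in> borel_measurable borel"
    unfolding U_def by measurable
  have "(\<integral>\<^sup>+k. ennreal (?I k) \<partial>lborel)
      = (\<integral>\<^sup>+k. liminf (\<lambda>n. ennreal ((norm (?Fq n k))^2)) \<partial>lborel)"
  proof (intro nn_integral_cong)
    fix k :: "real ^ 'n"
    have "(\<lambda>n. (real (Suc n))^2 * (norm (cis ((k $ i) / real (Suc n)) - 1))^2 * (norm (fourier_integral U k))^2)
      \<longlonglongrightarrow> ?I k"
      by (intro tendsto_mult LIMSEQ_Suc[OF scaled_cis_difference_limit] tendsto_const)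
    then have "(\<lambda>n. (norm (?Fq n k))^2) \<longlonglongrightarrow> ?I k"
      unfolding F by (simp only: norm_mult norm_of_real power_mult_distrib power2_abs)
    from lim_imp_Liminf[OF sequentially_bot tendsto_ennrealI[OF this]]
    show "ennreal (?I k)
        = liminf (\<lambda>n. ennreal ((norm (?Fq n k))^2))"
      by simp
  qed
  also have "\<dots> \<le> liminf (\<lambda>n. L2sq (?Fq n))"
    unfolding L2sq_def by (rule nn_integral_liminf) measurable
  also have "\<dots> = ennreal (LINT x|lborel. (partial_deriv i u x)^2)"
    unfolding pl by (rule lim_imp_Liminf[OF sequentially_bot tendsto_ennrealI[OF Ilim]])
  finally have le: "(\<integral>\<^sup>+k. ennreal (?I k) \<partial>lborel) \<le> ennreal (LINT x|lborel. (partial_deriv i u x)^2)" .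
  show int: "integrable lborel (\<lambda>k. ?I k)"
  proof (rule integrableI_bounded)
    show "(\<integral>\<^sup>+k. ennreal (norm (?I k)) \<partial>lborel) < \<infinity>"
      using le by (simp add: order.strict_trans1)
  qed measurable
  have "ennreal (LINT k|lborel. ?I k) \<le> ennreal (LINT x|lborel. (partial_deriv i u x)^2)"
    using le by (subst nn_integral_eq_integral[OF int, symmetric]) auto
  then show "(LINT k|lborel. ?I k) \<le> (LINT x|lborel. (partial_deriv i u x)^2)"
    by (subst (asm) ennreal_le_iff) auto
qed

lemma fourier_gradient:
  fixes u :: "real ^ 'n \<Rightarrow> real"
  assumes u: "u \<in> Cc_infinity"
  defines "U \<equiv> \<lambda>x. complex_of_real (u x)"
  shows "integrable lborel (\<lambda>k. (norm k)^2 * (norm (fourier_integral U k))^2)"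
    and "(LINT k|lborel. (norm k)^2 * (norm (fourier_integral U k))^2) \<le> grad_norm_sq u"
proof -
  note c = fourier_gradient_component[OF u, folded U_def]
  have e: "(norm k)^2 * (norm (fourier_integral U k))^2 = (\<Sum>i\<in>UNIV. (k $ i)^2 * (norm (fourier_integral U k))^2)" for k
    unfolding power2_norm_eq_inner[of k] inner_vec_def sum_distrib_right by (simp add: power2_eq_square)
  show "integrable lborel (\<lambda>k. (norm k)^2 * (norm (fourier_integral U k))^2)"
    unfolding e by (intro Bochner_Integration.integrable_sum c)
  show "(LINT k|lborel. (norm k)^2 * (norm (fourier_integral U k))^2) \<le> grad_norm_sq u"
    unfolding e grad_norm_sq_def
    by (subst (1 2) Bochner_Integration.integral_sum) (auto intro!: c sum_mono)
qed

text \<open>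
  The boost \<open>(m / \<beta>) v\<close> is the point where the gradient \<open>k / \<surd>(|k|\<^sup>2 + m\<^sup>2)\<close> of the relativistic symbol
  equals \<open>v\<close>, so the linear terms in \<open>k\<close> cancel.
\<close>

lemma boosted_symbol_le:
  fixes v k :: "'a::euclidean_space"
  assumes v: "norm v < 1" and m: "m > 0"
  defines "\<beta> \<equiv> sqrt (1 - (norm v)^2)"
  shows "sqrt ((norm (k + (m / \<beta>) *\<^sub>R v))^2 + m\<^sup>2) - m - v \<bullet> (k + (m / \<beta>) *\<^sub>R v)
    \<le> m * (\<beta> - 1) + \<beta> / (2 * m) * (norm k)^2"
proof -
  have v1: "(norm v)^2 < 1" using v by (simp add: abs_square_less_1)
  have b: "\<beta> > 0" "\<beta>\<^sup>2 = 1 - (norm v)^2" using v1 by (auto simp: \<beta>_def)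
  define E where "E = m / \<beta>"
  have E: "E > 0" using m b by (simp add: E_def)
  \<comment> \<open>\<open>E\<close> is the relativistic energy \<open>\<surd>(|k\<^sub>0|\<^sup>2 + m\<^sup>2)\<close> of the boost \<open>k\<^sub>0 = E v\<close>.\<close>
  define y where "y = (norm k)^2 + 2 * E * (v \<bullet> k)"
  have sq: "(norm (k + E *\<^sub>R v))^2 + m\<^sup>2 = E\<^sup>2 + y"
  proof -
    have "(norm (k + E *\<^sub>R v))^2 = (norm k)^2 + 2 * E * (v \<bullet> k) + E\<^sup>2 * (norm v)^2"
      unfolding power2_norm_eq_inner
      by (simp add: inner_add_left inner_add_right inner_commute power2_eq_square[of E] algebra_simps)
    moreover have "E\<^sup>2 * (norm v)^2 + m\<^sup>2 = E\<^sup>2"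
    proof -
      have "m = E * \<beta>" using b by (simp add: E_def)
      then have "m\<^sup>2 = E\<^sup>2 * (1 - (norm v)^2)" by (simp add: power_mult_distrib b(2))
      then show ?thesis by (simp add: algebra_simps)
    qed
    ultimately show ?thesis by (simp add: y_def)
  qed
  have nn: "0 \<le> E\<^sup>2 + y" unfolding sq[symmetric] by simp
  have "sqrt (E\<^sup>2 + y) \<le> E + y / (2 * E)"
  proof (rule real_le_lsqrt)
    have "0 \<le> (E\<^sup>2 + y + E\<^sup>2) / (2 * E)" using nn E zero_le_power2[of E] by (intro divide_nonneg_nonneg) linarith+
    also have "\<dots> = E + y / (2 * E)" using E by (simp add: field_simps power2_eq_square)
    finally show "0 \<le> E + y / (2 * E)" .
    have "(E + y / (2 * E))^2 = E\<^sup>2 + y + (y / (2 * E))^2"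
      using E by (simp add: power2_sum)
    then show "E\<^sup>2 + y \<le> (E + y / (2 * E))^2" by simp
  qed
  also have "y / (2 * E) = \<beta> / (2 * m) * (norm k)^2 + v \<bullet> k"
    using m b E by (simp add: y_def add_divide_distrib) (simp add: E_def)
  finally have s: "sqrt ((norm (k + E *\<^sub>R v))^2 + m\<^sup>2) \<le> E + (\<beta> / (2 * m) * (norm k)^2 + v \<bullet> k)"
    unfolding sq .
  have "E - E * (norm v)^2 = E * \<beta>\<^sup>2" by (simp add: b(2) algebra_simps)
  also have "\<dots> = (E * \<beta>) * \<beta>" by (simp only: power2_eq_square mult.assoc)
  also have "E * \<beta> = m" using b by (simp add: E_def)
  finally have "E - E * (norm v)^2 = m * \<beta>" .
  then show ?thesis
    using s unfolding E_def[symmetric] by (simp add: inner_add_right power2_norm_eq_inner[symmetric] algebra_simps)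
qed

lemma boosted_energy:
  fixes v :: "real ^ 'n"
  assumes v: "norm v < 1" and m: "m > 0" and u: "u \<in> Cc_infinity"
  defines "\<beta> \<equiv> sqrt (1 - (norm v)^2)" and "U \<equiv> \<lambda>x. complex_of_real (u x)"
  defines "\<phi> \<equiv> \<lambda>x. cis (((m / \<beta>) *\<^sub>R v) \<bullet> x) * U x"
  assumes Ua: "U \<in> mass_sphere a"
  shows "\<phi> \<in> mass_sphere a"
    and "energy v m p \<phi> \<le> - (1 / 2) * (1 - \<beta>) * m * a + \<beta> / (4 * m) * grad_norm_sq u
      - 1 / p * Lnorm p U powr p - 1 / 2 * log_term U"
proof -
  define k0 where "k0 = (m / \<beta>) *\<^sub>R v"
  have UH: "U \<in> H_half" and UW: "U \<in> W_half" and Um: "(Lnorm 2 U)^2 = a"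
    using Ua by (auto simp: mass_sphere_def W_half_def)
  have U2: "U \<in> Defs.L2_set" using UH by (rule H_half_L2)
  have um: "u \<in> borel_measurable borel"
    by (rule borel_measurable_continuous_onI[OF Cc_infinityD(1)[OF u]])
  have U1: "integrable lborel U"
    using Cc_infinity_integrable[OF u, of 1] integrable_abs_cancel[of lborel u] um by (simp add: U_def)
  define g where "g = fourier_integral U"
  have g: "is_fourier U g" unfolding g_def by (rule is_fourier_integral[OF U1 U2])
  have g2: "g \<in> Defs.L2_set" using L2_setD_is_fourier[OF g] by auto
  have gi: "integrable lborel (\<lambda>k. norm k * (norm (g k))^2)" using UH H_half_iff[OF g] by simp
  have F: "is_fourier \<phi> (\<lambda>k. g (k - k0))"
    unfolding \<phi>_def k0_def by (rule is_fourier_modulation[OF g])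
  have tr: "integrable lborel (\<lambda>k. norm k * (norm (g (k - k0)))^2)"
    by (rule integrable_norm_weight_translation[OF gi g2])
  have \<phi>H: "\<phi> \<in> H_half" using tr H_half_iff[OF F] by simp
  have n: "norm (\<phi> x) = norm (U x)" for x by (simp add: \<phi>_def norm_mult)
  have same: "Lnorm q \<phi> = Lnorm q U" "log_term \<phi> = log_term U" for q
    by (simp_all add: Lnorm_def log_term_def n)
  show "\<phi> \<in> mass_sphere a"
    using \<phi>H UW Um unfolding mass_sphere_def W_half_def by (simp add: n same)
  let ?w = "\<lambda>k. sqrt ((norm k)^2 + m\<^sup>2) - m - v \<bullet> k"
  have L2t: "(\<lambda>k. g (k - k0)) \<in> Defs.L2_set" using L2_setD_is_fourier[OF F] by auto
  have wi: "integrable lborel (\<lambda>k. ?w k * (norm (g (k - k0)))^2)"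
    by (rule integrable_weight[OF tr L2t _ kinetic_weight(2)[OF v m]]) simp
  have i2: "integrable lborel (\<lambda>k. (norm k)^2 * (norm (g k))^2)"
    unfolding g_def U_def by (rule fourier_gradient(1)[OF u])
  have "kinetic v m \<phi> = (LINT k|lborel. ?w (k + k0) * (norm (g k))^2)"
    unfolding kinetic_eq[OF F] using integral_translation[OF wi, of k0] by (simp add: add.commute)
  also have "\<dots> \<le> (LINT k|lborel. m * (\<beta> - 1) * (norm (g k))^2 + \<beta> / (2 * m) * ((norm k)^2 * (norm (g k))^2))"
  proof (rule integral_mono)
    show "integrable lborel (\<lambda>k. ?w (k + k0) * (norm (g k))^2)"
      using integrable_translation[OF wi, of k0] by (simp add: add.commute)
    show "integrable lborel (\<lambda>k. m * (\<beta> - 1) * (norm (g k))^2 + \<beta> / (2 * m) * ((norm k)^2 * (norm (g k))^2))"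
      by (intro Bochner_Integration.integrable_add integrable_mult_right i2 L2_set_integrable[OF g2])
    show "?w (k + k0) * (norm (g k))^2 \<le> m * (\<beta> - 1) * (norm (g k))^2 + \<beta> / (2 * m) * ((norm k)^2 * (norm (g k))^2)" for k
      using mult_right_mono[OF boosted_symbol_le[OF v m, of k], of "(norm (g k))^2"]
      unfolding \<beta>_def[symmetric] k0_def[symmetric] distrib_right by (simp add: mult.assoc)
  qed
  also have "\<dots> = m * (\<beta> - 1) * a + \<beta> / (2 * m) * (LINT k|lborel. (norm k)^2 * (norm (g k))^2)"
    using i2 L2_set_integrable[OF g2] plancherel_integral[OF g] Um
    by (simp add: Lnorm_2_sq)
  also have "\<dots> \<le> m * (\<beta> - 1) * a + \<beta> / (2 * m) * grad_norm_sq u"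
  proof -
    have "0 \<le> \<beta> / (2 * m)" using m v by (simp add: \<beta>_def abs_square_le_1)
    then show ?thesis
      using mult_left_mono[OF fourier_gradient(2)[OF u], of "\<beta> / (2 * m)"] unfolding g_def U_def by linarith
  qed
  finally have kin: "kinetic v m \<phi> \<le> m * (\<beta> - 1) * a + \<beta> / (2 * m) * grad_norm_sq u" .
  have "\<beta> / (4 * m) * grad_norm_sq u = (\<beta> / (2 * m) * grad_norm_sq u) / 2"
    and "- (1 / 2) * (1 - \<beta>) * m * a = (m * (\<beta> - 1) * a) / 2"
    by (simp_all add: field_simps)
  with kin show "energy v m p \<phi> \<le> - (1 / 2) * (1 - \<beta>) * m * a + \<beta> / (4 * m) * grad_norm_sq u
      - 1 / p * Lnorm p U powr p - 1 / 2 * log_term U"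
    unfolding energy_def same by linarith
qed

text \<open>
  Unfolding the infimum in \<open>m\<^sub>p\<^sup>*(a)\<close> yields \<open>u\<close> with \<open>\<beta> \<parallel>\<nabla>u\<parallel>\<^sup>2 / (4 m) < \<parallel>u\<parallel>\<^sub>p\<^sup>p / p\<close>; if there were no
  admissible \<open>u\<close>, the threshold would be \<open>\<infinity>\<close> and the assumption on \<open>m\<close> void.
\<close>

lemma min_energy_below_threshold:
  fixes v :: "real ^ 'n"
  assumes v: "norm v < 1" and p: "p > 0" and a: "a > 0" and m: "ereal m > m_star v p a"
  shows "min_energy v m p a < ereal (- (1 / 2) * (1 - sqrt (1 - (norm v)^2)) * m * a)"
proof -
  define \<beta> where "\<beta> = sqrt (1 - (norm v)^2)"
  have b: "\<beta> > 0" using v by (simp add: \<beta>_def abs_square_less_1)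
  define c where "c = p * \<beta> / 4"
  have c: "c > 0" using b p by (simp add: c_def)
  let ?ratio = "\<lambda>u :: real ^ 'n \<Rightarrow> real. grad_norm_sq u / Lnorm p (\<lambda>x. complex_of_real (u x)) powr p"
  have "(INF u \<in> X_set a. ereal (?ratio u)) < ereal (m / c)"
  proof (rule ccontr)
    assume "\<not> (INF u \<in> X_set a. ereal (?ratio u)) < ereal (m / c)"
    then have "ereal c * ereal (m / c) \<le> ereal c * (INF u \<in> X_set a. ereal (?ratio u))"
      using c by (intro ereal_mult_left_mono) auto
    moreover have "ereal c * ereal (m / c) = ereal m" using c by simp
    moreover have "m_star v p a = ereal c * (INF u \<in> X_set a. ereal (?ratio u))"
      by (simp add: m_star_def c_def \<beta>_def)
    ultimately show False using m by simp
  qed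
  then obtain u where u: "u \<in> X_set a" and ratio: "?ratio u < m / c"
    by (auto simp: INF_less_iff)
  define U where "U = (\<lambda>x. complex_of_real (u x))"
  have uC: "u \<in> Cc_infinity" and Ua: "U \<in> mass_sphere a" and lt: "log_term U \<ge> 0"
    using u by (auto simp: X_set_def U_def)
  have um [measurable]: "u \<in> borel_measurable borel"
    by (rule borel_measurable_continuous_onI[OF Cc_infinityD(1)[OF uC]])
  define P where "P = Lnorm p U powr p"
  have Pi: "integrable lborel (\<lambda>x. norm (U x) powr p)"
    using Cc_infinity_integrable[OF uC p] by (simp add: U_def)
  have P: "P > 0"
  proof (rule ccontr)
    assume "\<not> P > 0"
    then have "P = 0" by (simp add: P_def)
    then have "AE x in lborel. norm (U x) powr p = 0"
      unfolding P_def Lnorm_powr[OF p] using Pi by (subst (asm) integral_nonneg_eq_0_iff_AE) auto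
    then have "AE x in lborel. (norm (U x))^2 = 0" by eventually_elim simp
    then have "(LINT x|lborel. (norm (U x))^2) = 0" by (rule integral_eq_zero_AE)
    then show False using Ua a by (simp add: mass_sphere_def Lnorm_2_sq)
  qed
  have G: "grad_norm_sq u \<ge> 0"
    unfolding grad_norm_sq_def by (intro integral_nonneg_AE AE_I2 sum_nonneg) auto
  have "0 \<le> ?ratio u" using G by simp
  then have m0: "m > 0" using ratio c by (metis order.strict_trans1 zero_less_divide_iff less_asym)
  have "grad_norm_sq u < m / c * P"
    using ratio P by (simp add: P_def U_def pos_divide_less_eq)
  then have "\<beta> / (4 * m) * grad_norm_sq u < \<beta> / (4 * m) * (m / c * P)"
    using b m0 by (intro mult_strict_left_mono) auto
  also have "\<dots> = 1 / p * P"
    using b m0 p by (simp add: c_def)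
  finally have key: "\<beta> / (4 * m) * grad_norm_sq u < 1 / p * P" .
  note B = boosted_energy[OF v m0 uC, folded \<beta>_def, folded U_def, OF Ua]
  have "min_energy v m p a \<le> ereal (energy v m p (\<lambda>x. cis (((m / \<beta>) *\<^sub>R v) \<bullet> x) * complex_of_real (u x)))"
    unfolding min_energy_def by (rule INF_lower[OF B(1), of "\<lambda>w. ereal (energy v m p w)"])
  also have "\<dots> < ereal (- (1 / 2) * (1 - \<beta>) * m * a)"
    using B(2)[of p] key lt unfolding P_def by simp
  finally show ?thesis by (simp add: \<beta>_def)
qed

theorem mainTheorem4:
  fixes v :: "real ^ 'n"
  assumes "CARD('n) \<ge> 2" and "norm v < 1"
  shows
    "(\<forall>p a m. 2 < p \<and> p < 2 + 2 / real CARD('n) \<and> a > 0 \<and> ereal m > m_star v p a \<longrightarrow>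
        min_energy v m p a < ereal (- (1 / 2) * (1 - sqrt (1 - (norm v)\<^sup>2)) * m * a)) \<and>
     (\<forall>p a m Q. GN_optimizer v Q \<and> p = 2 + 2 / real CARD('n) \<and> 0 < a \<and> a < (Lnorm 2 Q)\<^sup>2 \<and>
          ereal m > m_star v p a \<longrightarrow>
        min_energy v m p a < ereal (- (1 / 2) * (1 - sqrt (1 - (norm v)\<^sup>2)) * m * a)) \<and>
     (\<forall>p a m Q. GN_optimizer v Q \<and> p = 2 + 2 / real CARD('n) \<and> a \<ge> (Lnorm 2 Q)\<^sup>2 \<and> m > 0 \<longrightarrow>
        min_energy v m p a = - \<infinity>) \<and>
     (\<forall>p a m. 2 + 2 / real CARD('n) < p \<and> p \<le> 2 * real CARD('n) / (real CARD('n) - 1) \<and>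
          a > 0 \<and> m > 0 \<longrightarrow>
        min_energy v m p a = - \<infinity>)"
proof (intro conjI allI impI; elim conjE)
  note v = \<open>norm v < 1\<close>
  fix p a m :: real
  {
    assume "2 < p" "a > 0" "ereal m > m_star v p a"
    then show "min_energy v m p a < ereal (- (1 / 2) * (1 - sqrt (1 - (norm v)\<^sup>2)) * m * a)"
      by (intro min_energy_below_threshold[OF v]) auto
  next
    assume "p = 2 + 2 / real CARD('n)" "a > 0" "ereal m > m_star v p a"
    then show "min_energy v m p a < ereal (- (1 / 2) * (1 - sqrt (1 - (norm v)\<^sup>2)) * m * a)"
      by (intro min_energy_below_threshold[OF v]) (auto intro: add_pos_nonneg)
  next
    fix Q assume "GN_optimizer v Q" "p = 2 + 2 / real CARD('n)" "a \<ge> (Lnorm 2 Q)\<^sup>2" "m > 0"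
    then show "min_energy v m p a = - \<infinity>"
      by (rule min_energy_critical[OF v])
  next
    assume "2 + 2 / real CARD('n) < p" "a > 0" "m > 0"
    then show "min_energy v m p a = - \<infinity>"
      by (rule min_energy_supercritical[OF v])
  }
qed

end
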